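(* Let $\mathcal{A}$ be a solid involutive Banach convolution algebra over a lattice $\Lambda\subseteq\mathbb{R}^{2d}$, let $g$ with $V_gg\in W(\mathcal{A})$ generate a tight Gabor frame $\{\pi(\lambda)g\}_{\lambda\in\Lambda}$, and let $\mathcal{Y}$ be a solid Banach sequence space on $\Lambda$ in which finitely supported sequences are dense and such that $\|\mathbf a*\mathbf c\|_{\mathcal{Y}}\le\|\mathbf a\|_{\mathcal{A}}\|\mathbf c\|_{\mathcal{Y}}$ for $\mathbf a\in\mathcal{A}$, $\mathbf c\in\mathcal{Y}$. If $\sigma\in\widetilde M^{\infty,\mathcal{A}}$, then $\sigma^w$ extends to a bounded operator on $M(\mathcal{Y})$ with $$\|\sigma^w\|_{M(\mathcal{Y})\to M(\mathcal{Y})}\le\|M(\sigma)\|_{\mathcal{C}_{\mathcal{A}}}\le\|\sigma\|_{\widetilde M^{\infty,\mathcal{A}}},$$ the last norm computed with window $W(g,g)$.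
   Context: Solid involutive Banach convolution algebra $\mathcal{A}$ over $\Lambda$: Banach space of sequences closed under convolution ($\|\mathbf a*\mathbf b\|\le\|\mathbf a\|\|\mathbf b\|$), under $\mathbf a^*(\lambda)=\overline{\mathbf a(-\lambda)}$ ($\|\mathbf a^*\|\le\|\mathbf a\|$), solid; all $\delta_\lambda\in\mathcal{A}$. Solid sequence space: $\mathbf b\in\mathcal{Y}$, $|\mathbf a|\le|\mathbf b|$ imply $\mathbf a\in\mathcal{Y}$, $\|\mathbf a\|\le\|\mathbf b\|$. $W(\mathcal{A})$: $F\in L^\infty_{loc}(\mathbb{R}^{2d})$ with $(\operatorname{ess\,sup}_{\zeta\in\lambda+C}|F|)_\lambda\in\mathcal{A}$. $\pi(x,\xi)f(t)=e^{2\pi i\xi\cdot t}f(t-x)$, $V_gf(z)=\langle f,\pi(z)g\rangle$; $\mathcal V_\Phi\sigma(z,\zeta)=\langle\sigma,\pi(z,\zeta)\Phi\rangle$; grand symbol $\mathcal G_\Phi(\sigma)(\zeta)=\operatorname{ess\,sup}_z|\mathcal V_\Phi\sigma(z,\zeta)|$; $j(\zeta_1,\zeta_2)=(\zeta_2,-\zeta_1)$; $\widetilde M^{\infty,\mathcal{A}}$: symbols with $\mathcal G_\Phi(\sigma)\circ j\in W(\mathcal{A})$, norm $\|\mathcal G_\Phi(\sigma)\circ j\|_{W(\mathcal{A})}$. Weyl transform $\langle\sigma^wf,h\rangle=\langle\sigma,W(h,f)\rangle$, $W$ the cross-Wigner distribution. Tight Gabor frame: $\|f\|_2^2=\sum_\lambda|\langle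 f,\pi(\lambda)g\rangle|^2$. $M(\sigma)_{\lambda\mu}=\langle\sigma^w\pi(\mu)g,\pi(\lambda)g\rangle$; $\mathbf d_A(\mu)=\sup_\lambda|a_{\lambda,\lambda-\mu}|$, $\|A\|_{\mathcal{C}_{\mathcal{A}}}=\|\mathbf d_A\|_{\mathcal{A}}$. Modulation space $M(\mathcal{Y})$: on $\mathcal L_0$, the finite linear combinations $\sum c_\lambda\pi(\lambda)g$, define $\|f\|_{M(\mathcal{Y})}=\|(\langle f,\pi(\lambda)g\rangle)_{\lambda\in\Lambda}\|_{\mathcal{Y}}$; $M(\mathcal{Y})$ is the completion of $\mathcal L_0$ in this norm. *)

theory Defs
  imports "HOL-Probability.Probability"
begin

definition tfs :: "'c::euclidean_space \<times> 'c \<Rightarrow> ('c \<Rightarrow> complex) \<Rightarrow> 'c \<Rightarrow> complex" where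
  "tfs z f = (\<lambda>t. cis (2 * pi * (snd z \<bullet> t)) * f (t - fst z))"

definition l2_inner :: "('c::euclidean_space \<Rightarrow> complex) \<Rightarrow> ('c \<Rightarrow> complex) \<Rightarrow> complex" where
  "l2_inner f h = (LINT t|lborel. f t * cnj (h t))"

definition l2_normsq :: "('c::euclidean_space \<Rightarrow> complex) \<Rightarrow> real" where
  "l2_normsq f = (LINT t|lborel. (cmod (f t))\<^sup>2)"

definition L2 :: "('c::euclidean_space \<Rightarrow> complex) set" where
  "L2 = {f. f \<in> borel_measurable lborel \<and> integrable lborel (\<lambda>t. (cmod (f t))\<^sup>2)}"

definition stft :: "('c::euclidean_space \<Rightarrow> complex) \<Rightarrow> ('c \<Rightarrow> complex) \<Rightarrow> 'c \<times> 'c \<Rightarrow> complex" where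
  "stft g f z = l2_inner f (tfs z g)"

definition wigner :: "('c::euclidean_space \<Rightarrow> complex) \<Rightarrow> ('c \<Rightarrow> complex) \<Rightarrow> 'c \<times> 'c \<Rightarrow> complex" where
  "wigner f h = (\<lambda>(x, \<xi>). LINT t|lborel.
      f (x + (1/2) *\<^sub>R t) * cnj (h (x - (1/2) *\<^sub>R t)) * cis (- 2 * pi * (\<xi> \<bullet> t)))"

definition gaussian :: "'c::euclidean_space \<Rightarrow> complex" where
  "gaussian t = complex_of_real (exp (- pi * (norm t)\<^sup>2))"

definition S0 :: "('c::euclidean_space \<Rightarrow> complex) set" where
  "S0 = {F. F \<in> L2 \<and> integrable lborel (\<lambda>z. cmod (stft gaussian F z))}"

definition S0_norm :: "('c::euclidean_space \<Rightarrow> complex) \<Rightarrow> real" where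
  "S0_norm F = (LINT z|lborel. cmod (stft gaussian F z))"

text \<open>A distribution sigma in S_0', given through the sesquilinear pairing
  F |-> <sigma, F> (antilinear and bounded on S_0).\<close>
definition S0_dual :: "(('c::euclidean_space \<Rightarrow> complex) \<Rightarrow> complex) set" where
  "S0_dual = {\<sigma>. (\<forall>F\<in>S0. \<forall>G\<in>S0. \<sigma> (\<lambda>w. F w + G w) = \<sigma> F + \<sigma> G)
              \<and> (\<forall>c. \<forall>F\<in>S0. \<sigma> (\<lambda>w. c * F w) = cnj c * \<sigma> F)
              \<and> (\<exists>C. \<forall>F\<in>S0. cmod (\<sigma> F) \<le> C * S0_norm F)}"

text \<open>Weyl transform: <sigma^w f, h> = <sigma, W(h,f)>.\<close>
definition weyl_pair :: "((('c::euclidean_space) \<times> 'c \<Rightarrow> complex) \<Rightarrow> complex)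
     \<Rightarrow> ('c \<Rightarrow> complex) \<Rightarrow> ('c \<Rightarrow> complex) \<Rightarrow> complex" where
  "weyl_pair \<sigma> f h = \<sigma> (wigner h f)"

definition lat :: "('b::euclidean_space \<Rightarrow> 'b) \<Rightarrow> 'b set" where
  "lat T = T ` {x. \<forall>i\<in>Basis. x \<bullet> i \<in> \<int>}"

definition fund :: "('b::euclidean_space \<Rightarrow> 'b) \<Rightarrow> 'b set" where
  "fund T = T ` {x. \<forall>i\<in>Basis. 0 \<le> x \<bullet> i \<and> x \<bullet> i < 1}"

definition delta :: "'b \<Rightarrow> 'b \<Rightarrow> complex" where
  "delta l = (\<lambda>x. if x = l then 1 else 0)"

definition conv_ok :: "'b::ab_group_add set \<Rightarrow> ('b \<Rightarrow> complex) \<Rightarrow> ('b \<Rightarrow> complex) \<Rightarrow> bool" where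
  "conv_ok \<Lambda> a b = (\<forall>x\<in>\<Lambda>. (\<lambda>\<mu>. a \<mu> * b (x - \<mu>)) summable_on \<Lambda>)"

definition conv :: "'b::ab_group_add set \<Rightarrow> ('b \<Rightarrow> complex) \<Rightarrow> ('b \<Rightarrow> complex) \<Rightarrow> 'b \<Rightarrow> complex" where
  "conv \<Lambda> a b = (\<lambda>x. if x \<in> \<Lambda> then (\<Sum>\<^sub>\<infinity>\<mu>\<in>\<Lambda>. a \<mu> * b (x - \<mu>)) else 0)"

definition invol :: "('b::ab_group_add \<Rightarrow> complex) \<Rightarrow> 'b \<Rightarrow> complex" where
  "invol a = (\<lambda>x. cnj (a (- x)))"

text \<open>Banach space of sequences on Lambda (sequences are functions vanishing off Lambda).\<close>
definition banach_seq_space :: "'b set \<Rightarrow> ('b \<Rightarrow> complex) set \<Rightarrow> (('b \<Rightarrow> complex) \<Rightarrow> real) \<Rightarrow> bool" where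
  "banach_seq_space \<Lambda> X n \<longleftrightarrow>
     (\<forall>a\<in>X. \<forall>x. x \<notin> \<Lambda> \<longrightarrow> a x = 0) \<and>
     (\<lambda>_. 0) \<in> X \<and>
     (\<forall>a\<in>X. \<forall>b\<in>X. (\<lambda>x. a x + b x) \<in> X) \<and>
     (\<forall>c. \<forall>a\<in>X. (\<lambda>x. c * a x) \<in> X) \<and>
     (\<forall>a\<in>X. 0 \<le> n a) \<and>
     (\<forall>a\<in>X. n a = 0 \<longleftrightarrow> a = (\<lambda>_. 0)) \<and>
     (\<forall>c. \<forall>a\<in>X. n (\<lambda>x. c * a x) = cmod c * n a) \<and>
     (\<forall>a\<in>X. \<forall>b\<in>X. n (\<lambda>x. a x + b x) \<le> n a + n b) \<and>
     (\<forall>u::nat \<Rightarrow> 'b \<Rightarrow> complex. (\<forall>k. u k \<in> X) \<and>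
         (\<forall>e>0. \<exists>N. \<forall>m\<ge>N. \<forall>k\<ge>N. n (\<lambda>x. u m x - u k x) < e) \<longrightarrow>
         (\<exists>a\<in>X. (\<lambda>k. n (\<lambda>x. u k x - a x)) \<longlonglongrightarrow> 0))"

definition solid :: "'b set \<Rightarrow> ('b \<Rightarrow> complex) set \<Rightarrow> (('b \<Rightarrow> complex) \<Rightarrow> real) \<Rightarrow> bool" where
  "solid \<Lambda> X n \<longleftrightarrow> (\<forall>a b. b \<in> X \<and> (\<forall>x. x \<notin> \<Lambda> \<longrightarrow> a x = 0) \<and> (\<forall>x. cmod (a x) \<le> cmod (b x))
       \<longrightarrow> a \<in> X \<and> n a \<le> n b)"

definition solid_inv_conv_alg :: "'b::ab_group_add set \<Rightarrow> ('b \<Rightarrow> complex) set \<Rightarrow> (('b \<Rightarrow> complex) \<Rightarrow> real) \<Rightarrow> bool" where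
  "solid_inv_conv_alg \<Lambda> A n \<longleftrightarrow>
     banach_seq_space \<Lambda> A n \<and> solid \<Lambda> A n \<and>
     (\<forall>a\<in>A. \<forall>b\<in>A. conv_ok \<Lambda> a b \<and> conv \<Lambda> a b \<in> A \<and> n (conv \<Lambda> a b) \<le> n a * n b) \<and>
     (\<forall>a\<in>A. invol a \<in> A \<and> n (invol a) \<le> n a) \<and>
     (\<forall>l\<in>\<Lambda>. delta l \<in> A)"

definition locsup :: "('b::euclidean_space \<Rightarrow> 'b) \<Rightarrow> ('b \<Rightarrow> ereal) \<Rightarrow> 'b \<Rightarrow> ereal" where
  "locsup T F l = esssup (restrict_space lborel ((\<lambda>c. l + c) ` fund T)) F"

definition amalg_seq :: "('b::euclidean_space \<Rightarrow> 'b) \<Rightarrow> ('b \<Rightarrow> ereal) \<Rightarrow> 'b \<Rightarrow> complex" where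
  "amalg_seq T F = (\<lambda>l. if l \<in> lat T then complex_of_real (real_of_ereal (locsup T F l)) else 0)"

text \<open>F (given through |F|, as a nonnegative ereal function) belongs to W(A).\<close>
definition in_WA :: "('b::euclidean_space \<Rightarrow> 'b) \<Rightarrow> ('b \<Rightarrow> complex) set \<Rightarrow> ('b \<Rightarrow> ereal) \<Rightarrow> bool" where
  "in_WA T A F \<longleftrightarrow> F \<in> borel_measurable lborel \<and> (\<forall>l\<in>lat T. locsup T F l \<noteq> \<infinity>)
      \<and> amalg_seq T F \<in> A"

definition WA_norm :: "('b::euclidean_space \<Rightarrow> 'b) \<Rightarrow> (('b \<Rightarrow> complex) \<Rightarrow> real) \<Rightarrow> ('b \<Rightarrow> ereal) \<Rightarrow> real" where
  "WA_norm T n F = n (amalg_seq T F)"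

text \<open>G_Phi(sigma)(zeta) = ess sup_z |V_Phi sigma(z,zeta)|, V_Phi sigma(z,zeta) = <sigma, pi(z,zeta) Phi>.\<close>
definition grand_symbol :: "((('c::euclidean_space) \<times> 'c \<Rightarrow> complex) \<Rightarrow> complex)
     \<Rightarrow> ('c \<times> 'c \<Rightarrow> complex) \<Rightarrow> 'c \<times> 'c \<Rightarrow> ereal" where
  "grand_symbol \<sigma> \<Phi> \<zeta> = esssup lborel (\<lambda>z. ereal (cmod (\<sigma> (tfs (z, \<zeta>) \<Phi>))))"

definition jmap :: "'c::euclidean_space \<times> 'c \<Rightarrow> 'c \<times> 'c" where
  "jmap \<zeta> = (snd \<zeta>, - fst \<zeta>)"

definition gabor_matrix :: "((('c::euclidean_space) \<times> 'c \<Rightarrow> complex) \<Rightarrow> complex)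
     \<Rightarrow> ('c \<Rightarrow> complex) \<Rightarrow> 'c \<times> 'c \<Rightarrow> 'c \<times> 'c \<Rightarrow> complex" where
  "gabor_matrix \<sigma> g l \<mu> = weyl_pair \<sigma> (tfs \<mu> g) (tfs l g)"

definition gabor_diag :: "('c::euclidean_space \<times> 'c) set \<Rightarrow> ((('c) \<times> 'c \<Rightarrow> complex) \<Rightarrow> complex)
     \<Rightarrow> ('c \<Rightarrow> complex) \<Rightarrow> 'c \<times> 'c \<Rightarrow> complex" where
  "gabor_diag \<Lambda> \<sigma> g = (\<lambda>\<mu>. if \<mu> \<in> \<Lambda>
      then complex_of_real (SUP l\<in>\<Lambda>. cmod (gabor_matrix \<sigma> g l (l - \<mu>))) else 0)"

definition L0 :: "('c::euclidean_space \<times> 'c) set \<Rightarrow> ('c \<Rightarrow> complex) \<Rightarrow> ('c \<Rightarrow> complex) set" where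
  "L0 \<Lambda> g = {f. \<exists>S c. finite S \<and> S \<subseteq> \<Lambda> \<and> f = (\<lambda>t. \<Sum>l\<in>S. c l * tfs l g t)}"

definition coeff :: "('c::euclidean_space \<times> 'c) set \<Rightarrow> ('c \<Rightarrow> complex) \<Rightarrow> ('c \<Rightarrow> complex) \<Rightarrow> 'c \<times> 'c \<Rightarrow> complex" where
  "coeff \<Lambda> g f = (\<lambda>l. if l \<in> \<Lambda> then l2_inner f (tfs l g) else 0)"

definition weyl_coeff :: "('c::euclidean_space \<times> 'c) set \<Rightarrow> ((('c) \<times> 'c \<Rightarrow> complex) \<Rightarrow> complex)
    \<Rightarrow> ('c \<Rightarrow> complex) \<Rightarrow> ('c \<Rightarrow> complex) \<Rightarrow> 'c \<times> 'c \<Rightarrow> complex" where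
  "weyl_coeff \<Lambda> \<sigma> g f = (\<lambda>l. if l \<in> \<Lambda> then weyl_pair \<sigma> f (tfs l g) else 0)"

definition tight_gabor_frame :: "('c::euclidean_space \<times> 'c) set \<Rightarrow> ('c \<Rightarrow> complex) \<Rightarrow> bool" where
  "tight_gabor_frame \<Lambda> g \<longleftrightarrow> g \<in> L2 \<and>
     (\<forall>f\<in>L2. (\<lambda>l. (cmod (l2_inner f (tfs l g)))\<^sup>2) summable_on \<Lambda> \<and>
              l2_normsq f = (\<Sum>\<^sub>\<infinity>l\<in>\<Lambda>. (cmod (l2_inner f (tfs l g)))\<^sup>2))"

end

theory Submission
  imports Defs
begin

text \<open>
  Every solid involutive convolution algebra embeds into \<open>\<ell>\<^sup>1\<close>, so \<open>V\<^sub>g g \<in> W(\<A>)\<close> is integrable.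
  A tight frame cannot annihilate the Gaussian, and pairing \<open>V\<^sub>g g\<close> with a Gaussian kernel (Moyal's
  formula) then shows that \<open>g\<close> lies in Feichtinger's algebra \<open>S\<^sub>0\<close>. Since the Wigner distribution is a bounded
  sesquilinear map \<open>S\<^sub>0 \<times> S\<^sub>0 \<rightarrow> S\<^sub>0\<close> and time-frequency shifts act continuously on \<open>S\<^sub>0\<close>, the function
  \<open>\<V>\<^sub>\<Phi> \<sigma>\<close> with \<open>\<Phi> = W(g, g)\<close> is continuous. Covariance of the Wigner distribution gives
  \<open>|M(\<sigma>)\<^sub>\<lambda>\<^sub>\<mu>| = |\<V>\<^sub>\<Phi> \<sigma>((\<lambda> + \<mu>)/2, j(\<lambda> - \<mu>))|\<close>, and continuity lets essential suprema dominate these point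
  values, hence the sequence \<open>\<d>\<close> of diagonal suprema of \<open>M(\<sigma>)\<close> is bounded by the local suprema of the grand symbol. Frame expansions converge in
  \<open>S\<^sub>0\<close>, so the coefficients of \<open>\<sigma>\<^sup>w f\<close> are \<open>M(\<sigma>)\<close> applied to those of \<open>f\<close>, dominated by a convolution
  with \<open>\<d>\<close>; they are fixed by the Gram matrix, so that finite sequences approximating them yield the
  approximants in \<open>\<L>\<^sub>0\<close>.\<close>

section \<open>Square-integrable functions and time-frequency shifts\<close>

text \<open>Since \<open>\<sigma>\<close> is only a bounded antilinear functional on
  \<open>S0\<close>, \<open>weyl_pair\<close> can be controlled only where Wigner distributions are
  known to lie in \<open>S0\<close>; this is why so much of the proof concerns \<open>S0\<close>
  before any matrix appears. Two Gaussian identities carry that part: the parallelogram law makes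
  the STFT of a Wigner distribution factor exactly for the window \<open>gau 2\<close>, and
  completing the square recovers the standard window as an average of translates of that one. The
  embedding into l^1 compares growth rates: sumsets of a finite set of lattice points grow
  polynomially, convolution powers at most geometrically. Polynomial factors vanish in the limit, so
  finite sums are bounded by the norm with constant exactly 1. Frame vectors need not be orthogonal,
  so the coefficients of a finite combination are not the scalars that built it. The Gram matrix
  converts one into the other; its entries are dominated by local suprema of
  \<open>stft g g\<close>, so it acts on \<open>Y\<close> by the same convolution argument as the
  Weyl matrix.\<close>

abbreviation nn_integral_lborel :: "('a::euclidean_space \<Rightarrow> ennreal) \<Rightarrow> ennreal"  (binder \<open>LBINT\<^sup>+\<close> 10) where
  "nn_integral_lborel f \<equiv> integral\<^sup>N lborel f"

lemma nn_integral_lborel_affine: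
  fixes f :: "'a::euclidean_space \<Rightarrow> ennreal"
  assumes [measurable]: "f \<in> borel_measurable borel" and c: "c \<noteq> 0"
  shows "(LBINT\<^sup>+x. f x) = ennreal (\<bar>c\<bar> ^ DIM('a)) * (LBINT\<^sup>+x. f (t + c *\<^sub>R x))"
  by (subst lborel_affine[OF c, of t])
     (simp add: nn_integral_density nn_integral_distr nn_integral_cmult ennreal_power)

lemma lborel_integrable_affine:
  fixes f :: "'a::euclidean_space \<Rightarrow> 'b::{banach, second_countable_topology}"
  assumes f: "integrable lborel f" and c: "c \<noteq> 0"
  shows "integrable lborel (\<lambda>x. f (t + c *\<^sub>R x))"
proof -
  have [measurable]: "f \<in> borel_measurable borel" using f by auto
  have "(LBINT\<^sup>+x. norm (f x)) < \<infinity>" using f by (simp add: integrable_iff_bounded)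
  then have "(LBINT\<^sup>+x. norm (f (t + c *\<^sub>R x))) < \<infinity>"
    using nn_integral_lborel_affine[of "\<lambda>x. ennreal (norm (f x))" c t] c
    by (auto simp: ennreal_mult_less_top)
  then show ?thesis by (auto simp: integrable_iff_bounded)
qed

lemma integrable_dominated:
  fixes f :: "'a \<Rightarrow> 'b::{banach, second_countable_topology}" and g :: "'a \<Rightarrow> real"
  assumes "integrable M g" "f \<in> borel_measurable M" and le: "\<And>x. norm (f x) \<le> g x"
  shows "integrable M f"
  using assms(1,2) by (rule Bochner_Integration.integrable_bound) (auto intro!: AE_I2 order.trans[OF le])

lemma lborel_integral_affine:
  fixes f :: "'a::euclidean_space \<Rightarrow> 'b::{banach, second_countable_topology}"
  assumes [measurable]: "f \<in> borel_measurable borel" and c: "c \<noteq> 0"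
  shows "(LBINT x. f x) = \<bar>c\<bar> ^ DIM('a) *\<^sub>R (LBINT x. f (t + c *\<^sub>R x))"
proof -
  have "(LBINT x. f x) = (\<integral>x. f x \<partial>(density (distr lborel borel (\<lambda>x. t + c *\<^sub>R x)) (\<lambda>_. ennreal (\<bar>c\<bar> ^ DIM('a)))))"
    by (subst lborel_affine[OF c, of t]) (simp add: ennreal_power)
  also have "\<dots> = \<bar>c\<bar> ^ DIM('a) *\<^sub>R (LBINT x. f (t + c *\<^sub>R x))"
    by (subst integral_density) (auto simp: integral_distr)
  finally show ?thesis .
qed

lemma lborel_integral_shift:
  fixes f :: "'a::euclidean_space \<Rightarrow> 'b::{banach, second_countable_topology}"
  assumes "f \<in> borel_measurable borel"
  shows "(LBINT x. f (x - t)) = (LBINT x. f x)"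
  using lborel_integral_affine[OF assms, of 1 "-t"] by simp

lemma lborel_integrable_shift:
  fixes f :: "'a::euclidean_space \<Rightarrow> 'b::{banach, second_countable_topology}"
  assumes "integrable lborel f"
  shows "integrable lborel (\<lambda>x. f (x - t))"
  using lborel_integrable_affine[OF assms, of 1 "-t"] by simp

lemma nn_integral_lborel_shift:
  fixes f :: "'a::euclidean_space \<Rightarrow> ennreal"
  assumes "f \<in> borel_measurable borel"
  shows "(LBINT\<^sup>+x. f (x - t)) = (LBINT\<^sup>+x. f x)"
  using nn_integral_lborel_affine[OF assms, of 1 "-t"] by simp

section \<open>Iterated integrals and measurability on product spaces\<close>

lemma nn_integral_lborel_pair:
  fixes f :: "'a::euclidean_space \<times> 'b::euclidean_space \<Rightarrow> ennreal"
  assumes "f \<in> borel_measurable borel"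
  shows "(LBINT\<^sup>+z. f z) = (LBINT\<^sup>+x. LBINT\<^sup>+y. f (x, y))"
  using assms by (subst lborel_prod[symmetric], subst lborel.nn_integral_fst[symmetric])
    (auto simp: lborel_prod)

lemma nn_integral_lborel_swap:
  fixes f :: "'a::euclidean_space \<times> 'b::euclidean_space \<Rightarrow> ennreal"
  assumes "f \<in> borel_measurable borel"
  shows "(LBINT\<^sup>+x. LBINT\<^sup>+y. f (x, y)) = (LBINT\<^sup>+y. LBINT\<^sup>+x. f (x, y))"
  using assms by (intro lborel_pair.Fubini'[symmetric]) (auto simp: lborel_prod)

lemma borel_measurable_cis [measurable]:
  assumes "f \<in> borel_measurable M"
  shows "(\<lambda>x. cis (f x)) \<in> borel_measurable M"
proof -
  have "continuous_on UNIV cis" by (intro continuous_intros)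
  from measurable_compose[OF assms borel_measurable_continuous_onI[OF this]] show ?thesis .
qed

lemma borel_measurable_cnj [measurable]:
  assumes "f \<in> borel_measurable M"
  shows "(\<lambda>x. cnj (f x)) \<in> borel_measurable M"
proof -
  have "continuous_on UNIV cnj" by (intro continuous_intros)
  from measurable_compose[OF assms borel_measurable_continuous_onI[OF this]] show ?thesis .
qed

text \<open>Phase space is a product type with its own Borel algebra rather than a product measure
  space, so its projections are handled through continuity.\<close>

lemma borel_measurable_fst_prod [measurable (raw)]:
  assumes "f \<in> borel_measurable M"
  shows "(\<lambda>x. fst (f x :: 'a::topological_space \<times> 'b::topological_space)) \<in> borel_measurable M"
proof -
  have "continuous_on UNIV (fst :: 'a \<times> 'b \<Rightarrow> 'a)" by (intro continuous_intros)
  from measurable_compose[OF assms borel_measurable_continuous_onI[OF this]] show ?thesis .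
qed

lemma borel_measurable_snd_prod [measurable (raw)]:
  assumes "f \<in> borel_measurable M"
  shows "(\<lambda>x. snd (f x :: 'a::topological_space \<times> 'b::topological_space)) \<in> borel_measurable M"
proof -
  have "continuous_on UNIV (snd :: 'a \<times> 'b \<Rightarrow> 'b)" by (intro continuous_intros)
  from measurable_compose[OF assms borel_measurable_continuous_onI[OF this]] show ?thesis .
qed

lemma measurable_lborel_integral:
  fixes f :: "'a::euclidean_space \<times> 'b::euclidean_space \<Rightarrow> 'c::{banach, second_countable_topology}"
  assumes "f \<in> borel_measurable borel"
  shows "(\<lambda>x. LBINT y. f (x, y)) \<in> borel_measurable borel"
proof -
  have "(\<lambda>(x, y). f (x, y)) \<in> borel_measurable (lborel \<Otimes>\<^sub>M lborel)"
    using assms by (simp add: lborel_prod)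
  from lborel.borel_measurable_lebesgue_integral[OF this] show ?thesis by simp
qed

lemma measurable_lborel_nn_integral:
  fixes f :: "'a::euclidean_space \<times> 'b::euclidean_space \<Rightarrow> ennreal"
  assumes "f \<in> borel_measurable borel"
  shows "(\<lambda>x. LBINT\<^sup>+y. f (x, y)) \<in> borel_measurable borel"
proof -
  have "f \<in> borel_measurable (lborel \<Otimes>\<^sub>M lborel)"
    using assms by (simp add: lborel_prod)
  from lborel.borel_measurable_nn_integral_fst[OF this] show ?thesis by simp
qed

section \<open>Square-integrable functions and their inner product\<close>

lemma L2_measurable: "f \<in> L2 \<Longrightarrow> f \<in> borel_measurable borel"
  by (simp add: L2_def)

lemma L2_integrable: "f \<in> L2 \<Longrightarrow> integrable lborel (\<lambda>t. (cmod (f t))\<^sup>2)"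
  by (simp add: L2_def)

text \<open>Sharp up to a factor 1/2; the factor given away here reappears as the 2 in
  \<open>fourier_L2_bound\<close>.\<close>

lemma cmod_mult_le_squares: "cmod (a * b) \<le> (cmod a)\<^sup>2 + (cmod b)\<^sup>2"
proof -
  have "0 \<le> cmod a * cmod b" by simp
  then show ?thesis
    using sum_squares_bound[of "cmod a" "cmod b"] unfolding norm_mult mult.assoc by linarith
qed

lemma L2_mult_integrable:
  assumes f: "f \<in> L2" and h: "h \<in> L2"
  shows "integrable lborel (\<lambda>t. f t * h t)"
proof (rule Bochner_Integration.integrable_bound)
  show "integrable lborel (\<lambda>t. (cmod (f t))\<^sup>2 + (cmod (h t))\<^sup>2)"
    using L2_integrable[OF f] L2_integrable[OF h] by simp
  show "(\<lambda>t. f t * h t) \<in> borel_measurable lborel"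
    using L2_measurable[OF f] L2_measurable[OF h] by simp
  show "AE t in lborel. norm (f t * h t) \<le> norm ((cmod (f t))\<^sup>2 + (cmod (h t))\<^sup>2)"
    using cmod_mult_le_squares by (auto intro!: AE_I2)
qed

lemma L2_cnj: "f \<in> L2 \<Longrightarrow> (\<lambda>t. cnj (f t)) \<in> L2"
  by (auto simp: L2_def)

lemma L2_inner_integrable:
  "f \<in> L2 \<Longrightarrow> h \<in> L2 \<Longrightarrow> integrable lborel (\<lambda>t. f t * cnj (h t))"
  using L2_mult_integrable L2_cnj by blast

lemma L2_scale: "f \<in> L2 \<Longrightarrow> (\<lambda>t. c * f t) \<in> L2"
  by (auto simp: L2_def norm_mult power_mult_distrib)

lemma L2_add:
  assumes f: "f \<in> L2" and h: "h \<in> L2"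
  shows "(\<lambda>t. f t + h t) \<in> L2"
proof -
  note [measurable] = L2_measurable[OF f] L2_measurable[OF h]
  have "integrable lborel (\<lambda>t. (cmod (f t + h t))\<^sup>2)"
  proof (rule Bochner_Integration.integrable_bound)
    show "integrable lborel (\<lambda>t. 2 * (cmod (f t))\<^sup>2 + 2 * (cmod (h t))\<^sup>2)"
      using L2_integrable[OF f] L2_integrable[OF h] by simp
    have "(cmod (f t + h t))\<^sup>2 \<le> 2 * (cmod (f t))\<^sup>2 + 2 * (cmod (h t))\<^sup>2" for t
    proof -
      have "(cmod (f t + h t))\<^sup>2 \<le> (cmod (f t) + cmod (h t))\<^sup>2"
        by (intro power_mono norm_triangle_ineq) auto
      also have "\<dots> \<le> 2 * (cmod (f t))\<^sup>2 + 2 * (cmod (h t))\<^sup>2"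
        using sum_squares_bound[of "cmod (f t)" "cmod (h t)"] by (simp add: power2_sum)
      finally show ?thesis .
    qed
    then show "AE t in lborel. norm ((cmod (f t + h t))\<^sup>2) \<le> norm (2 * (cmod (f t))\<^sup>2 + 2 * (cmod (h t))\<^sup>2)"
      by (auto intro!: AE_I2)
  qed simp
  then show ?thesis by (simp add: L2_def)
qed

lemma L2_zero: "(\<lambda>t. 0) \<in> L2"
  by (simp add: L2_def)

lemma L2_diff: "f \<in> L2 \<Longrightarrow> h \<in> L2 \<Longrightarrow> (\<lambda>t. f t - h t) \<in> L2"
  using L2_add[of f "\<lambda>t. - 1 * h t"] L2_scale[of h "- 1"] by simp

section \<open>Time-frequency shifts and the short-time Fourier transform\<close>

lemma tfs_measurable [measurable]:
  assumes [measurable]: "f \<in> borel_measurable borel"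
  shows "tfs z f \<in> borel_measurable borel"
  unfolding tfs_def by measurable

lemma cmod_tfs: "cmod (tfs z f t) = cmod (f (t - fst z))"
  by (simp add: tfs_def norm_mult)

lemma L2_tfs:
  assumes f: "f \<in> L2" shows "tfs z f \<in> L2"
  using L2_measurable[OF f] lborel_integrable_shift[OF L2_integrable[OF f], of "fst z"]
  by (simp add: L2_def cmod_tfs tfs_measurable)

text \<open>Time-frequency shifts form only a projective representation of phase space; the extra
  factor is its cocycle.\<close>

lemma tfs_tfs: "tfs w (tfs z f) = (\<lambda>t. cis (- 2 * pi * (snd z \<bullet> fst w)) * tfs (w + z) f t)"
proof (rule ext)
  fix t
  have "cis (2 * pi * (snd w \<bullet> t)) * cis (2 * pi * (snd z \<bullet> (t - fst w)))
      = cis (- 2 * pi * (snd z \<bullet> fst w)) * cis (2 * pi * (snd (w + z) \<bullet> t))"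
    by (simp add: cis_mult inner_diff_right inner_add_left algebra_simps)
  then show "tfs w (tfs z f) t = cis (- 2 * pi * (snd z \<bullet> fst w)) * tfs (w + z) f t"
    by (simp add: tfs_def diff_diff_eq flip: mult.assoc)
qed

lemma l2_inner_tfs_tfs:
  assumes f: "f \<in> L2" and h: "h \<in> L2"
  shows "l2_inner (tfs w f) (tfs w h) = l2_inner f h"
proof -
  note [measurable] = L2_measurable[OF f] L2_measurable[OF h]
  have "tfs w f t * cnj (tfs w h t) = (f (t - fst w) * cnj (h (t - fst w)))" for t
    by (simp add: tfs_def cis_cnj cis_mult)
  then show ?thesis unfolding l2_inner_def
    using lborel_integral_shift[of "\<lambda>t. f t * cnj (h t)" "fst w"] by simp
qed

lemma l2_inner_add_left: "f \<in> L2 \<Longrightarrow> h \<in> L2 \<Longrightarrow> u \<in> L2 \<Longrightarrow>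
  l2_inner (\<lambda>t. f t + h t) u = l2_inner f u + l2_inner h u"
  by (simp add: l2_inner_def distrib_right L2_inner_integrable)

lemma l2_inner_scale_left: "l2_inner (\<lambda>t. c * f t) u = c * l2_inner f u"
  by (simp add: l2_inner_def mult.assoc)

lemma l2_inner_cnj: "cnj (l2_inner f u) = l2_inner u f"
proof -
  have "cnj (l2_inner f u) = (LBINT t. cnj (f t * cnj (u t)))"
    unfolding l2_inner_def by (rule Bochner_Integration.integral_cnj[symmetric])
  then show ?thesis by (simp add: l2_inner_def mult.commute)
qed

lemma l2_inner_scale_right: "l2_inner f (\<lambda>t. c * u t) = cnj c * l2_inner f u"
  using l2_inner_scale_left[of c u f] l2_inner_cnj[of "\<lambda>t. c * u t" f] l2_inner_cnj[of u f] by simp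

lemma l2_inner_add_right: "f \<in> L2 \<Longrightarrow> h \<in> L2 \<Longrightarrow> u \<in> L2 \<Longrightarrow>
  l2_inner u (\<lambda>t. f t + h t) = l2_inner u f + l2_inner u h"
  using l2_inner_add_left[of f h u] l2_inner_cnj[of "\<lambda>t. f t + h t" u] l2_inner_cnj[of f u] l2_inner_cnj[of h u]
  by simp

lemma l2_inner_diff_left: "f \<in> L2 \<Longrightarrow> h \<in> L2 \<Longrightarrow> u \<in> L2 \<Longrightarrow>
  l2_inner (\<lambda>t. f t - h t) u = l2_inner f u - l2_inner h u"
  by (simp add: l2_inner_def left_diff_distrib L2_inner_integrable)

lemma l2_inner_sum_left: "(\<And>m. m \<in> S \<Longrightarrow> F m \<in> L2) \<Longrightarrow> u \<in> L2 \<Longrightarrow>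
  l2_inner (\<lambda>t. \<Sum>m\<in>S. F m t) u = (\<Sum>m\<in>S. l2_inner (F m) u)"
  by (simp add: l2_inner_def sum_distrib_right L2_inner_integrable)

lemma l2_normsq_nonneg: "0 \<le> l2_normsq f"
  by (simp add: l2_normsq_def)

lemma l2_inner_Cauchy_Schwarz:
  assumes f: "f \<in> L2" and h: "h \<in> L2"
  shows "(cmod (l2_inner f h))\<^sup>2 \<le> l2_normsq f * l2_normsq h"
proof -
  note [measurable] = L2_measurable[OF f] L2_measurable[OF h]
  let ?I = "LBINT t. cmod (f t * cnj (h t))"
  have "(cmod (l2_inner f h))\<^sup>2 \<le> ?I\<^sup>2"
    unfolding l2_inner_def by (intro power_mono integral_norm_bound) auto
  moreover have "?I\<^sup>2 \<le> l2_normsq f * l2_normsq h"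
  proof -
    have i: "integrable lborel (\<lambda>t. cmod (f t * cnj (h t)))"
      using L2_inner_integrable[OF f h] by simp
    have "ennreal (?I\<^sup>2) = (LBINT\<^sup>+t. ennreal (cmod (f t)) * ennreal (cmod (h t)))\<^sup>2"
      using nn_integral_eq_integral[OF i]
      by (simp add: norm_mult ennreal_mult flip: ennreal_power)
    also have "\<dots> \<le> (LBINT\<^sup>+t. ennreal (cmod (f t))^2) * (LBINT\<^sup>+t. ennreal (cmod (h t))^2)"
      by (rule Cauchy_Schwarz_nn_integral) auto
    also have "\<dots> = ennreal (l2_normsq f * l2_normsq h)"
      using nn_integral_eq_integral[OF L2_integrable[OF f]] nn_integral_eq_integral[OF L2_integrable[OF h]]
      by (simp add: ennreal_power l2_normsq_def ennreal_mult)
    finally show ?thesis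
      by (subst (asm) ennreal_le_iff) (auto intro!: mult_nonneg_nonneg l2_normsq_nonneg)
  qed
  ultimately show ?thesis by linarith
qed

lemma stft_tfs:
  assumes f: "f \<in> L2" and h: "h \<in> L2"
  shows "stft h (tfs w f) z = cis (- 2 * pi * ((snd z - snd w) \<bullet> fst w)) * stft h f (z - w)"
proof -
  \<comment> \<open>Extracting \<open>tfs w\<close> from the window lets unitarity
    (\<open>l2_inner_tfs_tfs\<close>) cancel it against the shift of \<open>f\<close>.\<close>
  have "tfs z h = (\<lambda>t. cis (2 * pi * ((snd z - snd w) \<bullet> fst w)) * tfs w (tfs (z - w) h) t)"
    by (simp add: tfs_tfs cis_mult flip: mult.assoc)
  then show ?thesis
    using l2_inner_tfs_tfs[OF f L2_tfs[OF h], of w "z - w"]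
    by (simp add: stft_def l2_inner_scale_right cis_cnj)
qed

lemma stft_window_tfs:
  "stft (tfs w h) f z = cis (2 * pi * (snd w \<bullet> fst z)) * stft h f (z + w)"
  by (simp add: stft_def tfs_tfs l2_inner_scale_right cis_cnj)

lemma stft_measurable:
  fixes f h :: "'a::euclidean_space \<Rightarrow> complex"
  assumes [measurable]: "f \<in> borel_measurable borel" "h \<in> borel_measurable borel"
  shows "stft h f \<in> borel_measurable borel"
proof -
  have "(\<lambda>p::('a \<times> 'a) \<times> 'a. f (snd p) * cnj (cis (2 * pi * (snd (fst p) \<bullet> snd p)) * h (snd p - fst (fst p))))
      \<in> borel_measurable borel"
    by measurable
  from measurable_lborel_integral[OF this] show ?thesis
    by (simp add: stft_def[abs_def] l2_inner_def tfs_def)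
qed

section \<open>Gaussians\<close>

text \<open>Several widths interact: 1 is the window that defines \<open>S0\<close>, the pair 2 and
  1/2 arises from midpoints and differences and from Fourier transforms, and 4 from the product of
  two Gaussians of width 2.\<close>

definition gau :: "real \<Rightarrow> 'a::euclidean_space \<Rightarrow> real" where
  "gau a t = exp (- pi * a * (norm t)\<^sup>2)"

lemma gau_nonneg [simp]: "0 \<le> gau a t" by (simp add: gau_def)

lemma gau_le_1: "0 \<le> a \<Longrightarrow> gau a t \<le> 1"
  by (simp add: gau_def)

lemma gau_measurable [measurable (raw)]:
  "f \<in> borel_measurable M \<Longrightarrow> (\<lambda>x. gau a (f x)) \<in> borel_measurable M"
  unfolding gau_def by measurable

lemma gaussian_eq_gau: "gaussian t = complex_of_real (gau 1 t)"
  by (simp add: gaussian_def gau_def)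

lemma gau_uminus [simp]: "gau a (- t) = gau a t"
  by (simp add: gau_def)

lemma gau_minus_commute: "gau a (x - y) = gau a (y - x)"
  by (simp add: gau_def norm_minus_commute)

lemma gau_Pair: "gau a (x, y) = gau a x * gau a y"
  by (simp add: gau_def norm_Pair algebra_simps flip: exp_add)

lemma gau_prod: "gau a t = (\<Prod>b\<in>Basis. gau a (t \<bullet> b))"
proof -
  have "(norm t)\<^sup>2 = (\<Sum>b\<in>Basis. (t \<bullet> b)\<^sup>2)"
    by (subst power2_norm_eq_inner, subst euclidean_inner) (simp add: power2_eq_square)
  then show ?thesis
    by (simp add: gau_def exp_sum[symmetric] sum_distrib_left)
qed

section \<open>Integrals and Fourier transforms of Gaussians\<close>

lemma gau_real_eq_density:
  assumes "0 < a"
  shows "gau a (x::real) = sqrt (2 * pi) * std_normal_density (0 + sqrt (2 * pi * a) *\<^sub>R x)"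
  using assms by (simp add: gau_def std_normal_density_def power_mult_distrib)

lemma gau_integrable_real:
  assumes "0 < a"
  shows "integrable lborel (gau a :: real \<Rightarrow> real)"
proof -
  have "integrable lborel std_normal_density"
    using integrable_std_normal_moment[of 0] by simp
  from lborel_integrable_affine[OF this, of "sqrt (2 * pi * a)" 0] assms
  have "integrable lborel (\<lambda>x::real. sqrt (2 * pi) * std_normal_density (0 + sqrt (2 * pi * a) *\<^sub>R x))"
    by simp
  moreover have "gau a = (\<lambda>x::real. sqrt (2 * pi) * std_normal_density (0 + sqrt (2 * pi * a) *\<^sub>R x))"
    by (rule ext) (rule gau_real_eq_density[OF assms])
  ultimately show ?thesis by (simp only:)
qed

lemma gau_integrable:
  assumes "0 < a"
  shows "integrable lborel (gau a :: 'a::euclidean_space \<Rightarrow> real)"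
proof -
  have "(LBINT\<^sup>+t. ennreal (gau a (t::'a))) = (LBINT\<^sup>+t. (\<Prod>b\<in>Basis. ennreal (gau a ((t::'a) \<bullet> b))))"
    by (simp only: prod_ennreal[OF gau_nonneg] gau_prod[where 'a='a])
  also have "\<dots> = (\<Prod>b\<in>(Basis::'a set). (LBINT\<^sup>+x. ennreal (gau a (x::real))))"
    by (subst nn_integral_lborel_prod) auto
  also have "\<dots> < \<infinity>"
    using gau_integrable_real[OF assms] 
    by (simp add: integrable_iff_bounded power_less_top_ennreal)
  finally show ?thesis by (simp add: integrable_iff_bounded)
qed

text \<open>This is the characteristic function of the standard normal distribution after rescaling
  the variable by sqrt(2 pi a).\<close>

lemma gau_fourier_real:
  assumes a: "0 < a"
  shows "(LBINT x. complex_of_real (gau a (x::real)) * cis (- 2 * pi * (x * \<xi>)))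
    = complex_of_real (1 / sqrt a * gau (1 / a) \<xi>)"
proof -
  define c where "c = sqrt (2 * pi * a)"
  have c: "c > 0" using a by (simp add: c_def)
  \<comment> \<open>The frequency for which \<open>t * (c * x)\<close> equals
    \<open>- 2 * pi * (x * \<xi>)\<close>.\<close>
  define t where "t = - 2 * pi * \<xi> / c"
  have "char std_normal_distribution t = complex_of_real (exp (- (t^2) / 2))"
    by (simp add: char_std_normal_distribution)
  also have "char std_normal_distribution t = (LBINT x. std_normal_density x *\<^sub>R iexp (t * x))"
    unfolding char_def by (subst integral_density) auto
  also have "\<dots> = c *\<^sub>R (LBINT x. std_normal_density (0 + c *\<^sub>R x) *\<^sub>R iexp (t * (0 + c *\<^sub>R x)))"
    using c by (subst lborel_integral_affine[of _ c 0]) auto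
  also have "(\<lambda>x. std_normal_density (0 + c *\<^sub>R x) *\<^sub>R iexp (t * (0 + c *\<^sub>R x)))
      = (\<lambda>x. complex_of_real (1 / sqrt (2 * pi)) * (complex_of_real (gau a x) * cis (- 2 * pi * (x * \<xi>))))"
  proof (rule ext)
    fix x :: real
    have "t * (0 + c *\<^sub>R x) = - 2 * pi * (x * \<xi>)" using c by (simp add: t_def)
    then have 1: "iexp (t * (0 + c *\<^sub>R x)) = cis (- 2 * pi * (x * \<xi>))"
      by (simp only: cis_conv_exp)
    have 2: "std_normal_density (0 + c *\<^sub>R x) = 1 / sqrt (2 * pi) * gau a x"
      unfolding gau_real_eq_density[OF a] c_def by simp
    show "std_normal_density (0 + c *\<^sub>R x) *\<^sub>R iexp (t * (0 + c *\<^sub>R x))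
        = complex_of_real (1 / sqrt (2 * pi)) * (complex_of_real (gau a x) * cis (- 2 * pi * (x * \<xi>)))"
      unfolding 1 2 by (simp only: scaleR_conv_of_real of_real_mult mult.assoc)
  qed
  finally have "complex_of_real (exp (- (t^2) / 2)) = c *\<^sub>R (complex_of_real (1 / sqrt (2 * pi)) *
      (LBINT x. complex_of_real (gau a (x::real)) * cis (- 2 * pi * (x * \<xi>))))"
    by (simp only: integral_mult_right_zero)
  moreover have "c * (1 / sqrt (2 * pi)) = sqrt a"
    by (simp add: c_def real_sqrt_mult)
  ultimately have *: "complex_of_real (exp (- (t^2) / 2)) = complex_of_real (sqrt a) *
      (LBINT x. complex_of_real (gau a (x::real)) * cis (- 2 * pi * (x * \<xi>)))"
    by (simp only: scaleR_conv_of_real mult.assoc[symmetric] of_real_mult[symmetric])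
  have "t^2 / 2 = pi * (1 / a) * \<xi>\<^sup>2"
    using a by (simp add: t_def c_def power_divide power_mult_distrib field_simps power2_eq_square)
  then have "exp (- (t^2) / 2) = gau (1 / a) \<xi>" by (simp add: gau_def)
  then show ?thesis using * a
    by (simp add: field_simps)
qed

text \<open>Gaussian and character both factor over the coordinates, so the product measure on the
  coordinate lines reduces the claim to dimension one.\<close>

lemma gau_fourier:
  assumes a: "0 < a"
  shows "(LBINT t. complex_of_real (gau a (t::'a::euclidean_space)) * cis (- 2 * pi * (t \<bullet> \<xi>)))
    = complex_of_real ((1 / sqrt a) ^ DIM('a) * gau (1 / a) \<xi>)"
proof -
  interpret product_sigma_finite "\<lambda>_::'a. lborel :: real measure" ..
  let ?f = "\<lambda>b::'a. \<lambda>x::real. complex_of_real (gau a x) * cis (- 2 * pi * (x * (\<xi> \<bullet> b)))"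
  have eq: "complex_of_real (gau a t) * cis (- 2 * pi * (t \<bullet> \<xi>)) = (\<Prod>b\<in>Basis. ?f b (t \<bullet> b))" for t :: 'a
  proof -
    have "cis (- 2 * pi * (t \<bullet> \<xi>)) = (\<Prod>b\<in>Basis. cis (- 2 * pi * ((t \<bullet> b) * (\<xi> \<bullet> b))))"
      unfolding cis_conv_exp by (subst euclidean_inner) (simp add: exp_sum[symmetric] sum_distrib_left mult_ac)
    then show ?thesis by (simp add: gau_prod[of a t] prod.distrib)
  qed
  have "(LBINT t. complex_of_real (gau a (t::'a)) * cis (- 2 * pi * (t \<bullet> \<xi>)))
      = (LBINT t. (\<Prod>b\<in>Basis. ?f b ((t::'a) \<bullet> b)))"
    by (simp only: eq)
  also have "\<dots> = (\<integral>f. (\<Prod>b\<in>Basis. ?f b (f b)) \<partial>Pi\<^sub>M Basis (\<lambda>_. lborel))"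
    by (subst lborel_eq, subst integral_distr) (auto intro!: Bochner_Integration.integral_cong prod.cong)
  also have "\<dots> = (\<Prod>b\<in>Basis. integral\<^sup>L lborel (?f b))"
  proof (rule product_integral_prod)
    fix b :: 'a
    show "integrable lborel (?f b)"
      by (rule Bochner_Integration.integrable_bound[OF gau_integrable_real[OF a]])
         (auto simp: norm_mult)
  qed simp
  also have "\<dots> = (\<Prod>b\<in>Basis. complex_of_real (1 / sqrt a * gau (1 / a) (\<xi> \<bullet> b)))"
    by (simp only: gau_fourier_real[OF a])
  also have "\<dots> = complex_of_real ((1 / sqrt a) ^ DIM('a) * gau (1 / a) \<xi>)"
    by (subst gau_prod[of "1/a" \<xi>])
       (simp only: of_real_prod[symmetric] prod.distrib prod_constant)
  finally show ?thesis .
qed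

lemma gau_shift_fourier:
  assumes a: "0 < a"
  shows "(LBINT t. complex_of_real (gau a (t - p :: 'a::euclidean_space)) * cis (- 2 * pi * (t \<bullet> \<xi>)))
    = cis (- 2 * pi * (p \<bullet> \<xi>)) * complex_of_real ((1 / sqrt a) ^ DIM('a) * gau (1 / a) \<xi>)"
proof -
  have "(LBINT t. complex_of_real (gau a (t - p)) * cis (- 2 * pi * (t \<bullet> \<xi>)))
      = (LBINT t. cis (- 2 * pi * (p \<bullet> \<xi>)) * (complex_of_real (gau a (t - p)) * cis (- 2 * pi * ((t - p) \<bullet> \<xi>))))"
    by (intro Bochner_Integration.integral_cong)
       (auto simp: cis_mult algebra_simps inner_diff_left)
  also have "\<dots> = cis (- 2 * pi * (p \<bullet> \<xi>)) * (LBINT t. complex_of_real (gau a (t - p)) * cis (- 2 * pi * ((t - p) \<bullet> \<xi>)))"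
    by simp
  also have "\<dots> = cis (- 2 * pi * (p \<bullet> \<xi>)) * (LBINT t. complex_of_real (gau a t) * cis (- 2 * pi * (t \<bullet> \<xi>)))"
    by (subst lborel_integral_shift[of "\<lambda>t. complex_of_real (gau a t) * cis (- 2 * pi * (t \<bullet> \<xi>))"]) auto
  finally show ?thesis by (simp only: gau_fourier[OF a])
qed

lemma gau_integral:
  assumes a: "0 < a"
  shows "(LBINT t. gau a (t::'a::euclidean_space)) = (1 / sqrt a) ^ DIM('a)"
proof -
  have "complex_of_real (LBINT t. gau a (t::'a)) = complex_of_real ((1 / sqrt a) ^ DIM('a))"
    using gau_fourier[OF a, of "0::'a"] by (simp add: gau_def)
  then show ?thesis by (simp only: of_real_eq_iff)
qed

lemma gau_nn_integral:
  assumes a: "0 < a"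
  shows "(LBINT\<^sup>+t. ennreal (gau a (t::'a::euclidean_space))) = ennreal ((1 / sqrt a) ^ DIM('a))"
  using nn_integral_eq_integral[OF gau_integrable[OF a, where 'a='a]] by (simp add: gau_integral[OF a])

lemma gau_power2: "(gau a t)\<^sup>2 = gau (2 * a) t"
  by (simp add: gau_def power2_eq_square flip: exp_add)

lemma gaussian_L2: "gaussian \<in> L2"
  using gau_integrable[of 2]
  by (simp add: L2_def gaussian_eq_gau[abs_def] gau_power2)

lemma gaussian_normsq_pos: "0 < l2_normsq gaussian"
  using gau_integral[of 2, where 'a='a]
  by (simp add: l2_normsq_def gaussian_eq_gau gau_power2)

section \<open>Continuity of translations\<close>

lemma norm_add_power_le:
  fixes a b :: "'a::real_normed_vector"
  shows "norm (a + b) ^ p \<le> 2 ^ p * (norm a ^ p + norm b ^ p)"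
proof -
  have "norm (a + b) ^ p \<le> (2 * max (norm a) (norm b)) ^ p"
    by (intro power_mono order.trans[OF norm_triangle_ineq]) auto
  also have "\<dots> \<le> 2 ^ p * (norm a ^ p + norm b ^ p)"
    by (auto simp: power_mult_distrib max_def)
  finally show ?thesis .
qed

text \<open>For R > 0 this is the radial retraction onto the ball of radius R; unlike truncation by
  an indicator it is continuous.\<close>

definition clip :: "real \<Rightarrow> 'a::real_normed_vector \<Rightarrow> 'a" where
  "clip R z = (1 / max 1 (norm z / R)) *\<^sub>R z"

lemma continuous_clip: "continuous_on S (clip R)"
proof -
  have "max 1 (norm z / R) \<noteq> 0" for z :: 'a by (metis max.cobounded1 not_one_le_zero)
  moreover have "continuous_on S (\<lambda>z::'a. norm z / R)"
    unfolding divide_inverse by (intro continuous_intros)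
  then have "continuous_on S (\<lambda>z::'a. max 1 (norm z / R))"
    by (rule continuous_on_max[OF continuous_on_const])
  ultimately show ?thesis unfolding clip_def
    by (intro continuous_on_scaleR continuous_on_divide continuous_on_const continuous_on_id) auto
qed

lemma clip_measurable [measurable (raw)]:
  fixes f :: "'x \<Rightarrow> 'a::{real_normed_vector, second_countable_topology}"
  assumes "f \<in> borel_measurable M"
  shows "(\<lambda>x. clip R (f x)) \<in> borel_measurable M"
  using measurable_compose[OF assms borel_measurable_continuous_onI[OF continuous_clip]] .

lemma norm_clip_le: "norm (clip R z) \<le> norm z"
proof -
  have "norm (clip R z) = norm z / max 1 (norm z / R)" by (simp add: clip_def)
  also have "\<dots> \<le> norm z / 1" by (intro divide_left_mono) auto
  finally show ?thesis by simp
qed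

lemma norm_clip_le_radius:
  assumes "R > 0" shows "norm (clip R z) \<le> R"
proof (cases "norm z \<le> R")
  case True then show ?thesis using norm_clip_le order.trans by blast
next
  case False
  then have "max 1 (norm z / R) = norm z / R" using assms by (simp add: max_def field_simps)
  then show ?thesis using False assms by (simp add: clip_def)
qed

lemma clip_eq: "norm z \<le> R \<Longrightarrow> clip R z = z"
proof -
  assume z: "norm z \<le> R"
  then have "R \<ge> 0" using norm_ge_zero order.trans by blast
  then have "norm z / R \<le> 1" using z by (auto simp: divide_simps)
  then show ?thesis by (simp add: clip_def)
qed

text \<open>A continuous substitute for the indicator of the ball of radius R, falling linearly to 0
  on a shell of width 1.\<close>

definition cutoff :: "real \<Rightarrow> 'a::real_normed_vector \<Rightarrow> real" where
  "cutoff R t = max 0 (min 1 (R + 1 - norm t))"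

lemma continuous_cutoff: "continuous_on S (cutoff R)"
  unfolding cutoff_def by (intro continuous_intros)

lemma cutoff_measurable [measurable]: "cutoff R \<in> borel_measurable borel"
  using borel_measurable_continuous_onI[OF continuous_cutoff] .

lemma cutoff_bounds: "0 \<le> cutoff R t" "cutoff R t \<le> 1"
  by (auto simp: cutoff_def)

lemma norm_cutoff_scaleR_le: "norm (cutoff R t *\<^sub>R x) \<le> norm x"
  using mult_right_mono[OF cutoff_bounds(2)[of R t], of "norm x"] cutoff_bounds(1)[of R t] by simp

lemma cutoff_eq_1: "norm t \<le> R \<Longrightarrow> cutoff R t = 1"
  by (auto simp: cutoff_def)

lemma cutoff_eq_0: "norm t \<ge> R + 1 \<Longrightarrow> cutoff R t = 0"
  by (auto simp: cutoff_def)

lemma integrable_const_indicator_cball: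
  "integrable lborel (\<lambda>t::'a::euclidean_space. (c::real) * indicator (cball 0 r) t)"
  using emeasure_bounded_finite[OF bounded_cball[of "0::'a" r]]
  by (intro integrable_mult_right integrable_real_indicator) auto

text \<open>A measurable function is an a.e. limit of continuous functions; clipping values and arguments
  makes the convergence dominated.\<close>
lemma Lp_approx_continuous:
  fixes f :: "'a::euclidean_space \<Rightarrow> complex"
  assumes f [measurable]: "f \<in> borel_measurable borel" and p: "p > 0"
    and int: "integrable lborel (\<lambda>x. norm (f x) ^ p)" and e: "e > 0"
  shows "\<exists>u R B. continuous_on UNIV u \<and> (\<forall>x. norm x > R \<longrightarrow> u x = 0) \<and> (\<forall>x. norm (u x) \<le> B) \<and>
    integrable lborel (\<lambda>x. norm (f x - u x) ^ p) \<and> (LBINT x. norm (f x - u x) ^ p) < e"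
proof -
  \<comment> \<open>Truncating argument and value makes \<open>h k\<close> bounded with bounded
    support. The clipping radius is \<open>real k + 1\<close> because a retraction needs a positive
    radius and k may be 0.\<close>
  define h where "h k t = cutoff (real k) t *\<^sub>R clip (real k + 1) (f t)" for k t
  have [measurable]: "h k \<in> borel_measurable borel" for k
    unfolding h_def by measurable
  have hf: "norm (h k t) \<le> norm (f t)" for k t
    unfolding h_def by (rule order.trans[OF norm_cutoff_scaleR_le norm_clip_le])
  have fh: "norm (f t - h k t) ^ p \<le> (2 * norm (f t)) ^ p" for k t
    using hf[of k t] norm_triangle_ineq4[of "f t" "h k t"] by (intro power_mono) auto
  have I2: "integrable lborel (\<lambda>t. (2 * norm (f t)) ^ p)"
    using int by (simp add: power_mult_distrib)
  have Ifh: "integrable lborel (\<lambda>t. norm (f t - h k t) ^ p)" for k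
    by (rule Bochner_Integration.integrable_bound[OF I2]) (use fh in auto)
  have "(\<lambda>k. LBINT t. norm (f t - h k t) ^ p) \<longlonglongrightarrow> (\<integral>t. 0 \<partial>(lborel::'a measure))"
  proof (rule integral_dominated_convergence[OF _ _ I2])
    show "AE t in lborel. (\<lambda>k. norm (f t - h k t) ^ p) \<longlonglongrightarrow> 0"
    proof (rule AE_I2)
      fix t :: 'a
      have "eventually (\<lambda>k. real k \<ge> norm t \<and> real k \<ge> norm (f t)) sequentially"
        by (intro eventually_conj) (meson eventually_sequentiallyI nat_ceiling_le_eq)+
      then have "eventually (\<lambda>k. norm (f t - h k t) ^ p = 0) sequentially"
        by eventually_elim (use p in \<open>auto simp: h_def cutoff_eq_1 clip_eq\<close>)
      then show "(\<lambda>k. norm (f t - h k t) ^ p) \<longlonglongrightarrow> 0" by (rule tendsto_eventually)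
    qed
  qed (use fh in \<open>auto simp: norm_power\<close>)
  then have lim1: "(\<lambda>k. LBINT t. norm (f t - h k t) ^ p) \<longlonglongrightarrow> 0" by simp
  \<comment> \<open>Two errors below \<open>e'\<close>, each inflated by the factor
    \<open>2 ^ p\<close> of \<open>norm_add_power_le\<close>, add up to less than
    \<open>e\<close>.\<close>
  define e' where "e' = e / (2 * 2 ^ p)"
  have e': "e' > 0" using e by (simp add: e'_def)
  obtain k where k: "(LBINT t. norm (f t - h k t) ^ p) < e'"
    using order_tendstoD(2)[OF lim1 e'] by (auto simp: eventually_sequentially)
  \<comment> \<open>Lebesgue measurability supplies continuous \<open>g n\<close> converging to
    \<open>f\<close> off a negligible set, but with no control of size or support.\<close>
  have "f \<in> borel_measurable lebesgue" using f by (simp add: measurable_completion)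
  then have "f measurable_on UNIV" by (intro lebesgue_measurable_imp_measurable_on) auto
  then obtain N g where N: "negligible N" and g: "\<And>n. continuous_on UNIV (g n)"
    and lim: "\<And>x. x \<notin> N \<Longrightarrow> (\<lambda>n. g n x) \<longlonglongrightarrow> f x"
    by (auto simp: measurable_on_def)
  have AEN: "AE x in lborel. x \<notin> N"
    using N AE_not_in[of N lebesgue] by (simp add: negligible_iff_null_sets AE_completion_iff)
  \<comment> \<open>The truncation of \<open>h k\<close>, with k now fixed, applied to
    \<open>g n\<close>: continuity of \<open>clip\<close> carries the pointwise limit over, and one
    compactly supported bound dominates all n.\<close>
  define u where "u n t = cutoff (real k) t *\<^sub>R clip (real k + 1) (g n t)" for n t
  have cu: "continuous_on UNIV (u n)" for n
  proof -
    have "continuous_on UNIV (\<lambda>t. clip (real k + 1) (g n t))"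
      by (rule continuous_on_compose2[OF continuous_clip[of UNIV] g]) auto
    then show ?thesis unfolding u_def by (intro continuous_intros continuous_cutoff)
  qed
  have [measurable]: "u n \<in> borel_measurable borel" for n
    using borel_measurable_continuous_onI[OF cu] .
  have s: "u n t = 0" "h k t = 0" if "norm t > real k + 1" for n t
    using that by (auto simp: u_def h_def cutoff_eq_0)
  have b: "norm (u n t) \<le> real k + 1" "norm (h k t) \<le> real k + 1" for n t
    unfolding u_def h_def by (rule order.trans[OF norm_cutoff_scaleR_le norm_clip_le_radius], simp)+
  let ?D = "\<lambda>t::'a. (2 * (real k + 1)) ^ p * indicator (cball 0 (real k + 1)) t :: real"
  have ID: "integrable lborel ?D"
    by (rule integrable_const_indicator_cball)
  have hu: "norm (h k t - u n t) ^ p \<le> ?D t" for n t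
  proof (cases "norm t > real k + 1")
    case True then show ?thesis using p by (simp add: s power_0_left)
  next
    case False
    have "norm (h k t - u n t) \<le> norm (h k t) + norm (u n t)" by (rule norm_triangle_ineq4)
    also have "\<dots> \<le> (real k + 1) + (real k + 1)" by (intro add_mono b)
    finally have "norm (h k t - u n t) \<le> 2 * (real k + 1)" by simp
    then have "norm (h k t - u n t) ^ p \<le> (2 * (real k + 1)) ^ p" by (intro power_mono) auto
    then show ?thesis using False by simp
  qed
  have Ihu: "integrable lborel (\<lambda>t. norm (h k t - u n t) ^ p)" for n
    by (rule integrable_dominated[OF ID]) (use hu in auto)
  have "(\<lambda>n. LBINT t. norm (h k t - u n t) ^ p) \<longlonglongrightarrow> (\<integral>t. 0 \<partial>(lborel::'a measure))"
  proof (rule integral_dominated_convergence[OF _ _ ID])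
    show "AE t in lborel. (\<lambda>n. norm (h k t - u n t) ^ p) \<longlonglongrightarrow> 0"
      using AEN
    proof eventually_elim
      fix t assume "t \<notin> N"
      have "isCont (clip (real k + 1)) (f t)"
        using continuous_clip[of "UNIV :: complex set" "real k + 1"] by (simp add: continuous_on_eq_continuous_at)
      from isCont_tendsto_compose[OF this lim[OF \<open>t \<notin> N\<close>]]
      have "(\<lambda>n. u n t) \<longlonglongrightarrow> h k t" unfolding u_def h_def by (intro tendsto_intros)
      then have "(\<lambda>n. norm (h k t - u n t) ^ p) \<longlonglongrightarrow> norm (h k t - h k t) ^ p"
        by (intro tendsto_intros)
      moreover have "norm (h k t - h k t) ^ p = 0" using p by (simp add: power_0_left)
      ultimately show "(\<lambda>n. norm (h k t - u n t) ^ p) \<longlonglongrightarrow> 0" by (simp only:)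
    qed
  qed (use hu in \<open>auto simp: norm_power\<close>)
  then have lim2: "(\<lambda>n. LBINT t. norm (h k t - u n t) ^ p) \<longlonglongrightarrow> 0" by simp
  obtain n where n: "(LBINT t. norm (h k t - u n t) ^ p) < e'"
    using order_tendstoD(2)[OF lim2 e'] by (auto simp: eventually_sequentially)
  have le: "norm (f t - u n t) ^ p \<le> 2 ^ p * (norm (f t - h k t) ^ p + norm (h k t - u n t) ^ p)" for t
    using norm_add_power_le[of "f t - h k t" "h k t - u n t"] by simp
  have IS: "integrable lborel (\<lambda>t. 2 ^ p * (norm (f t - h k t) ^ p + norm (h k t - u n t) ^ p))"
    using Ifh Ihu by simp
  have Ifu: "integrable lborel (\<lambda>t. norm (f t - u n t) ^ p)"
    by (rule integrable_dominated[OF IS]) (use le in auto)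
  have "(LBINT t. norm (f t - u n t) ^ p)
      \<le> (LBINT t. 2 ^ p * (norm (f t - h k t) ^ p + norm (h k t - u n t) ^ p))"
    by (intro integral_mono Ifu IS le)
  also have "\<dots> = 2 ^ p * ((LBINT t. norm (f t - h k t) ^ p) + (LBINT t. norm (h k t - u n t) ^ p))"
    using Ifh Ihu by simp
  also have "\<dots> < 2 ^ p * (e' + e')"
    using k n by (intro mult_strict_left_mono add_strict_mono) auto
  also have "\<dots> = e" by (simp add: e'_def field_simps)
  finally show ?thesis
    using cu s(1) b(1) Ifu by (intro exI[of _ "u n"] exI[of _ "real k + 1"]) blast
qed

text \<open>For a continuous function of bounded support this is dominated convergence; the
  approximation errors before and after the shift agree by translation invariance. The case p = 2
  gives continuity of the STFT, p = 1 continuity of shifts in \<open>S0\<close>.\<close>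

lemma Lp_translation_continuous:
  fixes f :: "'a::euclidean_space \<Rightarrow> complex"
  assumes f [measurable]: "f \<in> borel_measurable borel" and p: "p > 0"
    and int: "integrable lborel (\<lambda>x. norm (f x) ^ p)" and w: "w \<longlonglongrightarrow> 0"
  shows "(\<lambda>n. LBINT x. norm (f (x - w n) - f x) ^ p) \<longlonglongrightarrow> 0"
proof (rule LIMSEQ_I)
  fix r :: real assume r: "r > 0"
  \<comment> \<open>Three errors below \<open>e\<close>, inflated by \<open>4 ^ p\<close> through
    two applications of the triangle inequality, stay below 3/4 of \<open>r\<close>.\<close>
  define e where "e = r / (4 * 4 ^ p)"
  have e: "e > 0" using r by (simp add: e_def)
  obtain u R B where cu: "continuous_on UNIV u" and su: "\<And>x. norm x > R \<Longrightarrow> u x = 0"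
    and bu: "\<And>x. norm (u x) \<le> B" and Iu: "integrable lborel (\<lambda>x. norm (f x - u x) ^ p)"
    and eu: "(LBINT x. norm (f x - u x) ^ p) < e"
    using Lp_approx_continuous[OF f p int e] by blast
  have [measurable]: "u \<in> borel_measurable borel" using borel_measurable_continuous_onI[OF cu] .
  \<comment> \<open>A bound on the shifts keeps all translates of \<open>u\<close> supported in the
    single ball of radius \<open>R + D\<close>.\<close>
  obtain D where D: "\<And>n. norm (w n) \<le> D"
    using convergent_imp_Bseq[of w] w by (auto simp: convergent_def Bseq_def)
  have D0: "D \<ge> 0" using D[of 0] norm_ge_zero order.trans by blast
  let ?K = "\<lambda>t::'a. (2 * B) ^ p * indicator (cball 0 (R + D)) t :: real"
  have IK: "integrable lborel ?K"
    by (rule integrable_const_indicator_cball)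
  have K: "norm (u (x - w n) - u x) ^ p \<le> ?K x" for x n
  proof (cases "norm x > R + D")
    case True
    then have "norm (x - w n) > R" using D[of n] norm_triangle_ineq2[of x "w n"] by linarith
    then show ?thesis using True D0 p by (simp add: su power_0_left)
  next
    case False
    have "norm (u (x - w n) - u x) \<le> 2 * B"
      using bu[of "x - w n"] bu[of x] norm_triangle_ineq4[of "u (x - w n)" "u x"] by linarith
    then have "norm (u (x - w n) - u x) ^ p \<le> (2 * B) ^ p" by (intro power_mono) auto
    then show ?thesis using False by simp
  qed
  have Iuu: "integrable lborel (\<lambda>x. norm (u (x - w n) - u x) ^ p)" for n
    by (rule integrable_dominated[OF IK]) (use K in auto)
  have "(\<lambda>n. LBINT x. norm (u (x - w n) - u x) ^ p) \<longlonglongrightarrow> (\<integral>x. 0 \<partial>(lborel::'a measure))"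
  proof (rule integral_dominated_convergence[OF _ _ IK])
    show "AE x in lborel. (\<lambda>n. norm (u (x - w n) - u x) ^ p) \<longlonglongrightarrow> 0"
    proof (rule AE_I2)
      fix x
      have c: "isCont u x" using cu by (simp add: continuous_on_eq_continuous_at)
      have "(\<lambda>n. x - w n) \<longlonglongrightarrow> x" using tendsto_diff[OF tendsto_const w, of x] by simp
      from isCont_tendsto_compose[OF c this]
      have "(\<lambda>n. norm (u (x - w n) - u x) ^ p) \<longlonglongrightarrow> norm (u x - u x) ^ p"
        by (intro tendsto_intros)
      moreover have "norm (u x - u x) ^ p = 0" using p by (simp add: power_0_left)
      ultimately show "(\<lambda>n. norm (u (x - w n) - u x) ^ p) \<longlonglongrightarrow> 0" by (simp only:)
    qed
  qed (use K in \<open>auto simp: norm_power\<close>)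
  then have lim: "(\<lambda>n. LBINT x. norm (u (x - w n) - u x) ^ p) \<longlonglongrightarrow> 0" by simp
  obtain n0 where n0: "\<And>n. n \<ge> n0 \<Longrightarrow> (LBINT x. norm (u (x - w n) - u x) ^ p) < e"
    using order_tendstoD(2)[OF lim e] by (auto simp: eventually_sequentially)
  have "(LBINT x. norm (f (x - w n) - f x) ^ p) < r" if n: "n \<ge> n0" for n
  proof -
    let ?a = "\<lambda>x. norm (f (x - w n) - u (x - w n)) ^ p"
    let ?b = "\<lambda>x. norm (u (x - w n) - u x) ^ p"
    let ?c = "\<lambda>x. norm (f x - u x) ^ p"
    have Ia: "integrable lborel ?a" using lborel_integrable_shift[OF Iu] .
    have le: "norm (f (x - w n) - f x) ^ p \<le> 4 ^ p * (?a x + ?b x + ?c x)" for x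
    proof -
      have "norm (f (x - w n) - f x) ^ p \<le> 2 ^ p * (?a x + norm (u (x - w n) - f x) ^ p)"
        using norm_add_power_le[of "f (x - w n) - u (x - w n)" "u (x - w n) - f x"] by simp
      also have "norm (u (x - w n) - f x) ^ p \<le> 2 ^ p * (?b x + ?c x)"
        using norm_add_power_le[of "u (x - w n) - u x" "u x - f x"] by (simp add: norm_minus_commute)
      also have "?a x + 2 ^ p * (?b x + ?c x) \<le> 2 ^ p * (?a x + ?b x + ?c x)"
        using mult_right_mono[of 1 "2 ^ p" "?a x"] by (simp add: algebra_simps)
      finally have "norm (f (x - w n) - f x) ^ p \<le> 2 ^ p * (2 ^ p * (?a x + ?b x + ?c x))" by simp
      moreover have "(4::real) ^ p = 2 ^ p * 2 ^ p" by (simp flip: power_mult_distrib)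
      ultimately show ?thesis by (simp only: mult.assoc)
    qed
    have IS: "integrable lborel (\<lambda>x. 4 ^ p * (?a x + ?b x + ?c x))"
      using Ia Iuu Iu by simp
    have "integrable lborel (\<lambda>x. norm (f (x - w n) - f x) ^ p)"
      by (rule integrable_dominated[OF IS]) (use le in auto)
    then have "(LBINT x. norm (f (x - w n) - f x) ^ p) \<le> (LBINT x. 4 ^ p * (?a x + ?b x + ?c x))"
      by (intro integral_mono IS le)
    also have "\<dots> = 4 ^ p * ((LBINT x. ?a x) + (LBINT x. ?b x) + (LBINT x. ?c x))"
      using Ia Iuu Iu by simp
    also have "(LBINT x. ?a x) = (LBINT x. ?c x)"
      by (rule lborel_integral_shift[of "\<lambda>x. norm (f x - u x) ^ p"]) simp
    also have "4 ^ p * ((LBINT x. ?c x) + (LBINT x. ?b x) + (LBINT x. ?c x)) < 4 ^ p * (e + e + e)"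
      using eu n0[OF n] by (intro mult_strict_left_mono add_strict_mono) auto
    also have "\<dots> < r" using r by (simp add: e_def field_simps)
    finally show ?thesis .
  qed
  then show "\<exists>n0. \<forall>n\<ge>n0. norm ((LBINT x. norm (f (x - w n) - f x) ^ p) - 0) < r"
    by (intro exI[of _ n0]) auto
qed

lemma Lp_translation_continuous_at:
  fixes f :: "'a::euclidean_space \<Rightarrow> complex"
  assumes f [measurable]: "f \<in> borel_measurable borel" and p: "p > 0"
    and int: "integrable lborel (\<lambda>x. norm (f x) ^ p)" and w: "w \<longlonglongrightarrow> w0"
  shows "(\<lambda>n. LBINT x. norm (f (x - w n) - f (x - w0)) ^ p) \<longlonglongrightarrow> 0"
proof -
  have "(\<lambda>n. w n - w0) \<longlonglongrightarrow> 0" using w by (simp add: LIM_zero)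
  from Lp_translation_continuous[OF f p int this]
  have "(\<lambda>n. LBINT x. norm (f (x - (w n - w0)) - f x) ^ p) \<longlonglongrightarrow> 0" .
  moreover have "(LBINT x. norm (f (x - (w n - w0)) - f x) ^ p)
      = (LBINT x. norm (f (x - w n) - f (x - w0)) ^ p)" for n
    using lborel_integral_shift[of "\<lambda>x. norm (f (x - (w n - w0)) - f x) ^ p" w0]
    by (simp add: algebra_simps)
  ultimately show ?thesis by simp
qed

text \<open>The change of the window is split in two. In \<open>a n\<close> only the translation
  varies, which is small in L^2; in \<open>b n\<close> only the modulation varies, which leaves the
  modulus fixed, so dominated convergence applies.\<close>

lemma stft_continuous:
  fixes f g :: "'a::euclidean_space \<Rightarrow> complex"
  assumes f: "f \<in> L2" and g: "g \<in> L2"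
  shows "continuous_on UNIV (stft g f)"
proof (rule continuous_at_imp_continuous_on, rule ballI, rule continuous_at_sequentiallyI)
  fix z :: "'a \<times> 'a" and s assume s: "s \<longlonglongrightarrow> z"
  note [measurable] = L2_measurable[OF f] L2_measurable[OF g]
  have s1: "(\<lambda>n. fst (s n)) \<longlonglongrightarrow> fst z" and s2: "(\<lambda>n. snd (s n)) \<longlonglongrightarrow> snd z"
    using s by (auto intro: tendsto_fst tendsto_snd)
  define b where "b n = tfs (fst z, snd (s n)) g" for n
  define a where "a n = (\<lambda>t. tfs (s n) g t - b n t)" for n
  have bL: "b n \<in> L2" and aL: "a n \<in> L2" for n
    unfolding a_def b_def by (intro L2_diff L2_tfs g)+
  have "(\<lambda>n. l2_normsq (a n)) \<longlonglongrightarrow> 0"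
  proof -
    have "cmod (a n t) = cmod (g (t - fst (s n)) - g (t - fst z))" for n t
      by (simp add: a_def b_def tfs_def norm_mult flip: right_diff_distrib)
    then show ?thesis
      unfolding l2_normsq_def
      using Lp_translation_continuous_at[OF _ _ L2_integrable[OF g] s1] by simp
  qed
  then have "(\<lambda>n. sqrt (l2_normsq f * l2_normsq (a n))) \<longlonglongrightarrow> sqrt (l2_normsq f * 0)"
    by (intro tendsto_intros)
  then have lim: "(\<lambda>n. sqrt (l2_normsq f * l2_normsq (a n))) \<longlonglongrightarrow> 0" by simp
  have 1: "(\<lambda>n. l2_inner f (a n)) \<longlonglongrightarrow> 0"
    by (rule Lim_null_comparison[OF always_eventually lim])
       (simp add: real_le_rsqrt[OF l2_inner_Cauchy_Schwarz[OF f aL]])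
  have 2: "(\<lambda>n. l2_inner f (b n)) \<longlonglongrightarrow> l2_inner f (tfs z g)"
    unfolding l2_inner_def
  proof (rule integral_dominated_convergence)
    show "(\<lambda>t. f t * cnj (tfs z g t)) \<in> borel_measurable lborel" by measurable
    show "(\<lambda>t. f t * cnj (b n t)) \<in> borel_measurable lborel" for n unfolding b_def by measurable
    show "integrable lborel (\<lambda>t. cmod (f t * cnj (tfs z g t)))"
      using L2_inner_integrable[OF f L2_tfs[OF g]] by (rule integrable_norm)
    show "AE t in lborel. (\<lambda>n. f t * cnj (b n t)) \<longlonglongrightarrow> f t * cnj (tfs z g t)"
      unfolding b_def tfs_def fst_conv snd_conv by (intro AE_I2 tendsto_intros s2)
    show "AE t in lborel. norm (f t * cnj (b n t)) \<le> cmod (f t * cnj (tfs z g t))" for n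
      by (simp add: b_def norm_mult cmod_tfs)
  qed
  have "stft g f (s n) = l2_inner f (a n) + l2_inner f (b n)" for n
    using l2_inner_add_right[OF aL bL f, of n n] by (simp add: stft_def a_def)
  then show "(\<lambda>n. stft g f (s n)) \<longlonglongrightarrow> stft g f z"
    using tendsto_add[OF 1 2] by (simp add: stft_def)
qed

section \<open>Integrable short-time Fourier transforms\<close>

lemma lborel_pair_integral:
  fixes f :: "'a::euclidean_space \<times> 'b::euclidean_space \<Rightarrow> 'c::{banach, second_countable_topology}"
  assumes "integrable lborel f"
  shows "(LBINT z. f z) = (LBINT x. LBINT y. f (x, y))"
  using lborel_pair.integral_fst'[of f] assms by (simp add: lborel_prod)

lemma lborel_swap_integral:
  fixes f :: "'a::euclidean_space \<times> 'b::euclidean_space \<Rightarrow> 'c::{banach, second_countable_topology}"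
  assumes "integrable lborel f"
  shows "(LBINT x. LBINT y. f (x, y)) = (LBINT y. LBINT x. f (x, y))"
  using lborel_pair.Fubini_integral[of "\<lambda>x y. f (x, y)"] assms by (simp add: lborel_prod)

lemma integrable_lborel_pairI:
  fixes f :: "'a::euclidean_space \<times> 'b::euclidean_space \<Rightarrow> 'c::{banach, second_countable_topology}"
  assumes [measurable]: "f \<in> borel_measurable borel"
    and "(LBINT\<^sup>+x. LBINT\<^sup>+y. ennreal (norm (f (x, y)))) < \<infinity>"
  shows "integrable lborel f"
  using assms nn_integral_lborel_pair[of "\<lambda>z. ennreal (norm (f z))"]
  by (simp add: integrable_iff_bounded)

text \<open>The exponentiated parallelogram law for t - x and t - y: two Gaussians in separate
  variables become one in the midpoint and one in the difference.\<close>

lemma gau_parallelogram: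
  "gau 2 (t - (1/2) *\<^sub>R (x + y)) * gau (1/2) (y - x) = gau 1 (t - x) * gau 1 (t - y)"
proof -
  have "2 * (norm (t - (1/2) *\<^sub>R (x + y)))\<^sup>2 + (1/2) * (norm (y - x))\<^sup>2 = (norm (t - x))\<^sup>2 + (norm (t - y))\<^sup>2"
    unfolding power2_norm_eq_inner
    by (simp add: inner_diff_left inner_diff_right inner_add_left inner_add_right inner_commute algebra_simps)
  then have eq: "- pi * (2 * (norm (t - (1/2) *\<^sub>R (x + y)))\<^sup>2 + (1/2) * (norm (y - x))\<^sup>2)
      = - pi * ((norm (t - x))\<^sup>2 + (norm (t - y))\<^sup>2)"
    by (simp only:)
  have e: "exp (- pi * a * A) * exp (- pi * b * B) = exp (- pi * (a * A + b * B))" for a b A B :: real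
    by (simp add: algebra_simps flip: exp_add)
  show ?thesis unfolding gau_def e eq by simp
qed

lemma gaussian_measurable [measurable]: "gaussian \<in> borel_measurable borel"
  by (rule L2_measurable[OF gaussian_L2])

text \<open>What matters is uniformity in x: it provides the majorant for Fubini in
  \<open>stft_gaussian_reproducing\<close> and bounds \<open>wig_prod\<close> independently of the
  position.\<close>

lemma nn_integral_mult_le_squares:
  assumes f: "f \<in> L2" and h: "h \<in> L2"
  shows "(LBINT\<^sup>+t. ennreal (cmod (f t * h (t - x)))) \<le> ennreal (l2_normsq f + l2_normsq h)"
proof -
  note [measurable] = L2_measurable[OF f] L2_measurable[OF h]
  have "(LBINT\<^sup>+t. ennreal (cmod (f t * h (t - x))))
      \<le> (LBINT\<^sup>+t. ennreal ((cmod (f t))\<^sup>2 + (cmod (h (t - x)))\<^sup>2))"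
    by (intro nn_integral_mono ennreal_leI cmod_mult_le_squares)
  also have "\<dots> = ennreal (LBINT t. (cmod (f t))\<^sup>2 + (cmod (h (t - x)))\<^sup>2)"
    by (intro nn_integral_eq_integral Bochner_Integration.integrable_add L2_integrable[OF f]
      lborel_integrable_shift[OF L2_integrable[OF h]]) auto
  also have "(LBINT t. (cmod (f t))\<^sup>2 + (cmod (h (t - x)))\<^sup>2) = l2_normsq f + l2_normsq h"
    using L2_integrable[OF f] lborel_integrable_shift[OF L2_integrable[OF h], of x]
      lborel_integral_shift[of "\<lambda>t. (cmod (h t))\<^sup>2" x]
    by (simp add: l2_normsq_def)
  finally show ?thesis .
qed

text \<open>The kernel is, up to normalisation, the conjugate of \<open>stft gaussian (tfs z gaussian)\<close>;
  the identity is Moyal's formula for the pairs \<open>(f, g)\<close> and \<open>(tfs z gaussian, gaussian)\<close>.\<close>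
lemma stft_gaussian_reproducing:
  fixes f g :: "'a::euclidean_space \<Rightarrow> complex"
  assumes f: "f \<in> L2" and g: "g \<in> L2"
  shows "(LBINT w. stft g f w * (gau (1/2) (w - z) * cis (pi * ((snd w - snd z) \<bullet> (fst z + fst w)))))
    = complex_of_real (sqrt 2 ^ DIM('a)) * stft gaussian f z * l2_inner gaussian g"
proof -
  note [measurable] = L2_measurable[OF f] L2_measurable[OF g]
  define K where "K = complex_of_real (sqrt 2 ^ DIM('a))"
  define Q where "Q w = complex_of_real (gau (1/2) (w - z)) * cis (pi * ((snd w - snd z) \<bullet> (fst z + fst w)))" for w :: "'a \<times> 'a"
  have [measurable]: "Q \<in> borel_measurable borel" unfolding Q_def by measurable
  define G where "G p = f (snd p) * cnj (tfs (fst p) g (snd p)) * Q (fst p)" for p :: "('a \<times> 'a) \<times> 'a"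
  have [measurable]: "G \<in> borel_measurable borel" unfolding G_def tfs_def by measurable
  have nQ: "cmod (Q w) = gau (1/2) (w - z)" for w by (simp add: Q_def norm_mult)
  have Igau: "(LBINT\<^sup>+w. ennreal (gau (1/2) (w - z))) < \<infinity>"
    using nn_integral_lborel_shift[of "\<lambda>w. ennreal (gau (1/2) w)" z] by (simp add: gau_nn_integral)
  have IG: "integrable lborel G"
  proof (rule integrable_lborel_pairI)
    have "(LBINT\<^sup>+t. ennreal (norm (G (w, t)))) \<le> ennreal (l2_normsq f + l2_normsq g) * ennreal (gau (1/2) (w - z))" for w
    proof -
      have "(LBINT\<^sup>+t. ennreal (norm (G (w, t))))
          = (LBINT\<^sup>+t. ennreal (cmod (f t * g (t - fst w))) * ennreal (gau (1/2) (w - z)))"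
        by (simp add: G_def norm_mult nQ cmod_tfs ennreal_mult)
      also have "\<dots> = (LBINT\<^sup>+t. ennreal (cmod (f t * g (t - fst w)))) * ennreal (gau (1/2) (w - z))"
        by (rule nn_integral_multc) simp
      also have "\<dots> \<le> ennreal (l2_normsq f + l2_normsq g) * ennreal (gau (1/2) (w - z))"
        by (intro mult_right_mono nn_integral_mult_le_squares f g) auto
      finally show ?thesis .
    qed
    then have "(LBINT\<^sup>+w. LBINT\<^sup>+t. ennreal (norm (G (w, t))))
        \<le> (LBINT\<^sup>+w. ennreal (l2_normsq f + l2_normsq g) * ennreal (gau (1/2) (w - z)))"
      by (rule nn_integral_mono)
    also have "\<dots> < \<infinity>"
      using Igau by (subst nn_integral_cmult) (auto simp: ennreal_mult_less_top)
    finally show "(LBINT\<^sup>+w. LBINT\<^sup>+t. ennreal (norm (G (w, t)))) < \<infinity>" .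
  qed simp
  have inner: "(LBINT w. G (w, t)) = K * (f t * cnj (tfs z gaussian t)) * l2_inner gaussian g" for t
  proof -
    \<comment> \<open>Joint integrability would give this for almost every t only; here a direct
      estimate gives it for each t, with the x-integral finite as a product of two L^2
      functions.\<close>
    have IGt: "integrable lborel (\<lambda>w. G (w, t))"
    proof (rule integrable_lborel_pairI)
      have "(LBINT\<^sup>+x. ennreal (cmod (g (t - x) * complex_of_real (gau (1/2) (x - fst z))))) < \<infinity>"
      proof -
        have g': "(\<lambda>x. g (t - x)) \<in> L2"
          using lborel_integrable_affine[OF L2_integrable[OF g], of "-1" t] by (simp add: L2_def)
        have h': "(\<lambda>x. complex_of_real (gau (1/2) (x - fst z))) \<in> L2"
          using lborel_integrable_shift[OF gau_integrable[of 1], of "fst z"]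
          by (simp add: L2_def gau_power2)
        show ?thesis using L2_mult_integrable[OF g' h'] by (simp add: integrable_iff_bounded)
      qed
      moreover have "(LBINT\<^sup>+y. ennreal (gau (1/2) (y - snd z))) < \<infinity>"
        using nn_integral_lborel_shift[of "\<lambda>w. ennreal (gau (1/2) w)" "snd z"] by (simp add: gau_nn_integral)
      moreover have "ennreal (norm (G ((x, y), t))) = ennreal (cmod (f t)) *
          ennreal (cmod (g (t - x) * complex_of_real (gau (1/2) (x - fst z)))) * ennreal (gau (1/2) (y - snd z))" for x y
        by (cases z) (simp add: G_def norm_mult nQ cmod_tfs gau_Pair mult_ac flip: ennreal_mult)
      ultimately show "(LBINT\<^sup>+x. LBINT\<^sup>+y. ennreal (norm (G ((x, y), t)))) < \<infinity>"
        by (simp add: nn_integral_cmult nn_integral_multc ennreal_mult_less_top)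
    qed (simp add: G_def tfs_def)
    have iy: "(LBINT y. G ((x, y), t)) = K * (f t * cnj (tfs z gaussian t)) * (gaussian (t - x) * cnj (g (t - x)))" for x
    proof -
      \<comment> \<open>The midpoint of the two translations: collecting the phases that depend on y
        leaves exactly the frequency \<open>t - p\<close>.\<close>
      define p where "p = (1/2) *\<^sub>R (fst z + x)"
      have ph: "cnj (cis (2 * pi * (y \<bullet> t))) * cis (pi * ((y - snd z) \<bullet> (fst z + x)))
          = cis (- 2 * pi * (snd z \<bullet> p)) * cis (- 2 * pi * (y \<bullet> (t - p)))" for y
        by (simp add: cis_cnj cis_mult p_def inner_diff_left inner_diff_right inner_add_right algebra_simps)
      have "G ((x, y), t) = (f t * cnj (g (t - x)) * gau (1/2) (x - fst z) * cis (- 2 * pi * (snd z \<bullet> p)))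
          * (complex_of_real (gau (1/2) (y - snd z)) * cis (- 2 * pi * (y \<bullet> (t - p))))" for y
      proof -
        have "gau (1/2) ((x, y) - z) = gau (1/2) (x - fst z) * gau (1/2) (y - snd z)"
          by (cases z) (simp add: gau_Pair)
        then have "G ((x, y), t) = (f t * cnj (g (t - x)) * gau (1/2) (x - fst z) * gau (1/2) (y - snd z))
           * (cnj (cis (2 * pi * (y \<bullet> t))) * cis (pi * ((y - snd z) \<bullet> (fst z + x))))"
          by (simp add: G_def Q_def tfs_def)
        then show ?thesis unfolding ph by simp
      qed
      then have "(LBINT y. G ((x, y), t)) = (f t * cnj (g (t - x)) * gau (1/2) (x - fst z) * cis (- 2 * pi * (snd z \<bullet> p)))
          * (LBINT y. complex_of_real (gau (1/2) (y - snd z)) * cis (- 2 * pi * (y \<bullet> (t - p))))"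
        by simp
      \<comment> \<open>The Fourier transform turns width 1/2 into width 2 and produces the constant
        \<open>K\<close>.\<close>
      also have "\<dots> = (f t * cnj (g (t - x)) * gau (1/2) (x - fst z) * cis (- 2 * pi * (snd z \<bullet> p)))
          * (cis (- 2 * pi * (snd z \<bullet> (t - p))) * (K * gau 2 (t - p)))"
        by (subst gau_shift_fourier) (auto simp: K_def real_sqrt_divide)
      also have "\<dots> = (f t * cnj (g (t - x)) * K) * (cis (- 2 * pi * (snd z \<bullet> p)) * cis (- 2 * pi * (snd z \<bullet> (t - p))))
          * complex_of_real (gau 2 (t - p) * gau (1/2) (x - fst z))"
        by simp
      also have "cis (- 2 * pi * (snd z \<bullet> p)) * cis (- 2 * pi * (snd z \<bullet> (t - p))) = cnj (cis (2 * pi * (snd z \<bullet> t)))"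
        by (simp add: cis_cnj cis_mult inner_diff_right algebra_simps)
      also have "gau 2 (t - p) * gau (1/2) (x - fst z) = gau 1 (t - fst z) * gau 1 (t - x)"
        unfolding p_def by (rule gau_parallelogram)
      finally show ?thesis by (simp add: tfs_def gaussian_eq_gau)
    qed
    have "(LBINT w. G (w, t)) = (LBINT x. LBINT y. G ((x, y), t))"
      by (rule lborel_pair_integral[OF IGt])
    also have "\<dots> = (LBINT x. K * (f t * cnj (tfs z gaussian t)) * (gaussian (t - x) * cnj (g (t - x))))"
      by (simp only: iy)
    also have "(LBINT x. K * (f t * cnj (tfs z gaussian t)) * (gaussian (t - x) * cnj (g (t - x))))
        = K * (f t * cnj (tfs z gaussian t)) * (LBINT x. gaussian (t - x) * cnj (g (t - x)))"
      by (rule integral_mult_right_zero)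
    also have "(LBINT x. gaussian (t - x) * cnj (g (t - x))) = l2_inner gaussian g"
      using lborel_integral_affine[of "\<lambda>x. gaussian x * cnj (g x)" "-1" t] by (simp add: l2_inner_def)
    finally show ?thesis .
  qed
  have "(LBINT w. stft g f w * Q w) = (LBINT w. LBINT t. G (w, t))"
    by (simp add: stft_def l2_inner_def G_def)
  also have "\<dots> = (LBINT t. LBINT w. G (w, t))"
    by (rule lborel_swap_integral[OF IG])
  also have "\<dots> = K * stft gaussian f z * l2_inner gaussian g"
    by (simp add: inner stft_def l2_inner_def)
  finally show ?thesis by (simp add: Q_def K_def)
qed

text \<open>Dividing the reproducing identity by the nonzero \<open>l2_inner gaussian g\<close>
  bounds the Gaussian STFT by the convolution of an integrable function with a Gaussian, and Tonelli
  finishes.\<close>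

lemma S0_of_integrable_stft:
  fixes f g :: "'a::euclidean_space \<Rightarrow> complex"
  assumes f: "f \<in> L2" and g: "g \<in> L2" and int: "integrable lborel (stft g f)"
    and nz: "l2_inner gaussian g \<noteq> 0"
  shows "f \<in> S0"
proof -
  note [measurable] = L2_measurable[OF f] L2_measurable[OF g]
  have [measurable]: "stft g f \<in> borel_measurable borel" "stft gaussian f \<in> borel_measurable borel"
    by (rule stft_measurable; measurable)+
  define c where "c = sqrt 2 ^ DIM('a) * cmod (l2_inner gaussian g)"
  have c: "c > 0" using nz by (simp add: c_def)
  have le: "ennreal c * ennreal (cmod (stft gaussian f z))
      \<le> (LBINT\<^sup>+w. ennreal (cmod (stft g f w)) * ennreal (gau (1/2) (w - z)))" for z
  proof -
    have "ennreal c * ennreal (cmod (stft gaussian f z)) = 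
      ennreal (cmod (LBINT w. stft g f w * (gau (1/2) (w - z) * cis (pi * ((snd w - snd z) \<bullet> (fst z + fst w))))))"
      unfolding stft_gaussian_reproducing[OF f g]
      by (simp add: c_def norm_mult norm_power mult_ac flip: ennreal_mult)
    also have "\<dots> \<le> (LBINT\<^sup>+w. norm (stft g f w * (gau (1/2) (w - z) * cis (pi * ((snd w - snd z) \<bullet> (fst z + fst w))))))"
    proof (rule integral_norm_bound_ennreal, rule integrable_dominated)
      show "integrable lborel (\<lambda>w. cmod (stft g f w))" using int by simp
      show "norm (stft g f w * (gau (1/2) (w - z) * cis (pi * ((snd w - snd z) \<bullet> (fst z + fst w))))) \<le> cmod (stft g f w)" for w
        by (simp add: norm_mult gau_le_1 mult_left_le)
    qed measurable
    also have "\<dots> = (LBINT\<^sup>+w. ennreal (cmod (stft g f w)) * ennreal (gau (1/2) (w - z)))"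
      by (simp add: norm_mult ennreal_mult)
    finally show ?thesis .
  qed
  have "ennreal c * (LBINT\<^sup>+z. ennreal (cmod (stft gaussian f z)))
      = (LBINT\<^sup>+z. ennreal c * ennreal (cmod (stft gaussian f z)))"
    by (rule nn_integral_cmult[symmetric]) simp
  also have "\<dots> \<le> (LBINT\<^sup>+z. LBINT\<^sup>+w. ennreal (cmod (stft g f w)) * ennreal (gau (1/2) (w - z)))"
    by (intro nn_integral_mono le)
  also have "\<dots> = (LBINT\<^sup>+w. LBINT\<^sup>+z. ennreal (cmod (stft g f w)) * ennreal (gau (1/2) (w - z)))"
    using nn_integral_lborel_swap[of "\<lambda>p. ennreal (cmod (stft g f (snd p))) * ennreal (gau (1/2) (snd p - fst p))"]
    by simp
  also have "\<dots> = (LBINT\<^sup>+w. ennreal (cmod (stft g f w)) * (LBINT\<^sup>+z. ennreal (gau (1/2) (z - w))))"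
    by (simp add: nn_integral_cmult gau_minus_commute[of "1/2"])
  also have "\<dots> = (LBINT\<^sup>+w. ennreal (cmod (stft g f w)) * ennreal ((1 / sqrt (1/2)) ^ DIM('a \<times> 'a)))"
    by (subst nn_integral_lborel_shift[of "\<lambda>z. ennreal (gau (1/2) z)"]) (simp_all only: gau_nn_integral, auto)
  also have "\<dots> < \<infinity>"
    using int by (subst nn_integral_multc) (auto simp: integrable_iff_bounded ennreal_mult_less_top)
  finally have "(LBINT\<^sup>+z. ennreal (cmod (stft gaussian f z))) < \<infinity>"
    using c by (auto simp: ennreal_mult_less_top)
  then show ?thesis using f by (simp add: S0_def integrable_iff_bounded)
qed

section \<open>Cross-Wigner distributions\<close>

text \<open>The function of t whose Fourier transform at \<xi> is the Wigner distribution at (x,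
  \<xi>); kept separate so that Plancherel can be applied for each fixed x.\<close>

definition wig_prod :: "('a::euclidean_space \<Rightarrow> complex) \<Rightarrow> ('a \<Rightarrow> complex) \<Rightarrow> 'a \<Rightarrow> 'a \<Rightarrow> complex" where
  "wig_prod f h x t = f (x + (1/2) *\<^sub>R t) * cnj (h (x - (1/2) *\<^sub>R t))"

lemma wigner_eq: "wigner f h (x, \<xi>) = (LBINT t. wig_prod f h x t * cis (- 2 * pi * (\<xi> \<bullet> t)))"
  by (simp add: wigner_def wig_prod_def)

lemma L2_affine:
  assumes f: "f \<in> L2" and c: "c \<noteq> 0"
  shows "(\<lambda>t. f (x + c *\<^sub>R t)) \<in> L2"
  using L2_measurable[OF f] lborel_integrable_affine[OF L2_integrable[OF f] c, of x] by (simp add: L2_def)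

lemma wig_prod_integrable:
  assumes f: "f \<in> L2" and h: "h \<in> L2"
  shows "integrable lborel (wig_prod f h x)"
  unfolding wig_prod_def
  using L2_inner_integrable[OF L2_affine[OF f, of "1/2" x] L2_affine[OF h, of "-(1/2)" x]] by simp

lemma wig_prod_measurable [measurable (raw)]:
  fixes f h :: "'a::euclidean_space \<Rightarrow> complex"
  assumes [measurable]: "f \<in> borel_measurable borel" "h \<in> borel_measurable borel"
    "u \<in> borel_measurable M" "v \<in> borel_measurable M"
  shows "(\<lambda>p. wig_prod f h (u p) (v p)) \<in> borel_measurable M"
  unfolding wig_prod_def by measurable

lemma wigner_measurable:
  fixes f h :: "'a::euclidean_space \<Rightarrow> complex"
  assumes [measurable]: "f \<in> borel_measurable borel" "h \<in> borel_measurable borel"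
  shows "wigner f h \<in> borel_measurable borel"
proof -
  have "(\<lambda>p::('a \<times> 'a) \<times> 'a. wig_prod f h (fst (fst p)) (snd p) * cis (- 2 * pi * (snd (fst p) \<bullet> snd p)))
      \<in> borel_measurable borel"
    by measurable
  from measurable_lborel_integral[OF this] show ?thesis
    by (rule measurable_cong[THEN iffD1, rotated]) (auto simp: wigner_eq)
qed

lemma wig_prod_nn_integral_le:
  fixes f h :: "'a::euclidean_space \<Rightarrow> complex"
  assumes f: "f \<in> L2" and h: "h \<in> L2"
  shows "(LBINT\<^sup>+t. ennreal (cmod (wig_prod f h x t))) \<le> ennreal (2 ^ DIM('a) * (l2_normsq f + l2_normsq h))"
proof -
  note [measurable] = L2_measurable[OF f] L2_measurable[OF h]
  \<comment> \<open>Substituting s = x + t/2 turns the second factor into h(2x - s), a translate of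
    the reflected function; the substitution costs the factor 2^d.\<close>
  let ?h = "\<lambda>s. h (- s)"
  have h': "?h \<in> L2" using L2_affine[OF h, of "-1" 0] by simp
  have n: "l2_normsq ?h = l2_normsq h"
    unfolding l2_normsq_def using lborel_integral_affine[of "\<lambda>x. (cmod (h x))\<^sup>2" "-1" 0] by simp
  have "ennreal ((1/2) ^ DIM('a)) * (LBINT\<^sup>+t. ennreal (cmod (wig_prod f h x t)))
      = (LBINT\<^sup>+s. ennreal (cmod (f s * ?h (s - 2 *\<^sub>R x))))"
  proof -
    have "?h (x + (1 / 2) *\<^sub>R t - 2 *\<^sub>R x) = h (x - (1/2) *\<^sub>R t)" for t
      by (rule arg_cong[where f=h]) (simp add: scaleR_2 algebra_simps)
    then show ?thesis
      using nn_integral_lborel_affine[of "\<lambda>s. ennreal (cmod (f s * ?h (s - 2 *\<^sub>R x)))" "1/2" x]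
      by (simp add: wig_prod_def norm_mult)
  qed
  also have "\<dots> \<le> ennreal (l2_normsq f + l2_normsq h)"
    using nn_integral_mult_le_squares[OF f h'] by (simp add: n)
  finally have "ennreal (2 ^ DIM('a)) * (ennreal ((1/2) ^ DIM('a)) * (LBINT\<^sup>+t. ennreal (cmod (wig_prod f h x t))))
      \<le> ennreal (2 ^ DIM('a)) * ennreal (l2_normsq f + l2_normsq h)"
    by (rule mult_left_mono) simp
  moreover have "ennreal (2 ^ DIM('a)) * ennreal ((1/2) ^ DIM('a)) = 1"
    by (simp flip: ennreal_mult power_mult_distrib)
  ultimately show ?thesis
    by (simp add: ennreal_mult l2_normsq_nonneg flip: mult.assoc)
qed

lemma wigner_bounded:
  fixes f h :: "'a::euclidean_space \<Rightarrow> complex"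
  assumes f: "f \<in> L2" and h: "h \<in> L2"
  shows "cmod (wigner f h z) \<le> 2 ^ DIM('a) * (l2_normsq f + l2_normsq h)"
proof (cases z)
  case (Pair x \<xi>)
  note [measurable] = L2_measurable[OF f] L2_measurable[OF h]
  have "integrable lborel (\<lambda>t. wig_prod f h x t * cis (- 2 * pi * (\<xi> \<bullet> t)))"
    by (rule integrable_dominated[OF integrable_norm[OF wig_prod_integrable[OF f h, of x]]])
       (auto simp: norm_mult)
  from integral_norm_bound_ennreal[OF this]
  have "ennreal (cmod (wigner f h z)) \<le> (LBINT\<^sup>+t. ennreal (cmod (wig_prod f h x t)))"
    by (simp add: Pair wigner_eq norm_mult)
  also have "\<dots> \<le> ennreal (2 ^ DIM('a) * (l2_normsq f + l2_normsq h))"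
    by (rule wig_prod_nn_integral_le[OF f h])
  finally show ?thesis
    by (subst (asm) ennreal_le_iff) (auto intro!: mult_nonneg_nonneg add_nonneg_nonneg l2_normsq_nonneg)
qed

text \<open>Shifting t by the difference of the two translations recentres both arguments at
  \<open>y\<close>, the position moved back by the midpoint of the translations. So the midpoint of
  \<open>l\<close> and \<open>m\<close> acts as a translation, while their difference survives as a
  modulation rotated by \<open>jmap\<close>; this is the origin of \<open>jmap\<close> in the symbol
  class.\<close>

lemma wigner_tfs_tfs:
  fixes f h :: "'a::euclidean_space \<Rightarrow> complex"
  assumes [measurable]: "f \<in> borel_measurable borel" "h \<in> borel_measurable borel"
  shows "wigner (tfs l f) (tfs m h)
    = (\<lambda>z. cis (pi * ((snd l + snd m) \<bullet> (fst l - fst m))) * tfs ((1/2) *\<^sub>R (l + m), jmap (l - m)) (wigner f h) z)"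
proof (rule ext, clarify)
  fix x \<xi> :: 'a
  define a b a' b' where "a = fst l" "b = snd l" "a' = fst m" "b' = snd m"
  note ab = this
  let ?c = "cis (pi * ((b + b') \<bullet> (a - a'))) * cis (2 * pi * (jmap (l - m) \<bullet> (x, \<xi>)))"
  define y \<eta> where "y = x - (1/2) *\<^sub>R (a + a')" "\<eta> = \<xi> - (1/2) *\<^sub>R (b + b')"
  note y = this
  have "wigner (tfs l f) (tfs m h) (x, \<xi>)
      = (LBINT t. ?c * (wig_prod f h y (t - (a - a')) * cis (- 2 * pi * (\<eta> \<bullet> (t - (a - a'))))))"
    unfolding wigner_eq
  proof (rule Bochner_Integration.integral_cong[OF refl])
    fix t
    have 1: "x + (1/2) *\<^sub>R t - a = y + (1/2) *\<^sub>R (t - (a - a'))"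
      and 2: "x - (1/2) *\<^sub>R t - a' = y - (1/2) *\<^sub>R (t - (a - a'))"
    proof -
      have a: "a = (1/2) *\<^sub>R a + (1/2) *\<^sub>R a" and a': "a' = (1/2) *\<^sub>R a' + (1/2) *\<^sub>R a'"
        by (simp_all flip: scaleR_add_left)
      show "x + (1/2) *\<^sub>R t - a = y + (1/2) *\<^sub>R (t - (a - a'))"
        unfolding y by (subst a) (simp add: algebra_simps)
      show "x - (1/2) *\<^sub>R t - a' = y - (1/2) *\<^sub>R (t - (a - a'))"
        unfolding y by (subst a') (simp add: algebra_simps)
    qed
    have "wig_prod (tfs l f) (tfs m h) x t * cis (- 2 * pi * (\<xi> \<bullet> t))
       = (cis (2 * pi * (b \<bullet> (x + (1/2) *\<^sub>R t))) * cnj (cis (2 * pi * (b' \<bullet> (x - (1/2) *\<^sub>R t)))) * cis (- 2 * pi * (\<xi> \<bullet> t)))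
         * wig_prod f h y (t - (a - a'))"
      unfolding wig_prod_def tfs_def ab[symmetric] 1 2 by (simp only: mult_ac complex_cnj_mult)
    also have "cis (2 * pi * (b \<bullet> (x + (1/2) *\<^sub>R t))) * cnj (cis (2 * pi * (b' \<bullet> (x - (1/2) *\<^sub>R t)))) * cis (- 2 * pi * (\<xi> \<bullet> t))
        = ?c * cis (- 2 * pi * (\<eta> \<bullet> (t - (a - a'))))"
      unfolding cis_cnj cis_mult y jmap_def ab
      by (rule arg_cong[where f=cis])
         (simp add: inner_diff_left inner_diff_right inner_add_left inner_add_right inner_commute algebra_simps)
    finally show "wig_prod (tfs l f) (tfs m h) x t * cis (- 2 * pi * (\<xi> \<bullet> t))
       = ?c * (wig_prod f h y (t - (a - a')) * cis (- 2 * pi * (\<eta> \<bullet> (t - (a - a')))))"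
      by (simp only: mult_ac)
  qed
  also have "\<dots> = ?c * (LBINT t. wig_prod f h y (t - (a - a')) * cis (- 2 * pi * (\<eta> \<bullet> (t - (a - a')))))"
    by (rule integral_mult_right_zero)
  also have "(LBINT t. wig_prod f h y (t - (a - a')) * cis (- 2 * pi * (\<eta> \<bullet> (t - (a - a'))))) = wigner f h (y, \<eta>)"
    unfolding wigner_eq
    by (rule lborel_integral_shift[of "\<lambda>t. wig_prod f h y t * cis (- 2 * pi * (\<eta> \<bullet> t))"]) measurable
  also have "(y, \<eta>) = (x, \<xi>) - (1/2) *\<^sub>R (l + m)"
    unfolding y ab by (simp add: prod_eq_iff)
  finally show "wigner (tfs l f) (tfs m h) (x, \<xi>) = cis (pi * ((snd l + snd m) \<bullet> (fst l - fst m))) *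
     tfs ((1/2) *\<^sub>R (l + m), jmap (l - m)) (wigner f h) (x, \<xi>)"
    by (simp add: tfs_def ab)
qed

text \<open>The map (x, t) to (x + t/2, x - t/2) preserves volume. It is carried out as two affine
  substitutions in one block of variables each, whose factors (1/2)^d and 2^d cancel.\<close>

lemma nn_integral_wigner_coordinates:
  fixes G :: "'a::euclidean_space \<times> 'a \<Rightarrow> ennreal"
  assumes [measurable]: "G \<in> borel_measurable borel"
  shows "(LBINT\<^sup>+x. LBINT\<^sup>+t. G (x + (1/2) *\<^sub>R t, x - (1/2) *\<^sub>R t))
    = (LBINT\<^sup>+u. LBINT\<^sup>+v. G (u, v))"
proof -
  let ?c = "ennreal ((1/2) ^ DIM('a))" and ?d = "ennreal (2 ^ DIM('a))"
  have cd: "?d * ?c = 1" by (simp flip: ennreal_mult power_mult_distrib)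
  have 1: "(LBINT\<^sup>+u. G (u, 2 *\<^sub>R x - u)) = ?c * (LBINT\<^sup>+t. G (x + (1/2) *\<^sub>R t, x - (1/2) *\<^sub>R t))" for x
  proof -
    have eq: "2 *\<^sub>R x - (x + (1/2) *\<^sub>R t) = x - (1/2) *\<^sub>R t" for t by (simp add: scaleR_2)
    show ?thesis
      using nn_integral_lborel_affine[of "\<lambda>u. G (u, 2 *\<^sub>R x - u)" "1/2" x, unfolded eq] by simp
  qed
  have 2: "(LBINT\<^sup>+v. G (u, v)) = ?d * (LBINT\<^sup>+x. G (u, 2 *\<^sub>R x - u))" for u
    using nn_integral_lborel_affine[of "\<lambda>v. G (u, v)" 2 "-u"] by simp
  have m: "(\<lambda>x. LBINT\<^sup>+t. G (x + (1/2) *\<^sub>R t, x - (1/2) *\<^sub>R t)) \<in> borel_measurable borel"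
    using measurable_lborel_nn_integral[of "\<lambda>p. G (fst p + (1/2) *\<^sub>R snd p, fst p - (1/2) *\<^sub>R snd p)"] by simp
  have m': "(\<lambda>u. LBINT\<^sup>+x. G (u, 2 *\<^sub>R x - u)) \<in> borel_measurable borel"
    using measurable_lborel_nn_integral[of "\<lambda>p. G (fst p, 2 *\<^sub>R snd p - fst p)"] by simp
  have "(LBINT\<^sup>+u. LBINT\<^sup>+v. G (u, v)) = ?d * (LBINT\<^sup>+u. LBINT\<^sup>+x. G (u, 2 *\<^sub>R x - u))"
    using m' by (simp add: 2 nn_integral_cmult)
  also have "(LBINT\<^sup>+u. LBINT\<^sup>+x. G (u, 2 *\<^sub>R x - u)) = (LBINT\<^sup>+x. LBINT\<^sup>+u. G (u, 2 *\<^sub>R x - u))"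
    using nn_integral_lborel_swap[of "\<lambda>p. G (fst p, 2 *\<^sub>R snd p - fst p)"] by simp
  also have "\<dots> = ?c * (LBINT\<^sup>+x. LBINT\<^sup>+t. G (x + (1/2) *\<^sub>R t, x - (1/2) *\<^sub>R t))"
    using m by (simp add: 1 nn_integral_cmult)
  finally show ?thesis by (simp add: cd flip: mult.assoc)
qed

lemma integral_wigner_coordinates:
  fixes G :: "'a::euclidean_space \<times> 'a \<Rightarrow> complex"
  assumes G: "integrable lborel G"
  shows "(LBINT x. LBINT t. G (x + (1/2) *\<^sub>R t, x - (1/2) *\<^sub>R t)) = (LBINT u. LBINT v. G (u, v))"
proof -
  have [measurable]: "G \<in> borel_measurable borel" using G by auto
  let ?c = "(1/2) ^ DIM('a) :: real" and ?d = "2 ^ DIM('a) :: real"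
  have cd: "?d * ?c = 1" by (simp flip: power_mult_distrib)
  have 1: "(LBINT u. G (u, 2 *\<^sub>R x - u)) = ?c *\<^sub>R (LBINT t. G (x + (1/2) *\<^sub>R t, x - (1/2) *\<^sub>R t))" for x
  proof -
    have eq: "2 *\<^sub>R x - (x + (1/2) *\<^sub>R t) = x - (1/2) *\<^sub>R t" for t by (simp add: scaleR_2)
    show ?thesis
      using lborel_integral_affine[of "\<lambda>u. G (u, 2 *\<^sub>R x - u)" "1/2" x, unfolded eq] by simp
  qed
  have 2: "(LBINT v. G (u, v)) = ?d *\<^sub>R (LBINT x. G (u, 2 *\<^sub>R x - u))" for u
    using lborel_integral_affine[of "\<lambda>v. G (u, v)" 2 "-u"] by simp
  \<comment> \<open>In the intermediate coordinates (u, x) integrability follows from that of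
    \<open>G\<close>, since the substitution for v multiplies by 2^d, which is at least 1.\<close>
  have I: "integrable lborel (\<lambda>p. G (fst p, 2 *\<^sub>R snd p - fst p))"
  proof (rule integrable_lborel_pairI)
    let ?n = "\<lambda>p. ennreal (norm (G p))"
    have "(LBINT\<^sup>+v. ?n (u, v)) = ennreal ?d * (LBINT\<^sup>+x. ?n (u, 2 *\<^sub>R x - u))" for u
      using nn_integral_lborel_affine[of "\<lambda>v. ?n (u, v)" 2 "-u"] by simp
    then have le: "(LBINT\<^sup>+x. ?n (u, 2 *\<^sub>R x - u)) \<le> (LBINT\<^sup>+v. ?n (u, v))" for u
      using mult_right_mono[of 1 "ennreal ?d" "LBINT\<^sup>+x. ?n (u, 2 *\<^sub>R x - u)"] by simp
    have "(LBINT\<^sup>+u. LBINT\<^sup>+x. ?n (u, 2 *\<^sub>R x - u)) \<le> (LBINT\<^sup>+u. LBINT\<^sup>+v. ?n (u, v))"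
      by (intro nn_integral_mono le)
    also have "\<dots> = (LBINT\<^sup>+p. ?n p)"
      by (rule nn_integral_lborel_pair[symmetric]) measurable
    also have "\<dots> < \<infinity>" using G by (simp add: integrable_iff_bounded)
    finally show "(LBINT\<^sup>+u. LBINT\<^sup>+x. ennreal (norm (G (fst (u, x), 2 *\<^sub>R snd (u, x) - fst (u, x))))) < \<infinity>" by simp
  qed measurable
  have "(LBINT u. LBINT v. G (u, v)) = ?d *\<^sub>R (LBINT u. LBINT x. G (u, 2 *\<^sub>R x - u))"
    by (simp add: 2)
  also have "(LBINT u. LBINT x. G (u, 2 *\<^sub>R x - u)) = (LBINT x. LBINT u. G (u, 2 *\<^sub>R x - u))"
    using lborel_swap_integral[OF I] by simp
  also have "\<dots> = ?c *\<^sub>R (LBINT x. LBINT t. G (x + (1/2) *\<^sub>R t, x - (1/2) *\<^sub>R t))"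
    by (simp add: 1)
  finally show ?thesis using cd by simp
qed

text \<open>Plancherel up to the harmless factor 2: damp by a Gaussian, so that Fubini applies and turns the
  left-hand side into an average of translates, then remove the damping by Fatou's lemma.\<close>
lemma fourier_L2_bound:
  fixes u :: "'a::euclidean_space \<Rightarrow> complex"
  assumes u: "integrable lborel u"
  shows "(LBINT\<^sup>+\<xi>. ennreal ((cmod (LBINT t. u t * cis (- 2 * pi * (\<xi> \<bullet> t))))\<^sup>2))
    \<le> 2 * (LBINT\<^sup>+t. ennreal ((cmod (u t))\<^sup>2))"
proof -
  have [measurable]: "u \<in> borel_measurable borel" using u by auto
  define F where "F \<xi> = (LBINT t. u t * cis (- 2 * pi * (\<xi> \<bullet> t)))" for \<xi>
  have [measurable]: "F \<in> borel_measurable borel"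
    unfolding F_def using measurable_lborel_integral[of "\<lambda>p. u (snd p) * cis (- 2 * pi * (fst p \<bullet> snd p))"] by simp
  define N where "N = (LBINT t. cmod (u t))"
  have FN: "cmod (F \<xi>) \<le> N" for \<xi>
    unfolding F_def N_def using integral_norm_bound[of lborel "\<lambda>t. u t * cis (- 2 * pi * (\<xi> \<bullet> t))"]
    by (simp add: norm_mult)
  have N0: "0 \<le> N" using FN[of 0] norm_ge_zero order.trans by blast
  have nu: "(LBINT\<^sup>+t. ennreal (cmod (u t))) < \<infinity>"
    using u by (simp add: integrable_iff_bounded)
  have damped: "(LBINT\<^sup>+\<xi>. ennreal ((cmod (F \<xi>))\<^sup>2 * gau a \<xi>)) \<le> 2 * (LBINT\<^sup>+t. ennreal ((cmod (u t))\<^sup>2))"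
    if a: "a > 0" for a
  proof -
    \<comment> \<open>The Fourier transform of \<open>gau a\<close>: nonnegative with total mass
      one, so integrating against it averages translates.\<close>
    define k where "k s = (1 / sqrt a) ^ DIM('a) * gau (1 / a) s" for s :: 'a
    have [measurable]: "k \<in> borel_measurable borel" unfolding k_def by measurable
    have k0: "0 \<le> k s" for s using a by (simp add: k_def)
    have k1: "(LBINT\<^sup>+s. ennreal (k (s - t))) = 1" for t
    proof -
      have "(LBINT\<^sup>+s. ennreal (k (s - t))) = (LBINT\<^sup>+s. ennreal (k s))"
        by (rule nn_integral_lborel_shift[of "\<lambda>s. ennreal (k s)"]) simp
      also have "\<dots> = (LBINT\<^sup>+s. ennreal ((1 / sqrt a) ^ DIM('a)) * ennreal (gau (1 / a) (s::'a)))"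
        using a by (simp add: k_def ennreal_mult)
      also have "\<dots> = ennreal ((1 / sqrt a) ^ DIM('a)) * ennreal ((1 / sqrt (1 / a)) ^ DIM('a))"
        using a by (subst nn_integral_cmult) (auto simp: gau_nn_integral)
      also have "\<dots> = ennreal (((1 / sqrt a) * (1 / sqrt (1 / a))) ^ DIM('a))"
        unfolding power_mult_distrib using a by (subst ennreal_mult) simp_all
      also have "(1 / sqrt a) * (1 / sqrt (1 / a)) = 1" using a by (simp add: real_sqrt_divide)
      finally show ?thesis by simp
    qed
    \<comment> \<open>Damped Fourier inversion: transforming back returns \<open>u\<close> averaged
      by \<open>k\<close>.\<close>
    have swap1: "(LBINT \<xi>. F \<xi> * gau a \<xi> * cis (2 * pi * (\<xi> \<bullet> t))) = (LBINT s. u s * k (s - t))" for t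
    proof -
      let ?G = "\<lambda>p. u (snd p) * (gau a (fst p) * cis (- 2 * pi * (fst p \<bullet> (snd p - t))))"
      have I: "integrable lborel ?G"
        by (rule integrable_lborel_pairI)
           (use nu a in \<open>simp_all add: norm_mult ennreal_mult nn_integral_multc nn_integral_cmult gau_nn_integral ennreal_mult_less_top\<close>)
      have "F \<xi> * gau a \<xi> * cis (2 * pi * (\<xi> \<bullet> t)) = (LBINT s. ?G (\<xi>, s))" for \<xi>
      proof -
        have "?G (\<xi>, s) = u s * cis (- 2 * pi * (\<xi> \<bullet> s)) * (gau a \<xi> * cis (2 * pi * (\<xi> \<bullet> t)))" for s
        proof -
          have "cis (- 2 * pi * (\<xi> \<bullet> (s - t))) = cis (- 2 * pi * (\<xi> \<bullet> s)) * cis (2 * pi * (\<xi> \<bullet> t))"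
            by (simp add: cis_mult inner_diff_right algebra_simps)
          then show ?thesis by simp
        qed
        then show ?thesis unfolding F_def by (simp only: integral_mult_left_zero) (simp only: mult.assoc)
      qed
      then have "(LBINT \<xi>. F \<xi> * gau a \<xi> * cis (2 * pi * (\<xi> \<bullet> t))) = (LBINT \<xi>. LBINT s. ?G (\<xi>, s))"
        by (simp only:)
      also have "\<dots> = (LBINT s. LBINT \<xi>. ?G (\<xi>, s))"
        by (rule lborel_swap_integral[OF I])
      also have "\<dots> = (LBINT s. u s * k (s - t))"
        using gau_fourier[OF a, where 'a='a] by (simp add: k_def)
      finally show ?thesis .
    qed
    \<comment> \<open>The left side is the damped integral of the squared modulus of
      \<open>F\<close>; the right side is a quadratic form in \<open>u\<close> with kernel
      \<open>k\<close>, which no longer mentions frequencies.\<close>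
    have swap2: "(LBINT \<xi>. F \<xi> * gau a \<xi> * cnj (F \<xi>)) = (LBINT t. cnj (u t) * (LBINT s. u s * k (s - t)))"
    proof -
      let ?G = "\<lambda>p. F (fst p) * gau a (fst p) * (cnj (u (snd p)) * cis (2 * pi * (fst p \<bullet> snd p)))"
      have I: "integrable lborel ?G"
      proof (rule integrable_lborel_pairI)
        have "(LBINT\<^sup>+\<xi>. ennreal (cmod (F \<xi>) * gau a \<xi>)) \<le> (LBINT\<^sup>+\<xi>. ennreal N * ennreal (gau a (\<xi>::'a)))"
          using FN N0 by (intro nn_integral_mono) (auto simp flip: ennreal_mult intro!: ennreal_leI mult_right_mono)
        also have "\<dots> < \<infinity>" using a
          by (subst nn_integral_cmult) (auto simp: gau_nn_integral ennreal_mult_less_top)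
        finally have "(LBINT\<^sup>+\<xi>. ennreal (cmod (F \<xi>) * gau a \<xi>)) < \<infinity>" .
        moreover have "ennreal (norm (?G (\<xi>, t))) = ennreal (cmod (F \<xi>) * gau a \<xi>) * ennreal (cmod (u t))" for \<xi> t
          by (simp add: norm_mult flip: ennreal_mult)
        ultimately show "(LBINT\<^sup>+\<xi>. LBINT\<^sup>+t. ennreal (norm (?G (\<xi>, t)))) < \<infinity>"
          using nu by (simp add: nn_integral_multc nn_integral_cmult ennreal_mult_less_top)
      qed measurable
      have cF: "cnj (F \<xi>) = (LBINT t. cnj (u t) * cis (2 * pi * (\<xi> \<bullet> t)))" for \<xi>
      proof -
        have "cnj (F \<xi>) = (LBINT t. cnj (u t * cis (- 2 * pi * (\<xi> \<bullet> t))))"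
          unfolding F_def by (rule Bochner_Integration.integral_cnj[symmetric])
        then show ?thesis by (simp add: cis_cnj)
      qed
      have "(LBINT \<xi>. F \<xi> * gau a \<xi> * cnj (F \<xi>)) = (LBINT \<xi>. LBINT t. ?G (\<xi>, t))"
        by (simp add: cF)
      also have "\<dots> = (LBINT t. LBINT \<xi>. ?G (\<xi>, t))"
        by (rule lborel_swap_integral[OF I])
      also have "\<dots> = (LBINT t. cnj (u t) * (LBINT \<xi>. F \<xi> * gau a \<xi> * cis (2 * pi * (\<xi> \<bullet> t))))"
        by (simp flip: integral_mult_right_zero add: mult_ac)
      finally show ?thesis by (simp only: swap1)
    qed
    have IF: "integrable lborel (\<lambda>\<xi>. (cmod (F \<xi>))\<^sup>2 * gau a \<xi>)"
    proof (rule integrable_dominated)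
      show "integrable lborel (\<lambda>\<xi>::'a. N\<^sup>2 * gau a \<xi>)" using gau_integrable[OF a, where 'a='a] by simp
      show "norm ((cmod (F \<xi>))\<^sup>2 * gau a \<xi>) \<le> N\<^sup>2 * gau a \<xi>" for \<xi>
        using FN[of \<xi>] by (auto simp: abs_mult intro!: mult_right_mono power_mono)
    qed measurable
    have "(LBINT\<^sup>+\<xi>. ennreal ((cmod (F \<xi>))\<^sup>2 * gau a \<xi>)) = ennreal (LBINT \<xi>. (cmod (F \<xi>))\<^sup>2 * gau a \<xi>)"
      by (rule nn_integral_eq_integral[OF IF]) simp
    also have "(LBINT \<xi>. (cmod (F \<xi>))\<^sup>2 * gau a \<xi>) = cmod (LBINT \<xi>. F \<xi> * gau a \<xi> * cnj (F \<xi>))"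
    proof -
      have "F \<xi> * gau a \<xi> * cnj (F \<xi>) = complex_of_real ((cmod (F \<xi>))\<^sup>2 * gau a \<xi>)" for \<xi>
        unfolding of_real_mult complex_norm_square by simp
      then have "(LBINT \<xi>. F \<xi> * gau a \<xi> * cnj (F \<xi>)) = complex_of_real (LBINT \<xi>. (cmod (F \<xi>))\<^sup>2 * gau a \<xi>)"
        by (simp only: integral_complex_of_real)
      moreover have "0 \<le> (LBINT \<xi>. (cmod (F \<xi>))\<^sup>2 * gau a \<xi>)" by simp
      ultimately show ?thesis by (simp only: norm_of_real abs_of_nonneg)
    qed
    also have "ennreal \<dots> \<le> (LBINT\<^sup>+t. ennreal (cmod (cnj (u t) * (LBINT s. u s * k (s - t)))))"
      unfolding swap2
    \<comment> \<open>A non-integrable function has Bochner integral 0 by convention, which makes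
      the second case trivial.\<close>
    proof (cases "integrable lborel (\<lambda>t. cnj (u t) * (LBINT s. u s * k (s - t)))")
      case True then show "ennreal (cmod (LBINT t. cnj (u t) * (LBINT s. u s * k (s - t))))
         \<le> (LBINT\<^sup>+t. ennreal (cmod (cnj (u t) * (LBINT s. u s * k (s - t)))))"
        by (rule integral_norm_bound_ennreal)
    next
      case False then show "ennreal (cmod (LBINT t. cnj (u t) * (LBINT s. u s * k (s - t))))
         \<le> (LBINT\<^sup>+t. ennreal (cmod (cnj (u t) * (LBINT s. u s * k (s - t)))))"
        by (simp add: not_integrable_integral_eq)
    qed
    also have "\<dots> \<le> (LBINT\<^sup>+t. LBINT\<^sup>+s. ennreal ((cmod (u t))\<^sup>2) * ennreal (k (s - t)) + ennreal ((cmod (u s))\<^sup>2) * ennreal (k (s - t)))"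
    proof (rule nn_integral_mono)
      fix t
      have "integrable lborel (\<lambda>s. u s * k (s - t))"
      proof (rule integrable_dominated)
        show "integrable lborel (\<lambda>s. ((1 / sqrt a) ^ DIM('a)) * cmod (u s))" using u by simp
        show "norm (u s * k (s - t)) \<le> ((1 / sqrt a) ^ DIM('a)) * cmod (u s)" for s
        proof -
          have "k (s - t) \<le> (1 / sqrt a) ^ DIM('a)"
            unfolding k_def using a by (intro mult_left_le gau_le_1) auto
          from mult_right_mono[OF this, of "cmod (u s)"] k0[of "s - t"] show ?thesis
            by (simp add: norm_mult mult.commute)
        qed
      qed measurable
      from integral_norm_bound_ennreal[OF this]
      have "ennreal (cmod (cnj (u t) * (LBINT s. u s * k (s - t))))
          \<le> ennreal (cmod (u t)) * (LBINT\<^sup>+s. ennreal (cmod (u s * k (s - t))))"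
        by (simp add: norm_mult ennreal_mult mult_left_mono)
      also have "\<dots> = (LBINT\<^sup>+s. ennreal (cmod (u t)) * ennreal (cmod (u s * k (s - t))))"
        by (rule nn_integral_cmult[symmetric]) measurable
      also have "\<dots> \<le> (LBINT\<^sup>+s. ennreal ((cmod (u t))\<^sup>2) * ennreal (k (s - t)) + ennreal ((cmod (u s))\<^sup>2) * ennreal (k (s - t)))"
      proof (rule nn_integral_mono)
        fix s
        have "cmod (u t) * cmod (u s * k (s - t)) = cmod (u t * u s) * k (s - t)"
          using k0[of "s - t"] by (simp add: norm_mult)
        also have "\<dots> \<le> ((cmod (u t))\<^sup>2 + (cmod (u s))\<^sup>2) * k (s - t)"
          by (intro mult_right_mono cmod_mult_le_squares k0)
        finally show "ennreal (cmod (u t)) * ennreal (cmod (u s * k (s - t)))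
          \<le> ennreal ((cmod (u t))\<^sup>2) * ennreal (k (s - t)) + ennreal ((cmod (u s))\<^sup>2) * ennreal (k (s - t))"
          using k0[of "s - t"] by (simp add: distrib_right flip: ennreal_mult ennreal_plus)
      qed
      finally show "ennreal (cmod (cnj (u t) * (LBINT s. u s * k (s - t))))
        \<le> (LBINT\<^sup>+s. ennreal ((cmod (u t))\<^sup>2) * ennreal (k (s - t)) + ennreal ((cmod (u s))\<^sup>2) * ennreal (k (s - t)))" .
    qed
    also have "\<dots> = (LBINT\<^sup>+t. ennreal ((cmod (u t))\<^sup>2) + (LBINT\<^sup>+s. ennreal ((cmod (u s))\<^sup>2) * ennreal (k (s - t))))"
      by (simp add: nn_integral_add nn_integral_cmult k1)
    also have "\<dots> = (LBINT\<^sup>+t. ennreal ((cmod (u t))\<^sup>2))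
        + (LBINT\<^sup>+t. LBINT\<^sup>+s. ennreal ((cmod (u s))\<^sup>2) * ennreal (k (s - t)))"
      by (rule nn_integral_add)
         (use measurable_lborel_nn_integral[of "\<lambda>p. ennreal ((cmod (u (snd p)))\<^sup>2) * ennreal (k (snd p - fst p))"] in simp_all)
    also have "(LBINT\<^sup>+t. LBINT\<^sup>+s. ennreal ((cmod (u s))\<^sup>2) * ennreal (k (s - t)))
        = (LBINT\<^sup>+s. LBINT\<^sup>+t. ennreal ((cmod (u s))\<^sup>2) * ennreal (k (s - t)))"
      using nn_integral_lborel_swap[of "\<lambda>p. ennreal ((cmod (u (snd p)))\<^sup>2) * ennreal (k (snd p - fst p))"] by simp
    also have "\<dots> = (LBINT\<^sup>+s. ennreal ((cmod (u s))\<^sup>2))"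
    proof -
      have "k (s - t) = k (t - s)" for s t by (simp add: k_def gau_minus_commute)
      then have "(LBINT\<^sup>+t. ennreal (k (s - t))) = 1" for s using k1[of s] by simp
      then show ?thesis by (simp add: nn_integral_cmult)
    qed
    finally show ?thesis by (simp add: mult_2)
  qed
  \<comment> \<open>The damping is removed along 1/(n + 1), which stays positive as
    \<open>damped\<close> requires.\<close>
  have "(LBINT\<^sup>+\<xi>. ennreal ((cmod (F \<xi>))\<^sup>2))
      = (LBINT\<^sup>+\<xi>. liminf (\<lambda>n. ennreal ((cmod (F \<xi>))\<^sup>2 * gau (1 / real (Suc n)) \<xi>)))"
  proof (rule nn_integral_cong)
    fix \<xi> :: 'a
    have "(\<lambda>n. (1::real) / real (Suc n)) \<longlonglongrightarrow> 0" by (rule LIMSEQ_Suc) (rule lim_1_over_n)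
    then have "(\<lambda>n. (cmod (F \<xi>))\<^sup>2 * exp (- pi * (1 / real (Suc n)) * (norm \<xi>)\<^sup>2)) \<longlonglongrightarrow> (cmod (F \<xi>))\<^sup>2 * exp (- pi * 0 * (norm \<xi>)\<^sup>2)"
      by (intro tendsto_intros)
    then have "(\<lambda>n. ennreal ((cmod (F \<xi>))\<^sup>2 * gau (1 / real (Suc n)) \<xi>)) \<longlonglongrightarrow> ennreal ((cmod (F \<xi>))\<^sup>2)"
      unfolding gau_def by (intro tendsto_ennrealI) simp
    from lim_imp_Liminf[OF _ this]
    show "ennreal ((cmod (F \<xi>))\<^sup>2) = liminf (\<lambda>n. ennreal ((cmod (F \<xi>))\<^sup>2 * gau (1 / real (Suc n)) \<xi>))" by simp
  qed
  also have "\<dots> \<le> liminf (\<lambda>n. LBINT\<^sup>+\<xi>. ennreal ((cmod (F \<xi>))\<^sup>2 * gau (1 / real (Suc n)) \<xi>))"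
    by (rule nn_integral_liminf) measurable
  also have "\<dots> \<le> 2 * (LBINT\<^sup>+t. ennreal ((cmod (u t))\<^sup>2))"
    by (rule Liminf_le) (auto intro!: always_eventually damped)
  finally show ?thesis by (simp add: F_def)
qed

text \<open>Plancherel in the frequency variable for each position, then the volume-preserving
  coordinates, split the integral into the product of two squared L^2 norms.\<close>

lemma wigner_L2:
  fixes f h :: "'a::euclidean_space \<Rightarrow> complex"
  assumes f: "f \<in> L2" and h: "h \<in> L2"
  shows "wigner f h \<in> L2"
proof -
  note [measurable] = L2_measurable[OF f] L2_measurable[OF h]
  have [measurable]: "wigner f h \<in> borel_measurable borel" by (rule wigner_measurable; measurable)
  have "(LBINT\<^sup>+z. ennreal ((cmod (wigner f h z))\<^sup>2))
      = (LBINT\<^sup>+x. LBINT\<^sup>+\<xi>. ennreal ((cmod (wigner f h (x, \<xi>)))\<^sup>2))"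
    by (rule nn_integral_lborel_pair) measurable
  also have "\<dots> \<le> (LBINT\<^sup>+x. 2 * (LBINT\<^sup>+t. ennreal ((cmod (wig_prod f h x t))\<^sup>2)))"
    unfolding wigner_eq by (intro nn_integral_mono fourier_L2_bound wig_prod_integrable f h)
  also have "\<dots> = 2 * (LBINT\<^sup>+x. LBINT\<^sup>+t. ennreal ((cmod (wig_prod f h x t))\<^sup>2))"
    by (rule nn_integral_cmult)
       (use measurable_lborel_nn_integral[of "\<lambda>p. ennreal ((cmod (wig_prod f h (fst p) (snd p)))\<^sup>2)"] in simp)
  also have "(LBINT\<^sup>+x. LBINT\<^sup>+t. ennreal ((cmod (wig_prod f h x t))\<^sup>2))
      = (LBINT\<^sup>+u. LBINT\<^sup>+v. ennreal ((cmod (f u))\<^sup>2) * ennreal ((cmod (h v))\<^sup>2))"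
    using nn_integral_wigner_coordinates[of "\<lambda>p. ennreal ((cmod (f (fst p)))\<^sup>2) * ennreal ((cmod (h (snd p)))\<^sup>2)"]
    by (simp add: wig_prod_def norm_mult power_mult_distrib ennreal_mult)
  also have "\<dots> = (LBINT\<^sup>+u. ennreal ((cmod (f u))\<^sup>2)) * (LBINT\<^sup>+v. ennreal ((cmod (h v))\<^sup>2))"
    by (simp add: nn_integral_cmult nn_integral_multc)
  also have "2 * \<dots> < \<infinity>"
    using L2_integrable[OF f] L2_integrable[OF h] by (simp add: integrable_iff_bounded ennreal_mult_less_top)
  finally show ?thesis by (simp add: L2_def integrable_iff_bounded)
qed

text \<open>Up to a constant, \<open>gau 2\<close> on phase space is the Wigner distribution of the
  Gaussian itself. This is why the transform splits exactly into two Gaussian STFTs.\<close>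

lemma stft_gau2_wigner:
  fixes f h :: "'a::euclidean_space \<Rightarrow> complex"
  assumes f: "f \<in> L2" and h: "h \<in> L2"
  shows "cmod (stft (\<lambda>y. complex_of_real (gau 2 y)) (wigner f h) (z, \<zeta>))
    = (1 / sqrt 2) ^ DIM('a) * cmod (stft gaussian f (z - (1/2) *\<^sub>R jmap \<zeta>)) * cmod (stft gaussian h (z + (1/2) *\<^sub>R jmap \<zeta>))"
proof -
  note [measurable] = L2_measurable[OF f] L2_measurable[OF h]
  have [measurable]: "wigner f h \<in> borel_measurable borel" by (rule wigner_measurable; measurable)
  obtain z1 z2 where z: "z = (z1, z2)" by (cases z)
  obtain \<zeta>1 \<zeta>2 where \<zeta>: "\<zeta> = (\<zeta>1, \<zeta>2)" by (cases \<zeta>)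
  define K where "K = complex_of_real ((1 / sqrt 2) ^ DIM('a))"
  define B where "B = 2 ^ DIM('a) * (l2_normsq f + l2_normsq h)"
  have B: "cmod (wigner f h y) \<le> B" for y unfolding B_def by (rule wigner_bounded[OF f h])
  define p q where "p = z - (1/2) *\<^sub>R jmap \<zeta>" "q = z + (1/2) *\<^sub>R jmap \<zeta>"
  note pq = this
  have pq': "fst p = z1 - (1/2) *\<^sub>R \<zeta>2" "snd p = z2 + (1/2) *\<^sub>R \<zeta>1"
    "fst q = z1 + (1/2) *\<^sub>R \<zeta>2" "snd q = z2 - (1/2) *\<^sub>R \<zeta>1"
    by (simp_all add: pq z \<zeta> jmap_def)
  define G where "G r = (f (fst r) * cnj (tfs p gaussian (fst r))) * cnj (h (snd r) * cnj (tfs q gaussian (snd r)))" for r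
  have Ifp: "integrable lborel (\<lambda>u. f u * cnj (tfs p gaussian u))"
    and Ihq: "integrable lborel (\<lambda>v. h v * cnj (tfs q gaussian v))"
    by (intro L2_inner_integrable f h L2_tfs gaussian_L2)+
  have [measurable]: "G \<in> borel_measurable borel" unfolding G_def by measurable
  have IG: "integrable lborel G"
    by (rule integrable_lborel_pairI)
       (use Ifp Ihq in \<open>simp_all add: G_def norm_mult ennreal_mult nn_integral_cmult nn_integral_multc
          integrable_iff_bounded ennreal_mult_less_top\<close>)
  define H where "H y = wigner f h y * cnj (tfs (z, \<zeta>) (\<lambda>y. complex_of_real (gau 2 y)) y)" for y
  have H: "H (x, \<xi>) = wigner f h (x, \<xi>) * (cis (- 2 * pi * (\<zeta>1 \<bullet> x)) * gau 2 (x - z1)) * (cis (- 2 * pi * (\<xi> \<bullet> \<zeta>2)) * gau 2 (\<xi> - z2))" for x \<xi>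
  proof -
    have "cnj (cis (2 * pi * (\<zeta> \<bullet> (x, \<xi>)))) = cis (- 2 * pi * (\<zeta>1 \<bullet> x)) * cis (- 2 * pi * (\<xi> \<bullet> \<zeta>2))"
      by (simp add: cis_cnj cis_mult \<zeta> inner_commute algebra_simps)
    then show ?thesis by (simp add: H_def tfs_def z gau_Pair)
  qed
  have IH: "integrable lborel H"
  proof (rule integrable_dominated)
    show "integrable lborel (\<lambda>y. B * gau 2 (y - z))"
      using lborel_integrable_shift[OF gau_integrable[of 2], of z] by simp
    show "H \<in> borel_measurable lborel" unfolding H_def tfs_def by measurable
    show "norm (H y) \<le> B * gau 2 (y - z)" for y
      using B[of y] by (simp add: H_def norm_mult cmod_tfs mult_right_mono)
  qed
  \<comment> \<open>After Fubini the \<xi>-integral meets only a Gaussian and a character. It leaves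
    \<open>gau (1/2) (t + \<zeta>2)\<close>, which the parallelogram law can combine with
    \<open>gau 2 (x - z1)\<close>.\<close>
  have inner: "(LBINT \<xi>. H (x, \<xi>)) = K * cis (- 2 * pi * (z2 \<bullet> \<zeta>2)) * (LBINT t. G (x + (1/2) *\<^sub>R t, x - (1/2) *\<^sub>R t))" for x
  proof -
    let ?w = "wig_prod f h x"
    let ?F = "\<lambda>r. ?w (snd r) * (gau 2 (fst r - z2) * cis (- 2 * pi * (fst r \<bullet> (snd r + \<zeta>2))))"
    define c where "c = cis (- 2 * pi * (\<zeta>1 \<bullet> x)) * gau 2 (x - z1)"
    have I: "integrable lborel ?F"
    proof (rule integrable_lborel_pairI)
      have "(LBINT\<^sup>+\<xi>. ennreal (gau 2 (\<xi> - z2))) < \<infinity>"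
        using nn_integral_lborel_shift[of "\<lambda>w. ennreal (gau 2 w)" z2] by (simp add: gau_nn_integral)
      then show "(LBINT\<^sup>+\<xi>. LBINT\<^sup>+t. ennreal (norm (?F (\<xi>, t)))) < \<infinity>"
        using wig_prod_integrable[OF f h, of x]
        by (simp add: norm_mult ennreal_mult nn_integral_multc nn_integral_cmult integrable_iff_bounded ennreal_mult_less_top)
    qed measurable
    have e1: "H (x, \<xi>) = c * (LBINT t. ?F (\<xi>, t))" for \<xi>
    proof -
      have "?F (\<xi>, t) = ?w t * cis (- 2 * pi * (\<xi> \<bullet> t)) * (cis (- 2 * pi * (\<xi> \<bullet> \<zeta>2)) * gau 2 (\<xi> - z2))" for t
      proof -
        have "cis (- 2 * pi * (\<xi> \<bullet> (t + \<zeta>2))) = cis (- 2 * pi * (\<xi> \<bullet> t)) * cis (- 2 * pi * (\<xi> \<bullet> \<zeta>2))"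
          by (simp add: cis_mult inner_add_right algebra_simps)
        then show ?thesis by (simp add: mult_ac)
      qed
      then have "(LBINT t. ?F (\<xi>, t)) = wigner f h (x, \<xi>) * (cis (- 2 * pi * (\<xi> \<bullet> \<zeta>2)) * gau 2 (\<xi> - z2))"
        unfolding wigner_eq by (simp only: integral_mult_left_zero)
      then show ?thesis unfolding H c_def by (simp only: mult_ac)
    qed
    have e2: "(LBINT \<xi>. ?F (\<xi>, t)) = ?w t * (cis (- 2 * pi * (z2 \<bullet> (t + \<zeta>2))) * (K * gau (1/2) (t + \<zeta>2)))" for t
    proof -
      have "(LBINT \<xi>. ?F (\<xi>, t)) = ?w t * (LBINT \<xi>. gau 2 (\<xi> - z2) * cis (- 2 * pi * (\<xi> \<bullet> (t + \<zeta>2))))"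
        by simp
      then show ?thesis
        using gau_shift_fourier[of 2 z2 "t + \<zeta>2"] by (simp add: K_def)
    qed
    have "(LBINT \<xi>. H (x, \<xi>)) = c * (LBINT \<xi>. LBINT t. ?F (\<xi>, t))"
      by (simp only: e1 integral_mult_right_zero)
    also have "(LBINT \<xi>. LBINT t. ?F (\<xi>, t)) = (LBINT t. LBINT \<xi>. ?F (\<xi>, t))"
      by (rule lborel_swap_integral[OF I])
    also have "c * \<dots> = (LBINT t. c * (?w t * (cis (- 2 * pi * (z2 \<bullet> (t + \<zeta>2))) * (K * gau (1/2) (t + \<zeta>2)))))"
      by (simp only: e2 integral_mult_right_zero)
    also have "\<dots> = (LBINT t. K * cis (- 2 * pi * (z2 \<bullet> \<zeta>2)) * G (x + (1/2) *\<^sub>R t, x - (1/2) *\<^sub>R t))"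
    proof (rule Bochner_Integration.integral_cong[OF refl])
      fix t
      define u v where "u = x + (1/2) *\<^sub>R t" "v = x - (1/2) *\<^sub>R t"
      note uv = this
      have xuv: "x = (1/2) *\<^sub>R (u + v)" and tuv: "t = u - v"
        unfolding uv by (simp_all add: scaleR_2[symmetric] flip: scaleR_add_left)
      have g: "gau 2 (x - z1) * gau (1/2) (t + \<zeta>2) = gau 1 (u - fst p) * gau 1 (v - fst q)"
      proof -
        \<comment> \<open>The parallelogram law is applied with u moved by +\<zeta>2/2 and v by
          -\<zeta>2/2: their sum is unchanged while the difference absorbs \<zeta>2.\<close>
        have "gau 2 (z1 - (1/2) *\<^sub>R ((u + (1/2) *\<^sub>R \<zeta>2) + (v - (1/2) *\<^sub>R \<zeta>2))) * gau (1/2) ((v - (1/2) *\<^sub>R \<zeta>2) - (u + (1/2) *\<^sub>R \<zeta>2))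
          = gau 1 (z1 - (u + (1/2) *\<^sub>R \<zeta>2)) * gau 1 (z1 - (v - (1/2) *\<^sub>R \<zeta>2))"
          by (rule gau_parallelogram)
        moreover have "(u + (1/2) *\<^sub>R \<zeta>2) + (v - (1/2) *\<^sub>R \<zeta>2) = u + v" by simp
        moreover have "(v - (1/2) *\<^sub>R \<zeta>2) - (u + (1/2) *\<^sub>R \<zeta>2) = - (t + \<zeta>2)"
        proof -
          have "\<zeta>2 = (1/2) *\<^sub>R \<zeta>2 + (1/2) *\<^sub>R \<zeta>2" by (simp flip: scaleR_add_left)
          then show ?thesis unfolding tuv by (simp add: algebra_simps)
        qed
        moreover have "z1 - (u + (1/2) *\<^sub>R \<zeta>2) = - (u - fst p)" "z1 - (v - (1/2) *\<^sub>R \<zeta>2) = - (v - fst q)"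
          by (simp_all add: pq')
        ultimately show ?thesis by (simp only: gau_uminus gau_minus_commute[of 2 x] xuv[symmetric])
      qed
      have ph: "cis (- 2 * pi * (\<zeta>1 \<bullet> x)) * cis (- 2 * pi * (z2 \<bullet> (t + \<zeta>2)))
          = cis (- 2 * pi * (z2 \<bullet> \<zeta>2)) * (cnj (cis (2 * pi * (snd p \<bullet> u))) * cis (2 * pi * (snd q \<bullet> v)))"
        unfolding cis_cnj cis_mult pq' uv
        by (rule arg_cong[where f=cis])
           (simp add: inner_diff_left inner_diff_right inner_add_left inner_add_right algebra_simps)
      have "c * (?w t * (cis (- 2 * pi * (z2 \<bullet> (t + \<zeta>2))) * (K * gau (1/2) (t + \<zeta>2))))
        = K * (f u * cnj (h v)) * (cis (- 2 * pi * (\<zeta>1 \<bullet> x)) * cis (- 2 * pi * (z2 \<bullet> (t + \<zeta>2))))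
          * complex_of_real (gau 2 (x - z1) * gau (1/2) (t + \<zeta>2))"
        unfolding c_def wig_prod_def uv[symmetric] by (simp only: of_real_mult mult_ac)
      also have "\<dots> = K * cis (- 2 * pi * (z2 \<bullet> \<zeta>2)) * G (u, v)"
        unfolding ph g G_def tfs_def gaussian_eq_gau fst_conv snd_conv
        by (simp only: of_real_mult complex_cnj_mult complex_cnj_cnj complex_cnj_complex_of_real mult_ac)
      finally show "c * (?w t * (cis (- 2 * pi * (z2 \<bullet> (t + \<zeta>2))) * (K * gau (1/2) (t + \<zeta>2))))
        = K * cis (- 2 * pi * (z2 \<bullet> \<zeta>2)) * G (x + (1/2) *\<^sub>R t, x - (1/2) *\<^sub>R t)"
        unfolding uv .
    qed
    finally show ?thesis by (simp only: integral_mult_right_zero)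
  qed
  have "stft (\<lambda>y. complex_of_real (gau 2 y)) (wigner f h) (z, \<zeta>) = (LBINT y. H y)"
    by (simp add: stft_def l2_inner_def H_def)
  also have "\<dots> = (LBINT x. LBINT \<xi>. H (x, \<xi>))"
    by (rule lborel_pair_integral[OF IH])
  also have "\<dots> = K * cis (- 2 * pi * (z2 \<bullet> \<zeta>2)) * (LBINT x. LBINT t. G (x + (1/2) *\<^sub>R t, x - (1/2) *\<^sub>R t))"
    by (simp only: inner integral_mult_right_zero)
  also have "(LBINT x. LBINT t. G (x + (1/2) *\<^sub>R t, x - (1/2) *\<^sub>R t)) = (LBINT u. LBINT v. G (u, v))"
    by (rule integral_wigner_coordinates[OF IG])
  also have "\<dots> = stft gaussian f p * cnj (stft gaussian h q)"
    unfolding G_def fst_conv snd_conv stft_def l2_inner_def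
    by (simp only: integral_mult_right_zero integral_mult_left_zero Bochner_Integration.integral_cnj)
  finally show ?thesis
    by (simp add: norm_mult K_def norm_power pq norm_divide)
qed

text \<open>\<open>jmap\<close> exchanges the two coordinate blocks and reflects one of them, so it
  preserves Lebesgue measure.\<close>

lemma nn_integral_jmap:
  fixes H :: "'a::euclidean_space \<times> 'a \<Rightarrow> ennreal"
  assumes [measurable]: "H \<in> borel_measurable borel"
  shows "(LBINT\<^sup>+\<zeta>. H (z + jmap \<zeta>)) = (LBINT\<^sup>+y. H y)"
proof -
  have "(LBINT\<^sup>+\<zeta>. H (z + jmap \<zeta>)) = (LBINT\<^sup>+x. LBINT\<^sup>+y. H (z + jmap (x, y)))"
    by (rule nn_integral_lborel_pair) (unfold jmap_def, measurable)
  also have "\<dots> = (LBINT\<^sup>+y. LBINT\<^sup>+x. H (z + jmap (x, y)))"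
    using nn_integral_lborel_swap[of "\<lambda>p. H (z + jmap p)"] by (simp add: jmap_def)
  also have "\<dots> = (LBINT\<^sup>+y. LBINT\<^sup>+x. H (fst z + 1 *\<^sub>R y, snd z + (- 1) *\<^sub>R x))"
    by (cases z) (simp add: jmap_def)
  also have "\<dots> = (LBINT\<^sup>+y. LBINT\<^sup>+x. H (fst z + 1 *\<^sub>R y, x))"
    using nn_integral_lborel_affine[of "\<lambda>x. H (fst z + 1 *\<^sub>R y, x)" "-1" "snd z" for y] by simp
  also have "\<dots> = (LBINT\<^sup>+y. LBINT\<^sup>+x. H (y, x))"
    using nn_integral_lborel_affine[of "\<lambda>y. LBINT\<^sup>+x. H (y, x)" 1 "fst z"] measurable_lborel_nn_integral[of H] by simp
  also have "\<dots> = (LBINT\<^sup>+y. H y)"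
    by (rule nn_integral_lborel_pair[symmetric]) measurable
  finally show ?thesis .
qed

text \<open>Completing the square around the midpoint of 0 and y. Integrating out w then leaves a
  constant times \<open>gau 1 y\<close>, the standard window.\<close>

lemma gau_mixture:
  "gau 2 w * gau 2 (y - w) = gau 4 (w - (1/2) *\<^sub>R y) * gau 1 y"
proof -
  have "2 * (norm w)\<^sup>2 + 2 * (norm (y - w))\<^sup>2 = 4 * (norm (w - (1/2) *\<^sub>R y))\<^sup>2 + 1 * (norm y)\<^sup>2"
    unfolding power2_norm_eq_inner
    by (simp add: inner_diff_left inner_diff_right inner_commute algebra_simps)
  then have eq: "- pi * (2 * (norm w)\<^sup>2 + 2 * (norm (y - w))\<^sup>2) = - pi * (4 * (norm (w - (1/2) *\<^sub>R y))\<^sup>2 + 1 * (norm y)\<^sup>2)"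
    by (simp only:)
  have e: "exp (- pi * a * A) * exp (- pi * b * B) = exp (- pi * (a * A + b * B))" for a b A B :: real
    by (simp add: algebra_simps flip: exp_add)
  show ?thesis unfolding gau_def e eq by simp
qed

text \<open>The window \<open>gaussian\<close> on phase space is a Gaussian average of translates of the narrower window
  for which the STFT of a Wigner distribution factorises.\<close>
lemma stft_gaussian_le_gau2:
  fixes F :: "'b::euclidean_space \<Rightarrow> complex"
  assumes [measurable]: "F \<in> borel_measurable borel" and B: "\<And>y. cmod (F y) \<le> B"
  shows "ennreal ((1/2) ^ DIM('b)) * ennreal (cmod (stft gaussian F (z, \<zeta>)))
    \<le> (LBINT\<^sup>+w. ennreal (gau 2 w) * ennreal (cmod (stft (\<lambda>y. complex_of_real (gau 2 y)) F (z + w, \<zeta>))))"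
proof -
  \<comment> \<open>The modulation does not depend on the mixing variable, so it is absorbed into
    the function and only Gaussians are translated.\<close>
  define e where "e y = F y * cnj (cis (2 * pi * (\<zeta> \<bullet> y)))" for y
  have [measurable]: "e \<in> borel_measurable borel" unfolding e_def by measurable
  have eB: "cmod (e y) \<le> B" for y using B by (simp add: e_def norm_mult)
  have B0: "0 \<le> B" using B norm_ge_zero order.trans by blast
  let ?g = "\<lambda>y. complex_of_real (gau 2 y)"
  let ?G = "\<lambda>p. e (fst p) * complex_of_real (gau 2 (snd p) * gau 2 (fst p - z - snd p))"
  have I: "integrable lborel ?G"
  proof (rule integrable_lborel_pairI)
    have sh: "(LBINT\<^sup>+w. ennreal (gau 4 (w - a))) = ennreal ((1 / sqrt 4) ^ DIM('b))" for a :: 'b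
      using nn_integral_lborel_shift[of "\<lambda>w. ennreal (gau 4 (w::'b))" a] by (simp add: gau_nn_integral)
    have "(LBINT\<^sup>+y. LBINT\<^sup>+w. ennreal (norm (?G (y, w))))
        \<le> (LBINT\<^sup>+y. LBINT\<^sup>+w. ennreal B * (ennreal (gau 4 (w - (1/2) *\<^sub>R (y - z))) * ennreal (gau 1 (y - z))))"
    proof (intro nn_integral_mono)
      fix y w
      have "norm (?G (y, w)) = cmod (e y) * (gau 2 w * gau 2 (y - z - w))"
        by (simp add: norm_mult)
      also have "\<dots> \<le> B * (gau 4 (w - (1/2) *\<^sub>R (y - z)) * gau 1 (y - z))"
        unfolding gau_mixture by (intro mult_right_mono eB) auto
      finally show "ennreal (norm (?G (y, w))) \<le> ennreal B * (ennreal (gau 4 (w - (1/2) *\<^sub>R (y - z))) * ennreal (gau 1 (y - z)))"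
        using B0 by (simp flip: ennreal_mult)
    qed
    also have "\<dots> = ennreal B * (ennreal ((1 / sqrt 4) ^ DIM('b)) * (LBINT\<^sup>+y. ennreal (gau 1 (y - z))))"
      by (simp add: nn_integral_cmult nn_integral_multc sh del: real_sqrt_four)
    also have "\<dots> < \<infinity>"
      using nn_integral_lborel_shift[of "\<lambda>w. ennreal (gau 1 (w::'b))" z] by (simp add: gau_nn_integral ennreal_mult_less_top)
    finally show "(LBINT\<^sup>+y. LBINT\<^sup>+w. ennreal (norm (?G (y, w)))) < \<infinity>" .
  qed measurable
  \<comment> \<open>The mass of \<open>gau 4\<close> is (1/2)^d; this is the constant on the left of
    the claim.\<close>
  have e1: "(LBINT w. ?G (y, w)) = (1/2) ^ DIM('b) * (F y * cnj (tfs (z, \<zeta>) gaussian y))" for y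
  proof -
    have "(LBINT w. ?G (y, w)) = e y * complex_of_real (LBINT w. gau 2 w * gau 2 (y - z - w))"
      by (simp only: fst_conv snd_conv integral_mult_right_zero integral_complex_of_real)
    also have "(LBINT w. gau 2 w * gau 2 (y - z - w)) = (LBINT w. gau 4 (w - (1/2) *\<^sub>R (y - z))) * gau 1 (y - z)"
      by (simp only: gau_mixture integral_mult_left_zero)
    also have "(LBINT w. gau 4 (w - (1/2) *\<^sub>R (y - z))) = (1/2) ^ DIM('b)"
      by (subst lborel_integral_shift) (auto simp: gau_integral)
    finally show ?thesis by (simp add: e_def tfs_def gaussian_eq_gau)
  qed
  have e2: "(LBINT y. ?G (y, w)) = gau 2 w * stft ?g F (z + w, \<zeta>)" for w
    unfolding stft_def l2_inner_def
    by (subst integral_mult_right_zero[symmetric])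
       (simp add: e_def tfs_def diff_diff_eq mult_ac)
  have "complex_of_real ((1/2) ^ DIM('b)) * stft gaussian F (z, \<zeta>) = (LBINT y. LBINT w. ?G (y, w))"
    unfolding e1 stft_def l2_inner_def by simp
  also have "\<dots> = (LBINT w. LBINT y. ?G (y, w))"
    by (rule lborel_swap_integral[OF I])
  also have "\<dots> = (LBINT w. gau 2 w * stft ?g F (z + w, \<zeta>))"
    by (simp only: e2)
  finally have eq: "complex_of_real ((1/2) ^ DIM('b)) * stft gaussian F (z, \<zeta>) = (LBINT w. gau 2 w * stft ?g F (z + w, \<zeta>))" .
  have "integrable lborel (\<lambda>w. LBINT y. ?G (y, w))"
    using lborel_pair.integrable_snd[of "\<lambda>y w. ?G (y, w)"] I by (simp add: lborel_prod split_beta')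
  then have "integrable lborel (\<lambda>w. gau 2 w * stft ?g F (z + w, \<zeta>))" by (simp only: e2)
  from integral_norm_bound_ennreal[OF this, folded eq]
  show ?thesis by (simp add: norm_mult norm_power norm_divide ennreal_mult)
qed

section \<open>The Feichtinger algebra\<close>

lemma S0_L2: "f \<in> S0 \<Longrightarrow> f \<in> L2"
  by (simp add: S0_def)

lemma S0_integrable: "f \<in> S0 \<Longrightarrow> integrable lborel (stft gaussian f)"
proof -
  assume f: "f \<in> S0"
  have "stft gaussian f \<in> borel_measurable lborel"
    using stft_measurable[OF L2_measurable[OF S0_L2[OF f]] gaussian_measurable] by simp
  then show ?thesis using f by (simp add: S0_def integrable_iff_bounded)
qed

lemma S0I: "f \<in> L2 \<Longrightarrow> integrable lborel (stft gaussian f) \<Longrightarrow> f \<in> S0"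
  by (simp add: S0_def)

lemma S0_norm_nn: "f \<in> S0 \<Longrightarrow> ennreal (S0_norm f) = (LBINT\<^sup>+z. ennreal (cmod (stft gaussian f z)))"
  unfolding S0_norm_def by (rule nn_integral_eq_integral[symmetric]) (auto simp: S0_integrable)

lemma S0_norm_nonneg: "0 \<le> S0_norm f"
  by (simp add: S0_norm_def)

section \<open>Linear structure, norm and shift invariance of the Feichtinger algebra\<close>

lemma stft_gaussian_add: "f \<in> L2 \<Longrightarrow> h \<in> L2 \<Longrightarrow>
  stft gaussian (\<lambda>t. f t + h t) = (\<lambda>z. stft gaussian f z + stft gaussian h z)"
  by (rule ext) (simp add: stft_def l2_inner_add_left L2_tfs gaussian_L2)

lemma stft_gaussian_diff: "f \<in> L2 \<Longrightarrow> h \<in> L2 \<Longrightarrow>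
  stft gaussian (\<lambda>t. f t - h t) = (\<lambda>z. stft gaussian f z - stft gaussian h z)"
  by (rule ext) (simp add: stft_def l2_inner_diff_left L2_tfs gaussian_L2)

lemma stft_gaussian_scale: "stft gaussian (\<lambda>t. c * f t) = (\<lambda>z. c * stft gaussian f z)"
  by (rule ext) (simp add: stft_def l2_inner_scale_left)

lemma S0_add: "f \<in> S0 \<Longrightarrow> h \<in> S0 \<Longrightarrow> (\<lambda>t. f t + h t) \<in> S0"
  by (intro S0I L2_add) (auto simp: stft_gaussian_add S0_L2 S0_integrable)

lemma S0_scale: "f \<in> S0 \<Longrightarrow> (\<lambda>t. c * f t) \<in> S0"
  by (intro S0I L2_scale) (auto simp: stft_gaussian_scale S0_L2 S0_integrable)

lemma S0_diff: "f \<in> S0 \<Longrightarrow> h \<in> S0 \<Longrightarrow> (\<lambda>t. f t - h t) \<in> S0"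
  by (intro S0I L2_diff) (auto simp: stft_gaussian_diff S0_L2 S0_integrable)

lemma S0_zero: "(\<lambda>t::'a::euclidean_space. 0) \<in> S0"
proof -
  have "stft gaussian (\<lambda>t::'a. 0) = (\<lambda>z. 0)" by (simp add: stft_def l2_inner_def fun_eq_iff)
  then show ?thesis by (intro S0I L2_zero) simp
qed

lemma S0_sum: "(\<And>m. m \<in> S \<Longrightarrow> F m \<in> S0) \<Longrightarrow> (\<lambda>t. \<Sum>m\<in>S. F m t) \<in> S0"
  by (induction S rule: infinite_finite_induct) (auto intro: S0_zero S0_add)

lemma cmod_stft_gaussian_tfs: "f \<in> L2 \<Longrightarrow> cmod (stft gaussian (tfs w f) z) = cmod (stft gaussian f (z - w))"
  by (simp add: stft_tfs gaussian_L2 norm_mult)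

lemma S0_tfs:
  assumes f: "f \<in> S0" shows "tfs w f \<in> S0"
proof -
  note fL = S0_L2[OF f]
  have "integrable lborel (stft gaussian (tfs w f))"
  proof (rule integrable_dominated)
    show "integrable lborel (\<lambda>z. cmod (stft gaussian f (z - w)))"
      using lborel_integrable_shift[OF S0_integrable[OF f]] by simp
    show "stft gaussian (tfs w f) \<in> borel_measurable lborel"
      using stft_measurable[OF L2_measurable[OF L2_tfs[OF fL]] gaussian_measurable] by simp
  qed (simp add: cmod_stft_gaussian_tfs fL)
  then show ?thesis by (intro S0I L2_tfs fL)
qed

lemma S0_norm_tfs:
  assumes f: "f \<in> S0" shows "S0_norm (tfs w f) = S0_norm f"
proof -
  have "(\<lambda>z. cmod (stft gaussian f z)) \<in> borel_measurable borel"
    using S0_integrable[OF f] by auto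
  from lborel_integral_shift[OF this, of w] show ?thesis
    by (simp add: S0_norm_def cmod_stft_gaussian_tfs S0_L2[OF f])
qed

lemma S0_norm_scale: "S0_norm (\<lambda>t. c * f t) = cmod c * S0_norm f"
  by (simp add: S0_norm_def stft_gaussian_scale norm_mult)

lemma S0_norm_add_le:
  assumes f: "f \<in> S0" and h: "h \<in> S0"
  shows "S0_norm (\<lambda>t. f t + h t) \<le> S0_norm f + S0_norm h"
proof -
  have "S0_norm (\<lambda>t. f t + h t) \<le> (LBINT z. cmod (stft gaussian f z) + cmod (stft gaussian h z))"
    unfolding S0_norm_def stft_gaussian_add[OF S0_L2[OF f] S0_L2[OF h]]
    by (rule integral_mono) (use S0_integrable[OF f] S0_integrable[OF h] norm_triangle_ineq in auto)
  then show ?thesis using S0_integrable[OF f] S0_integrable[OF h] by (simp add: S0_norm_def)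
qed

lemma S0_norm_sum_le:
  "(\<And>m. m \<in> S \<Longrightarrow> F m \<in> S0) \<Longrightarrow> S0_norm (\<lambda>t. \<Sum>m\<in>S. F m t) \<le> (\<Sum>m\<in>S. S0_norm (F m))"
proof (induction S rule: infinite_finite_induct)
  case (insert x S)
  have "S0_norm (\<lambda>t. F x t + (\<Sum>m\<in>S. F m t)) \<le> S0_norm (F x) + S0_norm (\<lambda>t. \<Sum>m\<in>S. F m t)"
    using insert.prems by (intro S0_norm_add_le S0_sum) auto
  then show ?case using insert by fastforce
qed (simp_all add: S0_norm_def stft_def l2_inner_def)

text \<open>On the STFT side a shift is a translation times a unimodular phase. Translation is
  continuous in L^1, and the change of phase at the fixed translation by \<open>w\<close> is
  dominated by twice the modulus.\<close>

lemma S0_tfs_continuous: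
  fixes f :: "'a::euclidean_space \<Rightarrow> complex"
  assumes f: "f \<in> S0" and s: "s \<longlonglongrightarrow> w"
  shows "(\<lambda>n. S0_norm (\<lambda>t. tfs (s n) f t - tfs w f t)) \<longlonglongrightarrow> 0"
proof -
  note fL = S0_L2[OF f]
  define V where "V = stft gaussian f"
  have IV: "integrable lborel V" unfolding V_def by (rule S0_integrable[OF f])
  have [measurable]: "V \<in> borel_measurable borel" using IV by auto
  define ph where "ph v z = cis (- 2 * pi * ((snd z - snd v) \<bullet> fst v))" for v z :: "'a \<times> 'a"
  have [measurable]: "(\<lambda>z. ph v z) \<in> borel_measurable borel" for v unfolding ph_def by measurable
  have nph: "cmod (ph v z) = 1" for v z by (simp add: ph_def)
  have lim1: "(\<lambda>n. LBINT z. norm (V (z - s n) - V (z - w)) ^ 1) \<longlonglongrightarrow> 0"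
    by (rule Lp_translation_continuous_at[OF _ _ _ s]) (use IV in auto)
  have IVw: "integrable lborel (\<lambda>z. 2 * cmod (V (z - w)))"
    using lborel_integrable_shift[OF IV, of w] by simp
  have b2: "norm ((ph (s n) z - ph w z) * V (z - w)) \<le> 2 * cmod (V (z - w))" for n z
    using norm_triangle_ineq4[of "ph (s n) z" "ph w z"] by (simp add: norm_mult nph mult_right_mono)
  have I2: "integrable lborel (\<lambda>z. (ph (s n) z - ph w z) * V (z - w))" for n
    by (rule integrable_dominated[OF IVw _ b2]) measurable
  have lim2: "(\<lambda>n. LBINT z. cmod ((ph (s n) z - ph w z) * V (z - w))) \<longlonglongrightarrow> (\<integral>z. 0 \<partial>(lborel :: ('a \<times> 'a) measure))"
  proof (rule integral_dominated_convergence[OF _ _ IVw])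
    show "AE z in lborel. (\<lambda>n. cmod ((ph (s n) z - ph w z) * V (z - w))) \<longlonglongrightarrow> 0"
    proof (rule AE_I2)
      fix z
      have "(\<lambda>n. ph (s n) z) \<longlonglongrightarrow> ph w z"
        unfolding ph_def by (intro tendsto_intros s)
      then have "(\<lambda>n. cmod ((ph (s n) z - ph w z) * V (z - w))) \<longlonglongrightarrow> cmod ((ph w z - ph w z) * V (z - w))"
        by (intro tendsto_intros)
      then show "(\<lambda>n. cmod ((ph (s n) z - ph w z) * V (z - w))) \<longlonglongrightarrow> 0" by simp
    qed
    show "AE z in lborel. norm (cmod ((ph (s n) z - ph w z) * V (z - w))) \<le> 2 * cmod (V (z - w))" for n
      using b2 by auto
  qed measurable
  have le: "S0_norm (\<lambda>t. tfs (s n) f t - tfs w f t)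
    \<le> (LBINT z. norm (V (z - s n) - V (z - w)) ^ 1) + (LBINT z. cmod ((ph (s n) z - ph w z) * V (z - w)))" for n
  proof -
    have I1: "integrable lborel (\<lambda>z. norm (V (z - s n) - V (z - w)) ^ 1)"
      using lborel_integrable_shift[OF IV, of w] lborel_integrable_shift[OF IV, of "s n"] by simp
    have eq: "stft gaussian (\<lambda>t. tfs (s n) f t - tfs w f t) z = ph (s n) z * V (z - s n) - ph w z * V (z - w)" for z
      by (simp add: stft_gaussian_diff L2_tfs fL stft_tfs gaussian_L2 V_def ph_def)
    have "S0_norm (\<lambda>t. tfs (s n) f t - tfs w f t)
       \<le> (LBINT z. norm (V (z - s n) - V (z - w)) ^ 1 + cmod ((ph (s n) z - ph w z) * V (z - w)))"
      unfolding S0_norm_def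
    proof (rule integral_mono)
      show "integrable lborel (\<lambda>z. cmod (stft gaussian (\<lambda>t. tfs (s n) f t - tfs w f t) z))"
        using S0_integrable[OF S0_diff[OF S0_tfs[OF f] S0_tfs[OF f]]] by simp
      show "integrable lborel (\<lambda>z. norm (V (z - s n) - V (z - w)) ^ 1 + cmod ((ph (s n) z - ph w z) * V (z - w)))"
        by (rule Bochner_Integration.integrable_add[OF I1 integrable_norm[OF I2]])
      fix z
      have "ph (s n) z * V (z - s n) - ph w z * V (z - w) = ph (s n) z * (V (z - s n) - V (z - w)) + (ph (s n) z - ph w z) * V (z - w)"
        by (simp add: algebra_simps)
      then have "cmod (ph (s n) z * V (z - s n) - ph w z * V (z - w)) \<le> cmod (ph (s n) z * (V (z - s n) - V (z - w))) + cmod ((ph (s n) z - ph w z) * V (z - w))"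
        using norm_triangle_ineq by metis
      then show "cmod (stft gaussian (\<lambda>t. tfs (s n) f t - tfs w f t) z)
        \<le> norm (V (z - s n) - V (z - w)) ^ 1 + cmod ((ph (s n) z - ph w z) * V (z - w))"
        unfolding eq by (simp add: norm_mult nph)
    qed
    also have "\<dots> = (LBINT z. norm (V (z - s n) - V (z - w)) ^ 1) + (LBINT z. cmod ((ph (s n) z - ph w z) * V (z - w)))"
      by (rule Bochner_Integration.integral_add[OF I1 integrable_norm[OF I2]])
    finally show ?thesis .
  qed
  have lim: "(\<lambda>n. (LBINT z. norm (V (z - s n) - V (z - w)) ^ 1) + (LBINT z. cmod ((ph (s n) z - ph w z) * V (z - w)))) \<longlonglongrightarrow> 0"
    using tendsto_add[OF lim1 lim2] by simp
  show ?thesis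
    by (rule Lim_null_comparison[OF always_eventually lim], unfold real_norm_def abs_of_nonneg[OF S0_norm_nonneg]) (blast intro: le)
qed

text \<open>Once the window is averaged, the transform is bounded by \<open>P\<close>, a product of
  Gaussian STFTs at z - j(\<zeta>)/2 and z + j(\<zeta>)/2. Translating z and then substituting y = z
  + j(\<zeta>) preserves measure and separates the two factors.\<close>

lemma wigner_S0_bound_nn:
  fixes f h :: "'a::euclidean_space \<Rightarrow> complex"
  assumes f: "f \<in> L2" and h: "h \<in> L2"
  shows "ennreal ((1/2) ^ DIM('a \<times> 'a)) * (LBINT\<^sup>+r. ennreal (cmod (stft gaussian (wigner f h) r)))
    \<le> (LBINT\<^sup>+z. ennreal (cmod (stft gaussian f z))) * (LBINT\<^sup>+z. ennreal (cmod (stft gaussian h z)))"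
proof -
  note [measurable] = L2_measurable[OF f] L2_measurable[OF h]
  have [measurable]: "wigner f h \<in> borel_measurable borel" by (rule wigner_measurable; measurable)
  have [measurable]: "stft gaussian f \<in> borel_measurable borel" "stft gaussian h \<in> borel_measurable borel"
    "stft gaussian (wigner f h) \<in> borel_measurable borel"
    by (rule stft_measurable; measurable)+
  define F H where "F = (\<lambda>z. ennreal (cmod (stft gaussian f z)))" "H = (\<lambda>z. ennreal (cmod (stft gaussian h z)))"
  note FH = this
  have [measurable]: "F \<in> borel_measurable borel" "H \<in> borel_measurable borel"
    unfolding FH by measurable
  define P where "P r = F (fst r - (1/2) *\<^sub>R jmap (snd r)) * H (fst r + (1/2) *\<^sub>R jmap (snd r))" for r
  have [measurable]: "P \<in> borel_measurable borel" unfolding P_def jmap_def by measurable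
  have P: "(LBINT\<^sup>+r. P r) = (LBINT\<^sup>+z. F z) * (LBINT\<^sup>+z. H z)"
  proof -
    have "(LBINT\<^sup>+r. P r) = (LBINT\<^sup>+z. LBINT\<^sup>+\<zeta>. P (z, \<zeta>))"
      by (rule nn_integral_lborel_pair) measurable
    also have "\<dots> = (LBINT\<^sup>+\<zeta>. LBINT\<^sup>+z. P (z, \<zeta>))"
      by (rule nn_integral_lborel_swap) measurable
    also have "\<dots> = (LBINT\<^sup>+\<zeta>. LBINT\<^sup>+z. F z * H (z + jmap \<zeta>))"
    proof (rule nn_integral_cong)
      fix \<zeta> :: "'a \<times> 'a"
      have eq: "z - (1/2) *\<^sub>R jmap \<zeta> + jmap \<zeta> = z + (1/2) *\<^sub>R jmap \<zeta>" for z
      proof -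
        define y where "y = (1/2) *\<^sub>R jmap \<zeta>"
        have "jmap \<zeta> = y + y" unfolding y_def by (simp flip: scaleR_add_left)
        then show ?thesis unfolding y_def[symmetric] by simp
      qed
      show "(LBINT\<^sup>+z. P (z, \<zeta>)) = (LBINT\<^sup>+z. F z * H (z + jmap \<zeta>))"
        using nn_integral_lborel_shift[of "\<lambda>z. F z * H (z + jmap \<zeta>)" "(1/2) *\<^sub>R jmap \<zeta>", unfolded eq] by (simp add: P_def)
    qed
    also have "\<dots> = (LBINT\<^sup>+z. LBINT\<^sup>+\<zeta>. F z * H (z + jmap \<zeta>))"
      using nn_integral_lborel_swap[of "\<lambda>r. F (snd r) * H (snd r + jmap (fst r))"] by (simp add: jmap_def)
    also have "\<dots> = (LBINT\<^sup>+z. F z * (LBINT\<^sup>+y. H y))"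
      by (rule nn_integral_cong, subst nn_integral_cmult) (auto simp: nn_integral_jmap, simp add: jmap_def)
    also have "\<dots> = (LBINT\<^sup>+z. F z) * (LBINT\<^sup>+y. H y)"
      by (rule nn_integral_multc) measurable
    finally show ?thesis .
  qed
  \<comment> \<open>The averaging variable moves only the position component; written as a
    translation of r by \<open>(- w, 0)\<close>, it disappears on integrating over r.\<close>
  have le: "ennreal ((1/2) ^ DIM('a \<times> 'a)) * ennreal (cmod (stft gaussian (wigner f h) r))
      \<le> (LBINT\<^sup>+w. ennreal (gau 2 w) * P (r - (- w, 0)))" for r
  proof -
    obtain z \<zeta> where Pair: "r = (z, \<zeta>)" by (cases r) auto
    have "ennreal ((1/2) ^ DIM('a \<times> 'a)) * ennreal (cmod (stft gaussian (wigner f h) (z, \<zeta>)))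
      \<le> (LBINT\<^sup>+w. ennreal (gau 2 w) * ennreal (cmod (stft (\<lambda>y. complex_of_real (gau 2 y)) (wigner f h) (z + w, \<zeta>))))"
      by (rule stft_gaussian_le_gau2[OF _ wigner_bounded[OF f h]]) measurable
    also have "\<dots> \<le> (LBINT\<^sup>+w. ennreal (gau 2 w) * P (r - (- w, 0)))"
    proof (intro nn_integral_mono mult_left_mono)
      fix w
      have "(1 / sqrt 2) ^ DIM('a) \<le> (1::real)" by (intro power_le_one) auto
      then have "cmod (stft (\<lambda>y. complex_of_real (gau 2 y)) (wigner f h) (z + w, \<zeta>))
         \<le> 1 * (cmod (stft gaussian f (z + w - (1/2) *\<^sub>R jmap \<zeta>)) * cmod (stft gaussian h (z + w + (1/2) *\<^sub>R jmap \<zeta>)))"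
        unfolding stft_gau2_wigner[OF f h] mult.assoc by (rule mult_right_mono) simp
      then show "ennreal (cmod (stft (\<lambda>y. complex_of_real (gau 2 y)) (wigner f h) (z + w, \<zeta>))) \<le> P (r - (- w, 0))"
        by (simp add: P_def FH Pair flip: ennreal_mult)
    qed simp
    finally show ?thesis by (simp only: Pair)
  qed
  have "ennreal ((1/2) ^ DIM('a \<times> 'a)) * (LBINT\<^sup>+r. ennreal (cmod (stft gaussian (wigner f h) r)))
      = (LBINT\<^sup>+r. ennreal ((1/2) ^ DIM('a \<times> 'a)) * ennreal (cmod (stft gaussian (wigner f h) r)))"
    by (rule nn_integral_cmult[symmetric]) measurable
  also have "\<dots> \<le> (LBINT\<^sup>+r. LBINT\<^sup>+w. ennreal (gau 2 w) * P (r - (- w, 0)))"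
    by (intro nn_integral_mono le)
  also have "\<dots> = (LBINT\<^sup>+w. LBINT\<^sup>+r. ennreal (gau 2 w) * P (r - (- w, 0)))"
    using nn_integral_lborel_swap[of "\<lambda>q. ennreal (gau 2 (snd q)) * P (fst q - (- snd q, 0))"] by simp
  also have "\<dots> = (\<integral>\<^sup>+w. ennreal (gau 2 w) * (LBINT\<^sup>+r. P r) \<partial>(lborel :: ('a \<times> 'a) measure))"
    by (simp add: nn_integral_cmult nn_integral_lborel_shift[of P])
  also have "\<dots> = ennreal ((1 / sqrt 2) ^ DIM('a \<times> 'a)) * (LBINT\<^sup>+r. P r)"
    by (subst nn_integral_multc) (auto simp only: gau_nn_integral, auto)
  also have "\<dots> \<le> 1 * (LBINT\<^sup>+r. P r)"
    by (intro mult_right_mono) (auto intro!: power_le_one)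
  finally show ?thesis by (simp add: P) (simp add: FH)
qed

text \<open>The constant in the norm bound is the reciprocal of the mass factor lost when the
  standard window is averaged from \<open>gau 2\<close>.\<close>

lemma wigner_S0:
  fixes f h :: "'a::euclidean_space \<Rightarrow> complex"
  assumes f: "f \<in> S0" and h: "h \<in> S0"
  shows "wigner f h \<in> S0" and "S0_norm (wigner f h) \<le> 2 ^ DIM('a \<times> 'a) * S0_norm f * S0_norm h"
proof -
  note fh = S0_L2[OF f] S0_L2[OF h]
  have bound: "ennreal ((1/2) ^ DIM('a \<times> 'a)) * (LBINT\<^sup>+r. ennreal (cmod (stft gaussian (wigner f h) r)))
      \<le> ennreal (S0_norm f * S0_norm h)"
    using wigner_S0_bound_nn[OF fh] by (simp add: S0_norm_nn[OF f, symmetric] S0_norm_nn[OF h, symmetric] S0_norm_nonneg ennreal_mult)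
  then have "ennreal ((1/2) ^ DIM('a \<times> 'a)) * (LBINT\<^sup>+r. ennreal (cmod (stft gaussian (wigner f h) r))) < \<infinity>"
    by (rule order.strict_trans1) simp
  then have fin: "(LBINT\<^sup>+r. ennreal (cmod (stft gaussian (wigner f h) r))) < \<infinity>"
    by (auto simp: ennreal_mult_less_top)
  have "stft gaussian (wigner f h) \<in> borel_measurable lborel"
    using stft_measurable[OF L2_measurable[OF wigner_L2[OF fh]] gaussian_measurable] by simp
  then show W: "wigner f h \<in> S0"
    using fin by (intro S0I wigner_L2 fh) (auto simp: integrable_iff_bounded)
  have "ennreal ((1/2) ^ DIM('a \<times> 'a) * S0_norm (wigner f h)) \<le> ennreal (S0_norm f * S0_norm h)"
    using bound unfolding S0_norm_nn[OF W, symmetric] by (subst ennreal_mult) (auto simp: S0_norm_nonneg)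
  then have "(1/2) ^ DIM('a \<times> 'a) * S0_norm (wigner f h) \<le> S0_norm f * S0_norm h"
    by (subst (asm) ennreal_le_iff) (auto simp: S0_norm_nonneg)
  from mult_left_mono[OF this, of "2 ^ DIM('a \<times> 'a)"]
  have "(2 ^ DIM('a \<times> 'a) * (1/2) ^ DIM('a \<times> 'a)) * S0_norm (wigner f h) \<le> 2 ^ DIM('a \<times> 'a) * (S0_norm f * S0_norm h)"
    by (simp only: mult.assoc zero_le_power zero_le_numeral)
  moreover have "(2 ^ DIM('a \<times> 'a) * (1/2) ^ DIM('a \<times> 'a)) = (1::real)"
    by (simp only: power_mult_distrib[symmetric]) simp
  ultimately show "S0_norm (wigner f h) \<le> 2 ^ DIM('a \<times> 'a) * S0_norm f * S0_norm h"
    by (simp only: mult_1_left mult.assoc)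
qed

section \<open>The Weyl pairing\<close>

lemma wigner_integrable:
  assumes f: "f \<in> L2" and h: "h \<in> L2"
  shows "integrable lborel (\<lambda>t. f (x + (1/2) *\<^sub>R t) * cnj (h (x - (1/2) *\<^sub>R t)) * cis (- 2 * pi * (\<xi> \<bullet> t)))"
proof (rule integrable_dominated)
  note [measurable] = L2_measurable[OF f] L2_measurable[OF h]
  show "integrable lborel (\<lambda>t. cmod (wig_prod f h x t))" using wig_prod_integrable[OF f h] by simp
  show "(\<lambda>t. f (x + (1/2) *\<^sub>R t) * cnj (h (x - (1/2) *\<^sub>R t)) * cis (- 2 * pi * (\<xi> \<bullet> t))) \<in> borel_measurable lborel"
    by measurable
qed (simp add: wig_prod_def norm_mult)

section \<open>Sesquilinearity and continuity of the Weyl pairing\<close>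

lemma wigner_add_left: "f \<in> L2 \<Longrightarrow> f' \<in> L2 \<Longrightarrow> h \<in> L2 \<Longrightarrow>
  wigner (\<lambda>t. f t + f' t) h = (\<lambda>z. wigner f h z + wigner f' h z)"
  using wigner_integrable by (auto simp: wigner_def fun_eq_iff distrib_right intro!: Bochner_Integration.integral_add)

lemma wigner_add_right: "f \<in> L2 \<Longrightarrow> h \<in> L2 \<Longrightarrow> h' \<in> L2 \<Longrightarrow>
  wigner f (\<lambda>t. h t + h' t) = (\<lambda>z. wigner f h z + wigner f h' z)"
  using wigner_integrable by (auto simp: wigner_def fun_eq_iff distrib_right distrib_left intro!: Bochner_Integration.integral_add)

lemma wigner_scale_left: "wigner (\<lambda>t. c * f t) h = (\<lambda>z. c * wigner f h z)"
  by (auto simp: wigner_def fun_eq_iff mult.assoc)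

lemma wigner_scale_right: "wigner f (\<lambda>t. c * h t) = (\<lambda>z. cnj c * wigner f h z)"
proof -
  have "f a * cnj (c * h b) * e = cnj c * (f a * cnj (h b) * e)" for a b e by simp
  then show ?thesis unfolding wigner_def
    by (auto simp only: integral_mult_right_zero)
qed

lemma S0_dual_add: "\<sigma> \<in> S0_dual \<Longrightarrow> F \<in> S0 \<Longrightarrow> G \<in> S0 \<Longrightarrow> \<sigma> (\<lambda>w. F w + G w) = \<sigma> F + \<sigma> G"
  by (simp add: S0_dual_def)

lemma S0_dual_scale: "\<sigma> \<in> S0_dual \<Longrightarrow> F \<in> S0 \<Longrightarrow> \<sigma> (\<lambda>w. c * F w) = cnj c * \<sigma> F"
  by (simp add: S0_dual_def)

lemma weyl_pair_add_left:
  assumes "\<sigma> \<in> S0_dual" "f \<in> S0" "f' \<in> S0" "h \<in> S0"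
  shows "weyl_pair \<sigma> (\<lambda>t. f t + f' t) h = weyl_pair \<sigma> f h + weyl_pair \<sigma> f' h"
  using assms by (simp add: weyl_pair_def wigner_add_right S0_L2 S0_dual_add wigner_S0(1))

lemma weyl_pair_add_right:
  assumes "\<sigma> \<in> S0_dual" "f \<in> S0" "h \<in> S0" "h' \<in> S0"
  shows "weyl_pair \<sigma> f (\<lambda>t. h t + h' t) = weyl_pair \<sigma> f h + weyl_pair \<sigma> f h'"
  using assms by (simp add: weyl_pair_def wigner_add_left S0_L2 S0_dual_add wigner_S0(1))

text \<open>Two antilinearities cancel: the Wigner distribution is antilinear in its second
  argument, which is \<open>f\<close> here, and so is \<open>\<sigma>\<close> as a
  functional.\<close>

lemma weyl_pair_scale_left:
  assumes "\<sigma> \<in> S0_dual" "f \<in> S0" "h \<in> S0"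
  shows "weyl_pair \<sigma> (\<lambda>t. c * f t) h = c * weyl_pair \<sigma> f h"
  using assms by (simp add: weyl_pair_def wigner_scale_right S0_dual_scale wigner_S0(1))

lemma weyl_pair_scale_right:
  assumes "\<sigma> \<in> S0_dual" "f \<in> S0" "h \<in> S0"
  shows "weyl_pair \<sigma> f (\<lambda>t. c * h t) = cnj c * weyl_pair \<sigma> f h"
  using assms by (simp add: weyl_pair_def wigner_scale_left S0_dual_scale wigner_S0(1))

lemma weyl_pair_bounded:
  fixes \<sigma> :: "('a::euclidean_space \<times> 'a \<Rightarrow> complex) \<Rightarrow> complex"
  assumes "\<sigma> \<in> S0_dual"
  shows "\<exists>D\<ge>0. \<forall>f\<in>S0. \<forall>h\<in>S0. cmod (weyl_pair \<sigma> f h) \<le> D * S0_norm f * S0_norm h"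
proof -
  obtain C where C: "\<And>F. F \<in> S0 \<Longrightarrow> cmod (\<sigma> F) \<le> C * S0_norm F"
    using assms unfolding S0_dual_def by blast
  \<comment> \<open>The constant supplied by \<open>S0_dual\<close> carries no sign, hence
    \<open>max 0 C\<close>.\<close>
  show ?thesis
  proof (intro exI[of _ "max 0 C * 2 ^ DIM('a \<times> 'a)"] conjI ballI)
    fix f h :: "'a \<Rightarrow> complex" assume f: "f \<in> S0" and h: "h \<in> S0"
    have "cmod (weyl_pair \<sigma> f h) \<le> C * S0_norm (wigner h f)"
      unfolding weyl_pair_def by (rule C[OF wigner_S0(1)[OF h f]])
    also have "\<dots> \<le> max 0 C * S0_norm (wigner h f)"
      by (intro mult_right_mono S0_norm_nonneg) simp
    also have "\<dots> \<le> max 0 C * (2 ^ DIM('a \<times> 'a) * S0_norm h * S0_norm f)"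
      by (intro mult_left_mono wigner_S0(2)[OF h f]) simp
    finally show "cmod (weyl_pair \<sigma> f h) \<le> max 0 C * 2 ^ DIM('a \<times> 'a) * S0_norm f * S0_norm h"
      by (simp only: mult_ac)
  qed simp
qed

lemma weyl_pair_diff_left:
  assumes "\<sigma> \<in> S0_dual" "f \<in> S0" "f' \<in> S0" "h \<in> S0"
  shows "weyl_pair \<sigma> (\<lambda>t. f t - f' t) h = weyl_pair \<sigma> f h - weyl_pair \<sigma> f' h"
  using weyl_pair_add_left[OF assms(1,2) S0_scale[OF assms(3), of "-1"] assms(4)]
    weyl_pair_scale_left[OF assms(1,3,4), of "-1"] by simp

lemma weyl_pair_diff_right:
  assumes "\<sigma> \<in> S0_dual" "f \<in> S0" "h \<in> S0" "h' \<in> S0"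
  shows "weyl_pair \<sigma> f (\<lambda>t. h t - h' t) = weyl_pair \<sigma> f h - weyl_pair \<sigma> f h'"
  using weyl_pair_add_right[OF assms(1,2,3) S0_scale[OF assms(4), of "-1"]]
    weyl_pair_scale_right[OF assms(1,2,4), of "-1"] by simp

text \<open>The difference is split into one change per argument; isometry of shifts on
  \<open>S0\<close> keeps the norm of the other factor constant.\<close>

lemma weyl_pair_tfs_continuous:
  fixes g :: "'a::euclidean_space \<Rightarrow> complex"
  assumes \<sigma>: "\<sigma> \<in> S0_dual" and g: "g \<in> S0" and a: "a \<longlonglongrightarrow> l" and b: "b \<longlonglongrightarrow> m"
  shows "(\<lambda>n. weyl_pair \<sigma> (tfs (b n) g) (tfs (a n) g)) \<longlonglongrightarrow> weyl_pair \<sigma> (tfs m g) (tfs l g)"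
proof -
  obtain D where D: "\<And>f h. f \<in> S0 \<Longrightarrow> h \<in> S0 \<Longrightarrow> cmod (weyl_pair \<sigma> f h) \<le> D * S0_norm f * S0_norm h"
    using weyl_pair_bounded[OF \<sigma>] by blast
  let ?a = "\<lambda>n t. tfs (a n) g t - tfs l g t" and ?b = "\<lambda>n t. tfs (b n) g t - tfs m g t"
  note S = S0_tfs[OF g] S0_diff[OF S0_tfs[OF g] S0_tfs[OF g]]
  have eq: "weyl_pair \<sigma> (tfs (b n) g) (tfs (a n) g) - weyl_pair \<sigma> (tfs m g) (tfs l g)
      = weyl_pair \<sigma> (?b n) (tfs (a n) g) + weyl_pair \<sigma> (tfs m g) (?a n)" for n
    by (simp add: weyl_pair_diff_left weyl_pair_diff_right \<sigma> S)
  have "cmod (weyl_pair \<sigma> (tfs (b n) g) (tfs (a n) g) - weyl_pair \<sigma> (tfs m g) (tfs l g))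
      \<le> D * S0_norm (?b n) * S0_norm g + D * S0_norm g * S0_norm (?a n)" for n
    unfolding eq using D[OF S(2) S(1), of "b n" m "a n"] D[OF S(1) S(2), of m "a n" l]
      norm_triangle_ineq[of "weyl_pair \<sigma> (?b n) (tfs (a n) g)" "weyl_pair \<sigma> (tfs m g) (?a n)"]
    unfolding S0_norm_tfs[OF g] by linarith
  note le = this
  have "(\<lambda>n. D * S0_norm (?b n) * S0_norm g + D * S0_norm g * S0_norm (?a n)) \<longlonglongrightarrow> D * 0 * S0_norm g + D * S0_norm g * 0"
    by (intro tendsto_intros S0_tfs_continuous g a b)
  then have lim: "(\<lambda>n. D * S0_norm (?b n) * S0_norm g + D * S0_norm g * S0_norm (?a n)) \<longlonglongrightarrow> 0" by simp
  have "(\<lambda>n. weyl_pair \<sigma> (tfs (b n) g) (tfs (a n) g) - weyl_pair \<sigma> (tfs m g) (tfs l g)) \<longlonglongrightarrow> 0"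
    by (rule Lim_null_comparison[OF always_eventually lim]) (blast intro: le)
  then show ?thesis by (simp add: LIM_zero_iff)
qed

section \<open>Tight Gabor frames\<close>

text \<open>Subtractions are written as additions with scalar factors, the shape to which the rules
  for \<open>has_sum\<close> apply.\<close>

lemma complex_polarization:
  "a * cnj b = (of_real ((cmod (a + b))\<^sup>2) + (- 1) * of_real ((cmod (a - b))\<^sup>2)
     + \<i> * of_real ((cmod (a + \<i> * b))\<^sup>2) + (- \<i>) * of_real ((cmod (a - \<i> * b))\<^sup>2)) / 4"
  by (simp add: complex_norm_square complex_cnj_add del: of_real_power) (simp add: algebra_simps)

lemma tight_frame_has_sum:
  assumes frame: "tight_gabor_frame \<Lambda> g" and f: "f \<in> L2"
  shows "((\<lambda>l. complex_of_real ((cmod (l2_inner f (tfs l g)))\<^sup>2)) has_sum complex_of_real (l2_normsq f)) \<Lambda>"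
proof -
  have "(\<lambda>l. (cmod (l2_inner f (tfs l g)))\<^sup>2) summable_on \<Lambda>"
    and "l2_normsq f = (\<Sum>\<^sub>\<infinity>l\<in>\<Lambda>. (cmod (l2_inner f (tfs l g)))\<^sup>2)"
    using frame f unfolding tight_gabor_frame_def by auto
  then have "((\<lambda>l. (cmod (l2_inner f (tfs l g)))\<^sup>2) has_sum l2_normsq f) \<Lambda>" by simp
  then show ?thesis by (rule has_sum_of_real)
qed

text \<open>The frame identity is polarised twice, on the coefficients and under the integral, with
  the same four combinations of \<open>f\<close> and \<open>h\<close>.\<close>

lemma tight_frame_inner_has_sum:
  assumes frame: "tight_gabor_frame \<Lambda> g" and f: "f \<in> L2" and h: "h \<in> L2"
  shows "((\<lambda>l. l2_inner f (tfs l g) * cnj (l2_inner h (tfs l g))) has_sum l2_inner f h) \<Lambda>"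
proof -
  have g: "g \<in> L2" using frame by (simp add: tight_gabor_frame_def)
  have ih: "(\<lambda>t. \<i> * h t) \<in> L2" by (rule L2_scale[OF h])
  let ?N = "\<lambda>u l. complex_of_real ((cmod (l2_inner u (tfs l g)))\<^sup>2)"
  let ?u = "\<lambda>t. f t + h t" and ?v = "\<lambda>t. f t - h t" and ?x = "\<lambda>t. f t + \<i> * h t" and ?y = "\<lambda>t. f t - \<i> * h t"
  have L: "?u \<in> L2" "?v \<in> L2" "?x \<in> L2" "?y \<in> L2" by (intro L2_add L2_diff f h ih)+
  have i: "l2_inner ?u (tfs l g) = l2_inner f (tfs l g) + l2_inner h (tfs l g)"
    "l2_inner ?v (tfs l g) = l2_inner f (tfs l g) - l2_inner h (tfs l g)"
    "l2_inner ?x (tfs l g) = l2_inner f (tfs l g) + \<i> * l2_inner h (tfs l g)"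
    "l2_inner ?y (tfs l g) = l2_inner f (tfs l g) - \<i> * l2_inner h (tfs l g)" for l
    by (simp_all add: l2_inner_add_left l2_inner_diff_left f h ih L2_tfs g l2_inner_scale_left)
  note F = tight_frame_has_sum[OF frame]
  have "((\<lambda>l. (?N ?u l + (- 1) * ?N ?v l + \<i> * ?N ?x l + (- \<i>) * ?N ?y l) * (1/4)) has_sum
    (complex_of_real (l2_normsq ?u) + (- 1) * complex_of_real (l2_normsq ?v) + \<i> * complex_of_real (l2_normsq ?x) + (- \<i>) * complex_of_real (l2_normsq ?y)) * (1/4)) \<Lambda>"
    by (intro has_sum_cmult_left has_sum_add has_sum_cmult_right F L)
  moreover have "(?N ?u l + (- 1) * ?N ?v l + \<i> * ?N ?x l + (- \<i>) * ?N ?y l) * (1/4) = l2_inner f (tfs l g) * cnj (l2_inner h (tfs l g))" for l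
    unfolding i complex_polarization[of "l2_inner f (tfs l g)"] by simp
  moreover have "(complex_of_real (l2_normsq ?u) + (- 1) * complex_of_real (l2_normsq ?v) + \<i> * complex_of_real (l2_normsq ?x) + (- \<i>) * complex_of_real (l2_normsq ?y)) * (1/4)
     = l2_inner f h"
  proof -
    have "l2_inner f h = (LBINT t. (complex_of_real ((cmod (?u t))\<^sup>2) + (- 1) * complex_of_real ((cmod (?v t))\<^sup>2)
       + \<i> * complex_of_real ((cmod (?x t))\<^sup>2) + (- \<i>) * complex_of_real ((cmod (?y t))\<^sup>2)) / 4)"
      unfolding l2_inner_def by (rule Bochner_Integration.integral_cong[OF refl]) (rule complex_polarization)
    also have "\<dots> = (complex_of_real (l2_normsq ?u) + (- 1) * complex_of_real (l2_normsq ?v) + \<i> * complex_of_real (l2_normsq ?x) + (- \<i>) * complex_of_real (l2_normsq ?y)) * (1/4)"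
    proof -
      have I: "integrable lborel (\<lambda>t. complex_of_real ((cmod (u t))\<^sup>2))" if "u \<in> L2" for u :: "'a \<Rightarrow> complex"
        using L2_integrable[OF that] by (simp only: integrable_of_real)
      show ?thesis
        unfolding l2_normsq_def integral_complex_of_real[symmetric] integral_divide_zero
        using I[OF L(1)] I[OF L(2)] I[OF L(3)] I[OF L(4)]
        by (simp del: of_real_power)
    qed
    finally show ?thesis by simp
  qed
  ultimately show ?thesis by simp
qed

lemma tight_frame_gaussian_coeff_nonzero:
  fixes g :: "'a::euclidean_space \<Rightarrow> complex"
  assumes frame: "tight_gabor_frame \<Lambda> g"
  shows "\<exists>m\<in>\<Lambda>. l2_inner gaussian (tfs m g) \<noteq> 0"
proof (rule ccontr)
  assume "\<not> ?thesis"
  then have "(\<Sum>\<^sub>\<infinity>l\<in>\<Lambda>. (cmod (l2_inner gaussian (tfs l g)))\<^sup>2) = 0"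
    by (intro infsum_0) auto
  moreover have "l2_normsq (gaussian :: 'a \<Rightarrow> complex) = (\<Sum>\<^sub>\<infinity>l\<in>\<Lambda>. (cmod (l2_inner gaussian (tfs l g)))\<^sup>2)"
    using frame gaussian_L2[where 'a='a] unfolding tight_gabor_frame_def by blast
  ultimately have "l2_normsq (gaussian :: 'a \<Rightarrow> complex) = 0" by (simp only:)
  then show False using gaussian_normsq_pos[where 'a='a] by simp
qed

text \<open>The Gaussian may be orthogonal to \<open>g\<close>, so the window is changed to a frame
  element \<open>tfs m g\<close> that it does meet. This only translates the modulus of
  \<open>stft g g\<close>, hence preserves integrability.\<close>

lemma S0_of_tight_frame:
  fixes g :: "'a::euclidean_space \<Rightarrow> complex"
  assumes frame: "tight_gabor_frame \<Lambda> g" and int: "integrable lborel (stft g g)"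
  shows "g \<in> S0"
proof -
  have g: "g \<in> L2" using frame by (simp add: tight_gabor_frame_def)
  obtain m where m: "l2_inner gaussian (tfs m g) \<noteq> 0"
    using tight_frame_gaussian_coeff_nonzero[OF frame] by auto
  have "integrable lborel (stft (tfs m g) g)"
  proof (rule integrable_dominated)
    show "integrable lborel (\<lambda>z. cmod (stft g g (z - (- m))))"
      using lborel_integrable_shift[OF int, of "- m"] by simp
    show "stft (tfs m g) g \<in> borel_measurable lborel"
      using stft_measurable[OF L2_measurable[OF g] L2_measurable[OF L2_tfs[OF g]]] by simp
  qed (simp add: stft_window_tfs norm_mult)
  from S0_of_integrable_stft[OF g L2_tfs[OF g] this m] show ?thesis .
qed

text \<open>Fatou's lemma works with sequences, whereas \<open>has_sum\<close> converges along the
  net of finite subsets; a sequence running to the top of the net links the two.\<close>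

lemma countable_exhausting_sequence:
  assumes "countable (\<Lambda> :: 'b set)"
  shows "\<exists>X :: nat \<Rightarrow> 'b set. (\<forall>n. finite (X n) \<and> X n \<subseteq> \<Lambda>) \<and> filterlim X (finite_subsets_at_top \<Lambda>) sequentially"
proof -
  obtain e :: "'b \<Rightarrow> nat" where e: "inj_on e \<Lambda>" using assms by (auto simp: countable_def)
  let ?X = "\<lambda>n. {m \<in> \<Lambda>. e m \<le> n}"
  have fin: "finite (?X n)" for n
    by (rule finite_imageD[of e]) (auto intro: finite_subset[of _ "{..n}"] inj_on_subset[OF e])
  have "filterlim ?X (finite_subsets_at_top \<Lambda>) sequentially"
    unfolding filterlim_finite_subsets_at_top
  proof (intro allI impI)
    fix F assume F: "finite F \<and> F \<subseteq> \<Lambda>"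
    then obtain N where "\<And>m. m \<in> F \<Longrightarrow> e m \<le> N"
      using finite_nat_set_iff_bounded_le[of "e ` F"] by auto
    then show "\<forall>\<^sub>F n in sequentially. finite (?X n) \<and> F \<subseteq> ?X n \<and> ?X n \<subseteq> \<Lambda>"
      using F fin by (intro eventually_sequentiallyI[of N]) force
  qed
  then show ?thesis using fin by (intro exI[of _ ?X]) auto
qed

lemma summable_tail_small:
  fixes c :: "'b \<Rightarrow> real"
  assumes sm: "c summable_on \<Lambda>" and c0: "\<And>m. m \<in> \<Lambda> \<Longrightarrow> 0 \<le> c m" and e: "e > 0"
  shows "\<forall>\<^sub>F S in finite_subsets_at_top \<Lambda>. \<forall>F. finite F \<and> F \<subseteq> \<Lambda> - S \<longrightarrow> sum c F \<le> e"
proof -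
  have "(sum c \<longlongrightarrow> infsum c \<Lambda>) (finite_subsets_at_top \<Lambda>)"
    using has_sum_infsum[OF sm] by (simp add: has_sum_def)
  then have "\<forall>\<^sub>F S in finite_subsets_at_top \<Lambda>. infsum c \<Lambda> - e < sum c S"
    using e by (intro order_tendstoD) auto
  moreover have "\<forall>\<^sub>F S in finite_subsets_at_top \<Lambda>. finite S \<and> S \<subseteq> \<Lambda>"
    by (auto simp: eventually_finite_subsets_at_top)
  ultimately show ?thesis
  proof eventually_elim
    case (elim S)
    show ?case
    proof (intro allI impI)
      fix F assume F: "finite F \<and> F \<subseteq> \<Lambda> - S"
      have "sum c S + sum c F = sum c (S \<union> F)"
        using F elim by (intro sum.union_disjoint[symmetric]) auto
      also have "\<dots> \<le> infsum c \<Lambda>"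
        using F elim c0 by (intro finite_sum_le_infsum sm) auto
      finally show "sum c F \<le> e" using elim by linarith
    qed
  qed
qed

text \<open>Absolute summability bounds the distances between partial sums in the \<open>S0\<close>
  norm. The Gaussian STFTs of the partial sums converge pointwise to that of \<open>f\<close>, so
  Fatou's lemma passes the bound to the remainder.\<close>

lemma frame_expansion_S0:
  fixes f g :: "'a::euclidean_space \<Rightarrow> complex"
  assumes frame: "tight_gabor_frame \<Lambda> g" and g: "g \<in> S0" and \<Lambda>: "countable \<Lambda>" and f: "f \<in> S0"
    and sm: "(\<lambda>m. cmod (l2_inner f (tfs m g))) summable_on \<Lambda>" and e: "e > 0"
  shows "\<forall>\<^sub>F S in finite_subsets_at_top \<Lambda>. S0_norm (\<lambda>t. f t - (\<Sum>m\<in>S. l2_inner f (tfs m g) * tfs m g t)) \<le> e"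
proof -
  define c where "c m = l2_inner f (tfs m g)" for m
  define p where "p S = (\<lambda>t. \<Sum>m\<in>S. c m * tfs m g t)" for S
  have pS: "p S \<in> S0" for S unfolding p_def by (intro S0_sum S0_scale S0_tfs g)
  obtain X where X: "\<And>n. finite (X n)" "\<And>n. X n \<subseteq> \<Lambda>" and limX: "filterlim X (finite_subsets_at_top \<Lambda>) sequentially"
    using countable_exhausting_sequence[OF \<Lambda>] by blast
  \<comment> \<open>Adding 1 keeps the denominator positive even if \<open>S0_norm g\<close> is
    0.\<close>
  define e' where "e' = e / (S0_norm g + 1)"
  have g1: "S0_norm g + 1 > 0" using S0_norm_nonneg[of g] by linarith
  have e': "e' > 0" using e g1 by (simp add: e'_def)
  have e'e: "e' * S0_norm g \<le> e"
  proof -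
    have "e' * S0_norm g \<le> e' * (S0_norm g + 1)" using e' by simp
    also have "\<dots> = e" using g1 by (simp add: e'_def)
    finally show ?thesis .
  qed
  \<comment> \<open>The Gaussian STFT at z is an inner product with \<open>tfs z gaussian\<close>,
    so the weak L^2 expansion of \<open>f\<close> already gives its pointwise convergence.\<close>
  have conv: "(\<lambda>n. stft gaussian (p (X n)) z) \<longlonglongrightarrow> stft gaussian f z" for z
  proof -
    have "((\<lambda>m. c m * cnj (l2_inner (tfs z gaussian) (tfs m g))) has_sum l2_inner f (tfs z gaussian)) \<Lambda>"
      unfolding c_def by (rule tight_frame_inner_has_sum[OF frame S0_L2[OF f] L2_tfs[OF gaussian_L2]])
    then have "((\<lambda>S. \<Sum>m\<in>S. c m * stft gaussian (tfs m g) z) \<longlongrightarrow> stft gaussian f z) (finite_subsets_at_top \<Lambda>)"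
      by (simp add: has_sum_def l2_inner_cnj stft_def)
    from filterlim_compose[OF this limX]
    have "(\<lambda>n. \<Sum>m\<in>X n. c m * stft gaussian (tfs m g) z) \<longlonglongrightarrow> stft gaussian f z" .
    moreover have "stft gaussian (p S) z = (\<Sum>m\<in>S. c m * stft gaussian (tfs m g) z)" for S
      unfolding stft_def p_def
      by (subst l2_inner_sum_left) (auto intro: L2_scale L2_tfs S0_L2 g gaussian_L2 simp: l2_inner_scale_left)
    ultimately show ?thesis by simp
  qed
  have fin: "\<forall>\<^sub>F S in finite_subsets_at_top \<Lambda>. finite S \<and> S \<subseteq> \<Lambda>"
    by (auto simp: eventually_finite_subsets_at_top)
  have "\<forall>\<^sub>F S in finite_subsets_at_top \<Lambda>. \<forall>F. finite F \<and> F \<subseteq> \<Lambda> - S \<longrightarrow> (\<Sum>m\<in>F. cmod (c m)) \<le> e'"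
    by (rule summable_tail_small[OF _ _ e']) (use sm in \<open>auto simp: c_def\<close>)
  with fin show ?thesis
  proof eventually_elim
    case (elim S)
    have dS: "(\<lambda>t. f t - p S t) \<in> S0" by (intro S0_diff f pS)
    have le: "S0_norm (\<lambda>t. p (X n) t - p S t) \<le> e" if "S \<subseteq> X n" for n
    proof -
      have "(\<lambda>t. p (X n) t - p S t) = (\<lambda>t. \<Sum>m\<in>X n - S. c m * tfs m g t)"
        unfolding p_def using that X(1) by (simp add: sum_diff)
      then have "S0_norm (\<lambda>t. p (X n) t - p S t) \<le> (\<Sum>m\<in>X n - S. S0_norm (\<lambda>t. c m * tfs m g t))"
        by (simp only:) (intro S0_norm_sum_le S0_scale S0_tfs g)
      also have "\<dots> = (\<Sum>m\<in>X n - S. cmod (c m)) * S0_norm g"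
        by (simp add: S0_norm_scale S0_norm_tfs g sum_distrib_right)
      also have "\<dots> \<le> e' * S0_norm g"
      proof (rule mult_right_mono[OF _ S0_norm_nonneg])
        have "finite (X n - S) \<and> X n - S \<subseteq> \<Lambda> - S" using X by blast
        with elim(2) show "(\<Sum>m\<in>X n - S. cmod (c m)) \<le> e'" by blast
      qed
      finally show ?thesis using e'e by linarith
    qed
    have dX: "(\<lambda>t. p (X n) t - p S t) \<in> S0" for n by (intro S0_diff pS)
    have ev: "\<forall>\<^sub>F n in sequentially. S \<subseteq> X n"
    proof -
      have "\<forall>\<^sub>F n in sequentially. finite (X n) \<and> S \<subseteq> X n \<and> X n \<subseteq> \<Lambda>"
        using limX elim(1) unfolding filterlim_finite_subsets_at_top by blast
      then show ?thesis by eventually_elim blast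
    qed
    have "ennreal (S0_norm (\<lambda>t. f t - p S t)) = (LBINT\<^sup>+z. ennreal (cmod (stft gaussian (\<lambda>t. f t - p S t) z)))"
      by (rule S0_norm_nn[OF dS])
    also have "\<dots> = (LBINT\<^sup>+z. liminf (\<lambda>n. ennreal (cmod (stft gaussian (\<lambda>t. p (X n) t - p S t) z))))"
    proof (rule nn_integral_cong)
      fix z :: "'a \<times> 'a"
      have "(\<lambda>n. ennreal (cmod (stft gaussian (\<lambda>t. p (X n) t - p S t) z))) \<longlonglongrightarrow> ennreal (cmod (stft gaussian (\<lambda>t. f t - p S t) z))"
        by (simp add: stft_gaussian_diff S0_L2 pS f) (intro tendsto_ennrealI tendsto_intros conv)
      from lim_imp_Liminf[OF _ this]
      show "ennreal (cmod (stft gaussian (\<lambda>t. f t - p S t) z)) = liminf (\<lambda>n. ennreal (cmod (stft gaussian (\<lambda>t. p (X n) t - p S t) z)))"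
        by simp
    qed
    also have "\<dots> \<le> liminf (\<lambda>n. LBINT\<^sup>+z. ennreal (cmod (stft gaussian (\<lambda>t. p (X n) t - p S t) z)))"
      using S0_integrable[OF dX] by (intro nn_integral_liminf) auto
    also have "\<dots> = liminf (\<lambda>n. ennreal (S0_norm (\<lambda>t. p (X n) t - p S t)))"
      by (simp only: S0_norm_nn[OF dX])
    also have "\<dots> \<le> ennreal e"
    proof (rule Liminf_le)
      show "\<forall>\<^sub>F n in sequentially. ennreal (S0_norm (\<lambda>t. p (X n) t - p S t)) \<le> ennreal e"
        using ev by eventually_elim (rule ennreal_leI, rule le)
    qed simp
    finally have "S0_norm (\<lambda>t. f t - p S t) \<le> e" using e by simp
    then show ?case by (simp add: p_def c_def)
  qed
qed

text \<open>Kept abstract because two functionals are expanded later: the Weyl pairing in its first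
  argument and the conjugate of the pairing in its second.\<close>

lemma frame_expansion_functional:
  fixes f g :: "'a::euclidean_space \<Rightarrow> complex"
  assumes frame: "tight_gabor_frame \<Lambda> g" and g: "g \<in> S0" and \<Lambda>: "countable \<Lambda>" and f: "f \<in> S0"
    and sm: "(\<lambda>m. cmod (l2_inner f (tfs m g))) summable_on \<Lambda>"
    and add: "\<And>u v. u \<in> S0 \<Longrightarrow> v \<in> S0 \<Longrightarrow> B (\<lambda>t. u t + v t) = B u + B v"
    and scale: "\<And>c u. u \<in> S0 \<Longrightarrow> B (\<lambda>t. c * u t) = c * B u"
    and bound: "\<And>u. u \<in> S0 \<Longrightarrow> cmod (B u) \<le> D * S0_norm u"
  shows "((\<lambda>m. l2_inner f (tfs m g) * B (tfs m g)) has_sum B f) \<Lambda>"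
proof -
  define c where "c m = l2_inner f (tfs m g)" for m
  have zero: "B (\<lambda>t. 0) = 0" using scale[OF S0_zero, of 0] by simp
  have sum: "B (\<lambda>t. \<Sum>m\<in>S. c m * tfs m g t) = (\<Sum>m\<in>S. c m * B (tfs m g))" for S
  proof (induction S rule: infinite_finite_induct)
    case (insert x S)
    then show ?case by (simp add: add scale S0_scale S0_sum S0_tfs g)
  qed (simp_all add: zero)
  have diff: "B (\<lambda>t. u t - v t) = B u - B v" if "u \<in> S0" "v \<in> S0" for u v
    using add[OF that(1) S0_scale[OF that(2), of "-1"]] scale[OF that(2), of "-1"] by simp
  have "((\<lambda>S. \<Sum>m\<in>S. c m * B (tfs m g)) \<longlongrightarrow> B f) (finite_subsets_at_top \<Lambda>)"
  proof (rule tendstoI)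
    fix e :: real assume e: "e > 0"
    define e' where "e' = e / (2 * (\<bar>D\<bar> + 1))"
    have e': "e' > 0" using e by (simp add: e'_def)
    from frame_expansion_S0[OF frame g \<Lambda> f sm e']
    show "\<forall>\<^sub>F S in finite_subsets_at_top \<Lambda>. dist (\<Sum>m\<in>S. c m * B (tfs m g)) (B f) < e"
    proof eventually_elim
      case (elim S)
      let ?p = "\<lambda>t. \<Sum>m\<in>S. c m * tfs m g t"
      have p: "?p \<in> S0" by (intro S0_sum S0_scale S0_tfs g)
      have "cmod (B f - B ?p) \<le> D * S0_norm (\<lambda>t. f t - ?p t)"
        using bound[OF S0_diff[OF f p]] by (simp add: diff[OF f p])
      also have "\<dots> \<le> (\<bar>D\<bar> + 1) * e'"
        using elim S0_norm_nonneg by (intro mult_mono) (auto simp: c_def)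
      also have "\<dots> = e / 2" by (simp add: e'_def field_simps)
      finally show ?case using e by (simp add: sum dist_norm norm_minus_commute)
    qed
  qed
  then show ?thesis by (simp add: has_sum_def c_def)
qed

section \<open>Solid convolution algebras are contained in \<open>\<ell>\<^sup>1\<close>\<close>

lemma conv_finite_left:
  assumes F: "finite F" "F \<subseteq> \<Lambda>" and a: "\<And>x. x \<notin> F \<Longrightarrow> a x = 0" and x: "x \<in> \<Lambda>"
  shows "conv \<Lambda> a c x = (\<Sum>\<mu>\<in>F. a \<mu> * c (x - \<mu>))"
proof -
  have "(\<Sum>\<^sub>\<infinity>\<mu>\<in>\<Lambda>. a \<mu> * c (x - \<mu>)) = (\<Sum>\<^sub>\<infinity>\<mu>\<in>F. a \<mu> * c (x - \<mu>))"
    using F by (intro infsum_cong_neutral) (auto simp: a)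
  then show ?thesis using F x by (simp add: conv_def)
qed

text \<open>Only the subgroup property of the lattice is retained; the ambient vector space allows
  sums with multiplicities to be written as linear combinations.\<close>

locale solid_conv_algebra =
  fixes \<Lambda> :: "'b::real_vector set" and A n
  assumes alg: "solid_inv_conv_alg \<Lambda> A n"
    and zero_mem: "0 \<in> \<Lambda>" and add_mem: "\<And>x y. x \<in> \<Lambda> \<Longrightarrow> y \<in> \<Lambda> \<Longrightarrow> x + y \<in> \<Lambda>"
    and neg_mem: "\<And>x. x \<in> \<Lambda> \<Longrightarrow> - x \<in> \<Lambda>"
begin

lemma diff_mem: "x \<in> \<Lambda> \<Longrightarrow> y \<in> \<Lambda> \<Longrightarrow> x - y \<in> \<Lambda>"
  using add_mem[OF _ neg_mem, of x y] by simp

lemma banach: "banach_seq_space \<Lambda> A n"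
  using alg by (simp add: solid_inv_conv_alg_def)

lemma solidD:
  assumes "b \<in> A" "\<And>x. x \<notin> \<Lambda> \<Longrightarrow> a x = 0" "\<And>x. cmod (a x) \<le> cmod (b x)"
  shows "a \<in> A" "n a \<le> n b"
  using alg assms unfolding solid_inv_conv_alg_def solid_def by blast+

lemma conv_mem: "a \<in> A \<Longrightarrow> b \<in> A \<Longrightarrow> conv \<Lambda> a b \<in> A"
  and norm_conv_le: "a \<in> A \<Longrightarrow> b \<in> A \<Longrightarrow> n (conv \<Lambda> a b) \<le> n a * n b"
  using alg unfolding solid_inv_conv_alg_def by blast+

lemma norm_nonneg: "a \<in> A \<Longrightarrow> 0 \<le> n a"
  using banach unfolding banach_seq_space_def by blast

lemma norm_scale: "a \<in> A \<Longrightarrow> n (\<lambda>x. c * a x) = cmod c * n a"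
  using banach unfolding banach_seq_space_def by blast

lemma delta_mem: "l \<in> \<Lambda> \<Longrightarrow> delta l \<in> A"
  using alg unfolding solid_inv_conv_alg_def by blast

lemma conv_delta:
  assumes "l \<in> \<Lambda>" "m \<in> \<Lambda>"
  shows "conv \<Lambda> (delta l) (delta m) = delta (l + m)"
proof (rule ext)
  fix x
  show "conv \<Lambda> (delta l) (delta m) x = delta (l + m) x"
  proof (cases "x \<in> \<Lambda>")
    case True
    then have "conv \<Lambda> (delta l) (delta m) x = (\<Sum>\<mu>\<in>{l}. delta l \<mu> * delta m (x - \<mu>))"
      using assms by (intro conv_finite_left) (auto simp: delta_def)
    then show ?thesis by (auto simp: delta_def algebra_simps)
  next
    case False
    then have "x \<noteq> l + m" using add_mem assms by blast
    then show ?thesis using False by (simp add: conv_def delta_def)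
  qed
qed

text \<open>\<open>delta 0\<close> is a nonzero idempotent, so its norm is at least 1. It is the
  convolution of \<open>delta l\<close> and \<open>delta (- l)\<close>, which the involution
  exchanges without increasing the norm.\<close>

lemma norm_delta_ge_1:
  assumes l: "l \<in> \<Lambda>" shows "1 \<le> n (delta l)"
proof -
  have "delta 0 \<noteq> (\<lambda>_::'b. 0)" by (auto simp: delta_def fun_eq_iff)
  moreover have "n a = 0 \<longleftrightarrow> a = (\<lambda>_. 0)" if "a \<in> A" for a
    using banach that unfolding banach_seq_space_def by blast
  ultimately have "n (delta 0) \<noteq> 0" using delta_mem[OF zero_mem] by blast
  then have pos: "n (delta 0) > 0" using norm_nonneg[OF delta_mem[OF zero_mem]] by linarith
  have "n (delta 0) \<le> n (delta 0) * n (delta 0)"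
    using norm_conv_le[OF delta_mem delta_mem, OF zero_mem zero_mem] by (simp add: conv_delta zero_mem)
  then have one: "1 \<le> n (delta 0)" using pos by simp
  have "invol (delta l) = delta (- l)"
    by (auto simp: invol_def delta_def fun_eq_iff)
  then have "n (delta (- l)) \<le> n (delta l)"
    using alg delta_mem[OF l] unfolding solid_inv_conv_alg_def by metis
  then have "n (delta l) * n (delta (- l)) \<le> n (delta l) * n (delta l)"
    by (intro mult_left_mono norm_nonneg delta_mem l)
  moreover have "n (delta 0) \<le> n (delta l) * n (delta (- l))"
    using norm_conv_le[OF delta_mem delta_mem, OF l neg_mem[OF l]] by (simp add: conv_delta l neg_mem)
  ultimately have "1 \<le> (n (delta l))\<^sup>2" using one by (simp add: power2_eq_square)
  then show ?thesis using norm_nonneg[OF delta_mem[OF l]] by (simp add: power2_nonneg_ge_1_iff)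
qed

text \<open>By solidity a sequence dominates its restriction to one point, a multiple of a delta,
  and deltas have norm at least 1.\<close>

lemma norm_ge_coeff:
  assumes a: "a \<in> A" shows "cmod (a x) \<le> n a"
proof (cases "x \<in> \<Lambda>")
  case True
  have "cmod (a x) * 1 \<le> cmod (a x) * n (delta x)"
    by (intro mult_left_mono norm_delta_ge_1 True) simp
  also have "\<dots> = n (\<lambda>y. a x * delta x y)"
    by (rule norm_scale[symmetric, OF delta_mem[OF True]])
  also have "\<dots> \<le> n a"
    using True by (intro solidD(2)[OF a]) (auto simp: delta_def)
  finally show ?thesis by simp
next
  case False
  then have "a x = 0" using banach a unfolding banach_seq_space_def by blast
  then show ?thesis using norm_nonneg[OF a] by simp
qed

end

text \<open>If s exceeded r, the powers of c = s / r > 1 would grow exponentially and yet stay below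
  a fixed power of k + 2.\<close>

lemma exponential_beats_polynomial:
  fixes s r :: real
  assumes s: "0 \<le> s" and r: "0 \<le> r" and le: "\<And>k. s ^ Suc k \<le> real (k + 2) ^ N * r ^ Suc k"
  shows "s \<le> r"
proof (rule ccontr)
  assume "\<not> s \<le> r"
  then have sr: "s > r" by simp
  have "r \<noteq> 0"
  proof
    assume "r = 0" then have "s \<le> 0" using le[of 0] by simp
    then show False using sr \<open>r = 0\<close> by simp
  qed
  then have r0: "r > 0" using r by simp
  define c where "c = s / r"
  have c: "c > 1" using sr r0 by (simp add: c_def)
  have le': "c ^ Suc k \<le> real (k + 2) ^ N" for k
    using le[of k] r0 unfolding c_def power_divide by (simp add: divide_le_eq mult.commute)
  have "filterlim (\<lambda>k. real (k + 2) * ln c) at_top sequentially"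
  proof -
    have "filterlim (\<lambda>k. real (k + 2)) at_top sequentially"
      using filterlim_compose[OF filterlim_real_sequentially filterlim_add_const_nat_at_top[of 2]] by simp
    then show ?thesis using c by (intro filterlim_at_top_mult_tendsto_pos[OF tendsto_const]) auto
  qed
  from filterlim_compose[OF tendsto_power_div_exp_0[of N] this]
  have "(\<lambda>k. (real (k + 2) * ln c) ^ N / exp (real (k + 2) * ln c)) \<longlonglongrightarrow> 0" .
  \<comment> \<open>The factor \<open>c / (ln c) ^ N\<close> cancels the logarithms and adjusts the
    exponent k + 2 to \<open>Suc k\<close>, so the quotient becomes
    \<open>real (k + 2) ^ N / c ^ Suc k\<close>.\<close>
  then have "(\<lambda>k. (real (k + 2) * ln c) ^ N / exp (real (k + 2) * ln c) * (c / (ln c) ^ N)) \<longlonglongrightarrow> 0 * (c / (ln c) ^ N)"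
    by (intro tendsto_intros)
  then have lim: "(\<lambda>k. (real (k + 2) * ln c) ^ N / exp (real (k + 2) * ln c) * (c / (ln c) ^ N)) \<longlonglongrightarrow> 0" by simp
  have "1 \<le> (real (k + 2) * ln c) ^ N / exp (real (k + 2) * ln c) * (c / (ln c) ^ N)" for k
  proof -
    have "exp (real (k + 2) * ln c) = c ^ (k + 2)"
      using c by (subst exp_of_nat_mult) simp
    moreover have "ln c > 0" using c by simp
    ultimately have "(real (k + 2) * ln c) ^ N / exp (real (k + 2) * ln c) * (c / (ln c) ^ N) = real (k + 2) ^ N / c ^ Suc k"
      using c by (simp add: power_mult_distrib)
    moreover have "1 \<le> real (k + 2) ^ N / c ^ Suc k"
      using le'[of k] c by (subst le_divide_eq_1) auto
    ultimately show ?thesis by simp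
  qed
  then have "1 \<le> (0::real)" by (intro LIMSEQ_le_const[OF lim]) auto
  then show False by simp
qed

context solid_conv_algebra
begin

text \<open>For a positive sequence \<open>b\<close> on a finite set \<open>F\<close>, the \<open>k\<close>-th convolution power has total mass
  \<open>(\<Sum>b)\<^sup>k\<close> spread over at most \<open>(k + 1)\<close> to the power \<open>card F\<close> points, while each of its entries is
  bounded by \<open>(n b)\<^sup>k\<close>.\<close>
lemma sum_le_norm:
  assumes a: "a \<in> A" and F: "finite F" "F \<subseteq> \<Lambda>"
  shows "(\<Sum>x\<in>F. cmod (a x)) \<le> n a"
proof -
  \<comment> \<open>Solidity permits passing to moduli on F without increasing the norm; positivity
    then excludes cancellation in the powers.\<close>
  define r where "r x = (if x \<in> F then cmod (a x) else 0)" for x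
  \<comment> \<open>The convolution power with k + 1 factors; starting from \<open>q 0 = r\<close>
    explains the exponents \<open>Suc k\<close> below.\<close>
  define q where "q = rec_nat r (\<lambda>_ u x. if x \<in> \<Lambda> then (\<Sum>\<mu>\<in>F. r \<mu> * u (x - \<mu>)) else 0)"
  have q0: "q 0 = r" and qS: "q (Suc k) = (\<lambda>x. if x \<in> \<Lambda> then (\<Sum>\<mu>\<in>F. r \<mu> * q k (x - \<mu>)) else 0)" for k
    unfolding q_def by simp_all
  have r0: "0 \<le> r x" for x by (simp add: r_def)
  have qn: "0 \<le> q k x" for k x
  proof (induction k arbitrary: x)
    case 0 then show ?case by (simp add: q0 r0)
  next
    case (Suc k) then show ?case by (simp add: qS sum_nonneg r0)
  qed
  let ?r = "\<lambda>x. complex_of_real (r x)"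
  have rA: "?r \<in> A" and nr: "n ?r \<le> n a"
    using F by (auto intro!: solidD[OF a] simp: r_def)
  have "(\<lambda>x. complex_of_real (q k x)) \<in> A \<and> n (\<lambda>x. complex_of_real (q k x)) \<le> n a ^ Suc k" for k
  proof (induction k)
    case 0 then show ?case using rA nr by (simp add: q0)
  next
    case (Suc k)
    have eq: "(\<lambda>x. complex_of_real (q (Suc k) x)) = conv \<Lambda> ?r (\<lambda>x. complex_of_real (q k x))"
    proof (rule ext)
      fix x
      show "complex_of_real (q (Suc k) x) = conv \<Lambda> ?r (\<lambda>x. complex_of_real (q k x)) x"
      proof (cases "x \<in> \<Lambda>")
        case True
        then show ?thesis using F by (subst conv_finite_left[of F]) (auto simp: qS r_def)
      qed (simp add: qS conv_def)
    qed
    have "n (conv \<Lambda> ?r (\<lambda>x. complex_of_real (q k x))) \<le> n ?r * n (\<lambda>x. complex_of_real (q k x))"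
      using rA Suc by (intro norm_conv_le) auto
    also have "\<dots> \<le> n a * n a ^ Suc k"
      using Suc nr norm_nonneg[OF a] by (intro mult_mono) (auto intro: norm_nonneg)
    finally show ?case using rA Suc by (simp add: eq conv_mem)
  qed
  then have qA: "(\<lambda>x. complex_of_real (q k x)) \<in> A" and nq: "n (\<lambda>x. complex_of_real (q k x)) \<le> n a ^ Suc k" for k
    by auto
  have qle: "q k x \<le> n a ^ Suc k" for k x
    using norm_ge_coeff[OF qA, of k x] nq[of k] qn[of k x] by simp
  \<comment> \<open>The sumset of k + 1 copies of F, outside which \<open>q k\<close> has no
    mass.\<close>
  define S where "S = rec_nat F (\<lambda>_ U. (\<lambda>(\<mu>, y). y + \<mu>) ` (F \<times> U))"
  have S0: "S 0 = F" and SS: "S (Suc k) = (\<lambda>(\<mu>, y). y + \<mu>) ` (F \<times> S k)" for k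
    by (simp_all add: S_def)
  have Sfin: "finite (S k)" for k by (induction k) (auto simp: S0 SS F)
  have S\<Lambda>: "S k \<subseteq> \<Lambda>" for k
  proof (induction k)
    case 0 then show ?case using F by (simp add: S0)
  next
    case (Suc k) then show ?case using F by (auto simp: SS intro!: add_mem)
  qed
  \<comment> \<open>By commutativity an element of the sumset depends only on how often each member
    of F occurs, between 0 and k + 1 times; hence polynomially many points.\<close>
  have Ssub: "S k \<subseteq> (\<lambda>j. \<Sum>\<nu>\<in>F. real (j \<nu>) *\<^sub>R \<nu>) ` (F \<rightarrow>\<^sub>E {..k + 1})" for k
  proof (induction k)
    case 0
    show ?case
    proof
      fix x assume "x \<in> S 0"
      then have x: "x \<in> F" by (simp add: S0)
      let ?j = "\<lambda>\<nu>. if \<nu> \<in> F then (if \<nu> = x then 1 else 0) else undefined"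
      have "(\<Sum>\<nu>\<in>F. real (?j \<nu>) *\<^sub>R \<nu>) = (\<Sum>\<nu>\<in>F. if \<nu> = x then \<nu> else 0)"
        by (rule sum.cong) auto
      also have "\<dots> = x" using x F by simp
      finally show "x \<in> (\<lambda>j. \<Sum>\<nu>\<in>F. real (j \<nu>) *\<^sub>R \<nu>) ` (F \<rightarrow>\<^sub>E {..0 + 1})"
        by (intro image_eqI[of _ _ ?j]) (auto simp: PiE_def extensional_def)
    qed
  next
    case (Suc k)
    show ?case
    proof
      fix x assume "x \<in> S (Suc k)"
      then obtain \<mu> y where \<mu>: "\<mu> \<in> F" and y: "y \<in> S k" and x: "x = y + \<mu>" by (auto simp: SS)
      obtain j where j: "j \<in> F \<rightarrow>\<^sub>E {..k + 1}" and yj: "y = (\<Sum>\<nu>\<in>F. real (j \<nu>) *\<^sub>R \<nu>)"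
        using Suc y by auto
      let ?j = "j(\<mu> := Suc (j \<mu>))"
      have "(\<Sum>\<nu>\<in>F. real (?j \<nu>) *\<^sub>R \<nu>) = (\<Sum>\<nu>\<in>F. real (j \<nu>) *\<^sub>R \<nu> + (if \<nu> = \<mu> then \<nu> else 0))"
        by (rule sum.cong) (auto simp: scaleR_add_left)
      also have "\<dots> = x" using \<mu> F by (simp add: sum.distrib yj x)
      finally have "x = (\<Sum>\<nu>\<in>F. real (?j \<nu>) *\<^sub>R \<nu>)" by simp
      moreover have "?j \<in> F \<rightarrow>\<^sub>E {..Suc k + 1}"
        using j \<mu> by (auto simp: PiE_def extensional_def Pi_def le_SucI)
      ultimately show "x \<in> (\<lambda>j. \<Sum>\<nu>\<in>F. real (j \<nu>) *\<^sub>R \<nu>) ` (F \<rightarrow>\<^sub>E {..Suc k + 1})" by blast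
    qed
  qed
  have card: "card (S k) \<le> (k + 2) ^ card F" for k
  proof -
    have fin: "finite (F \<rightarrow>\<^sub>E {..k + 1})" using F by (intro finite_PiE) auto
    have "card (S k) \<le> card ((\<lambda>j. \<Sum>\<nu>\<in>F. real (j \<nu>) *\<^sub>R \<nu>) ` (F \<rightarrow>\<^sub>E {..k + 1}))"
      by (rule card_mono[OF finite_imageI[OF fin] Ssub])
    also have "\<dots> \<le> card (F \<rightarrow>\<^sub>E {..k + 1})" by (rule card_image_le[OF fin])
    also have "\<dots> = (k + 2) ^ card F" using F by (simp add: card_PiE)
    finally show ?thesis .
  qed
  define s where "s = (\<Sum>x\<in>F. cmod (a x))"
  have sr: "s = (\<Sum>x\<in>F. r x)" by (simp add: s_def r_def)
  have s0: "0 \<le> s" by (simp add: s_def sum_nonneg)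
  \<comment> \<open>Each factor contributes its full mass, because translating \<open>S k\<close> by
    a member of F stays inside \<open>S (Suc k)\<close>.\<close>
  have mass: "s ^ Suc k \<le> (\<Sum>x\<in>S k. q k x)" for k
  proof (induction k)
    case 0 then show ?case by (simp add: S0 q0 sr)
  next
    case (Suc k)
    have "s ^ Suc (Suc k) \<le> (\<Sum>\<mu>\<in>F. r \<mu>) * (\<Sum>y\<in>S k. q k y)"
      using Suc s0 by (simp add: sr mult_left_mono)
    also have "\<dots> = (\<Sum>\<mu>\<in>F. r \<mu> * (\<Sum>y\<in>S k. q k y))" by (simp add: sum_distrib_right)
    also have "\<dots> \<le> (\<Sum>\<mu>\<in>F. r \<mu> * (\<Sum>x\<in>S (Suc k). q k (x - \<mu>)))"
    proof (intro sum_mono mult_left_mono r0)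
      fix \<mu> assume \<mu>: "\<mu> \<in> F"
      have "(\<Sum>y\<in>S k. q k y) = (\<Sum>x\<in>(\<lambda>y. y + \<mu>) ` S k. q k (x - \<mu>))"
        by (subst sum.reindex) (auto simp: inj_on_def)
      also have "\<dots> \<le> (\<Sum>x\<in>S (Suc k). q k (x - \<mu>))"
        using \<mu> by (intro sum_mono2 Sfin qn) (auto simp: SS)
      finally show "(\<Sum>y\<in>S k. q k y) \<le> (\<Sum>x\<in>S (Suc k). q k (x - \<mu>))" .
    qed
    also have "\<dots> = (\<Sum>x\<in>S (Suc k). \<Sum>\<mu>\<in>F. r \<mu> * q k (x - \<mu>))"
      unfolding sum_distrib_left by (rule sum.swap)
    also have "\<dots> = (\<Sum>x\<in>S (Suc k). q (Suc k) x)"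
      using S\<Lambda>[of "Suc k"] by (intro sum.cong) (auto simp: qS)
    finally show ?case .
  qed
  have "s ^ Suc k \<le> real (k + 2) ^ card F * n a ^ Suc k" for k
  proof -
    have "s ^ Suc k \<le> (\<Sum>x\<in>S k. n a ^ Suc k)"
      using mass[of k] sum_mono[of "S k" "q k" "\<lambda>_. n a ^ Suc k"] qle[of k] by fastforce
    also have "\<dots> = real (card (S k)) * n a ^ Suc k" by simp
    also have "\<dots> \<le> real (k + 2) ^ card F * n a ^ Suc k"
    proof (intro mult_right_mono zero_le_power norm_nonneg a)
      have "real (card (S k)) \<le> real ((k + 2) ^ card F)" using card[of k] by (simp only: of_nat_le_iff)
      then show "real (card (S k)) \<le> real (k + 2) ^ card F" by (simp only: of_nat_power)
    qed
    finally show ?thesis .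
  qed
  then have "s \<le> n a" by (rule exponential_beats_polynomial[OF s0 norm_nonneg[OF a]])
  then show ?thesis by (simp add: s_def)
qed

lemma abs_summable: 
  assumes a: "a \<in> A" shows "(\<lambda>x. cmod (a x)) summable_on \<Lambda>"
  by (rule nonneg_bdd_above_summable_on) (use sum_le_norm[OF a] in \<open>auto intro!: bdd_aboveI[of _ "n a"]\<close>)

end

section \<open>Lattices and essential suprema\<close>

lemma lat_zero: "linear T \<Longrightarrow> 0 \<in> lat T"
  unfolding lat_def by (rule image_eqI[of _ _ 0]) (auto simp: linear_0)

lemma lat_add:
  assumes "linear T" "x \<in> lat T" "y \<in> lat T"
  shows "x + y \<in> lat T"
proof -
  obtain u v where "x = T u" "y = T v" "\<forall>i\<in>Basis. u \<bullet> i \<in> \<int>" "\<forall>i\<in>Basis. v \<bullet> i \<in> \<int>"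
    using assms(2,3) by (auto simp: lat_def)
  then show ?thesis unfolding lat_def
    by (intro image_eqI[of _ _ "u + v"]) (auto simp: linear_add[OF assms(1)] inner_add_left)
qed

lemma lat_neg:
  assumes "linear T" "x \<in> lat T"
  shows "- x \<in> lat T"
proof -
  obtain u where "x = T u" "\<forall>i\<in>Basis. u \<bullet> i \<in> \<int>"
    using assms(2) by (auto simp: lat_def)
  then show ?thesis unfolding lat_def
    by (intro image_eqI[of _ _ "- u"]) (auto simp: linear_neg[OF assms(1)])
qed

lemma countable_lat: "countable (lat (T :: 'b::euclidean_space \<Rightarrow> 'b))"
proof -
  have "{x::'b. \<forall>i\<in>Basis. x \<bullet> i \<in> \<int>} \<subseteq> (\<lambda>f. \<Sum>i\<in>Basis. f i *\<^sub>R i) ` (Basis \<rightarrow>\<^sub>E \<int>)"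
  proof
    fix x :: 'b assume x: "x \<in> {x. \<forall>i\<in>Basis. x \<bullet> i \<in> \<int>}"
    have "x = (\<Sum>i\<in>Basis. (restrict (\<lambda>i. x \<bullet> i) Basis i) *\<^sub>R i)" by (simp add: euclidean_representation)
    moreover have "restrict (\<lambda>i. x \<bullet> i) Basis \<in> Basis \<rightarrow>\<^sub>E \<int>" using x by auto
    ultimately show "x \<in> (\<lambda>f. \<Sum>i\<in>Basis. f i *\<^sub>R i) ` (Basis \<rightarrow>\<^sub>E \<int>)" by blast
  qed
  moreover have "countable (Basis \<rightarrow>\<^sub>E (\<int> :: real set) :: ('b \<Rightarrow> real) set)"
    by (intro countable_PiE) (auto simp: countable_int Ints_def)
  ultimately show ?thesis unfolding lat_def
    by (intro countable_image) (auto intro: countable_subset)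
qed

lemma lat_fund_cover:
  fixes T :: "'b::euclidean_space \<Rightarrow> 'b"
  assumes T: "linear T" "bij T"
  shows "\<exists>l\<in>lat T. z \<in> (\<lambda>c. l + c) ` fund T"
proof -
  obtain x where x: "z = T x" using T(2) by (metis bij_pointE)
  define y where "y = (\<Sum>i\<in>Basis. of_int \<lfloor>x \<bullet> i\<rfloor> *\<^sub>R i)"
  have y: "y \<bullet> i = of_int \<lfloor>x \<bullet> i\<rfloor>" if "i \<in> Basis" for i using that by (simp add: y_def)
  have "T y \<in> lat T" unfolding lat_def using y by auto
  moreover have "T (x - y) \<in> fund T"
    unfolding fund_def using y by (intro imageI) (auto simp: inner_diff_left, linarith+)
  moreover have "z = T y + T (x - y)" by (simp add: x linear_diff[OF T(1)])
  ultimately show ?thesis by blast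
qed

text \<open>The cell is an image under \<open>T\<close>; rewriting it as a preimage under the
  continuous linear inverse makes it Borel.\<close>

lemma fund_translate_measurable:
  fixes T :: "'b::euclidean_space \<Rightarrow> 'b"
  assumes T: "linear T" "bij T"
  shows "(\<lambda>c. l + c) ` fund T \<in> sets borel"
proof -
  obtain T' where T': "linear T'" "\<And>x. T' (T x) = x" "\<And>x. T (T' x) = x"
    using linear_injective_isomorphism[OF T(1) bij_is_inj[OF T(2)]] by blast
  have [measurable]: "T' \<in> borel_measurable borel"
    using linear_continuous_on[OF T'(1)[THEN linear_conv_bounded_linear[THEN iffD1]]]
    by (rule borel_measurable_continuous_onI)
  have "(\<lambda>c. l + c) ` fund T = {z \<in> space borel. \<forall>i\<in>Basis. 0 \<le> T' (z - l) \<bullet> i \<and> T' (z - l) \<bullet> i < 1}"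
  proof (intro set_eqI iffI)
    fix z assume "z \<in> {z \<in> space borel. \<forall>i\<in>Basis. 0 \<le> T' (z - l) \<bullet> i \<and> T' (z - l) \<bullet> i < 1}"
    then have "T (T' (z - l)) \<in> fund T" unfolding fund_def by blast
    then show "z \<in> (\<lambda>c. l + c) ` fund T" by (intro image_eqI[of _ _ "z - l"]) (simp_all add: T')
  qed (auto simp: fund_def T')
  also have "\<dots> \<in> sets borel" by measurable
  finally show ?thesis .
qed

lemma emeasure_fund_finite:
  fixes T :: "'b::euclidean_space \<Rightarrow> 'b"
  assumes T: "linear T"
  shows "\<exists>B. \<forall>l. emeasure lborel ((\<lambda>c. l + c) ` fund T) \<le> ennreal B"
proof -
  have "fund T \<subseteq> T ` cbox 0 One"
    unfolding fund_def by (intro image_mono) (auto simp: mem_box less_imp_le)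
  moreover have "bounded (T ` cbox 0 One)"
    using T by (intro bounded_linear_image bounded_cbox) (simp add: linear_conv_bounded_linear)
  ultimately have "bounded (fund T)" by (rule bounded_subset[rotated])
  then obtain r where r: "fund T \<subseteq> cball 0 r" unfolding bounded_iff by force
  have "emeasure lborel ((\<lambda>c. l + c) ` fund T) \<le> emeasure lborel (cball (0::'b) r)" for l
  proof -
    have "(\<lambda>c. l + c) ` fund T \<subseteq> cball l r" using r by (auto simp: dist_norm)
    then have "emeasure lborel ((\<lambda>c. l + c) ` fund T) \<le> emeasure lborel (cball l r)"
      by (rule emeasure_mono) simp
    also have "cball l r = (\<lambda>x. l + x) ` cball 0 r" by (simp add: cball_translation[symmetric])
    also have "emeasure lborel \<dots> = emeasure lborel (cball (0::'b) r)"
    proof -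
      have "emeasure lborel (cball (0::'b) r) = emeasure (distr lborel borel ((+) (- l))) (cball 0 r)"
        by (simp add: lborel_distr_plus)
      also have "\<dots> = emeasure lborel ((+) (- l) -` cball 0 r)" by (simp add: emeasure_distr)
      also have "(+) (- l) -` cball 0 r = (\<lambda>x. l + x) ` cball 0 r"
        by (auto simp: dist_norm intro!: image_eqI[of _ _ "_ - l"])
      finally show ?thesis by simp
    qed
    finally show ?thesis .
  qed
  moreover have "emeasure lborel (cball (0::'b) r) = ennreal (measure lborel (cball (0::'b) r))"
    using emeasure_bounded_finite[OF bounded_cball[of "0::'b" r]] by (intro emeasure_eq_ennreal_measure) auto
  ultimately show ?thesis by metis
qed

section \<open>Essential suprema bounded below by values on open sets\<close>

lemma AE_not_in_open:
  fixes V :: "'b::euclidean_space set"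
  assumes "open V" "AE x in lborel. x \<notin> V"
  shows "V = {}"
proof (rule ccontr)
  assume "V \<noteq> {}"
  have "V \<in> null_sets lborel" using assms by (subst AE_iff_null_sets) auto
  then have "negligible V" by (simp add: negligible_iff_null_sets null_sets_completionI)
  then show False using open_not_negligible[OF assms(1) \<open>V \<noteq> {}\<close>] by blast
qed

lemma esssup_lborel_ge:
  fixes F :: "'b::euclidean_space \<Rightarrow> ereal"
  assumes U: "open U" "U \<noteq> {}" and s: "\<And>x. x \<in> U \<Longrightarrow> s \<le> F x"
  shows "s \<le> esssup lborel F"
proof (rule ccontr)
  assume ns: "\<not> s \<le> esssup lborel F"
  have "AE x in lborel. x \<notin> U"
    using esssup_AE[of F lborel]
  proof eventually_elim
    case (elim x)
    then show ?case using s[of x] ns order.trans[of s "F x" "esssup lborel F"] by blast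
  qed
  then show False using AE_not_in_open[OF U(1)] U(2) by blast
qed

text \<open>The half-open cell has \<mu> as a corner, so it contains no neighbourhood of \<mu>. Its
  interior accumulates at that corner, however, so every open U around \<mu> meets the cell in a set
  with nonempty interior.\<close>

lemma locsup_ge:
  fixes T :: "'b::euclidean_space \<Rightarrow> 'b"
  assumes T: "linear T" "bij T" and U: "open U" "\<mu> \<in> U" and s: "\<And>x. x \<in> U \<Longrightarrow> s \<le> F x"
  shows "s \<le> locsup T F \<mu>"
proof (rule ccontr)
  assume ns: "\<not> s \<le> locsup T F \<mu>"
  let ?\<Omega> = "(\<lambda>c. \<mu> + c) ` fund T"
  have "AE x in restrict_space lborel ?\<Omega>. F x \<le> locsup T F \<mu>"
    unfolding locsup_def by (rule esssup_AE)
  then have "AE x in lborel. x \<in> ?\<Omega> \<longrightarrow> F x \<le> locsup T F \<mu>"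
    by (subst (asm) AE_restrict_space_iff) (simp_all add: fund_translate_measurable[OF T])
  then have AE1: "AE x in lborel. x \<notin> U \<inter> ?\<Omega>"
  proof eventually_elim
    case (elim x)
    then show ?case using s[of x] ns order.trans[of s "F x" "locsup T F \<mu>"] by blast
  qed
  define V where "V = U \<inter> (\<lambda>c. \<mu> + c) ` T ` box 0 One"
  have "open (T ` box 0 One)"
    using open_surjective_linear_image[OF _ T(1) bij_is_surj[OF T(2)]] open_box by blast
  then have oV: "open V" unfolding V_def by (intro open_Int U open_translation)
  have sub: "V \<subseteq> U \<inter> ?\<Omega>"
    unfolding V_def fund_def by (force simp: mem_box less_imp_le)
  have "AE x in lborel. x \<notin> V" using AE1 by eventually_elim (use sub in blast)
  then have "V = {}" by (rule AE_not_in_open[OF oV])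
  obtain e where e: "e > 0" "ball \<mu> e \<subseteq> U" using U openE by blast
  \<comment> \<open>A short step along the diagonal of the cell: 1/2 keeps it inside the open box,
    the other bound inside the ball around \<mu>, and the summand 1 avoids division by zero.\<close>
  define t where "t = min (1/2) (e / (2 * (norm (T One) + 1)))"
  have n1: "norm (T One) + 1 > 0" using norm_ge_zero[of "T One"] by linarith
  have t: "0 < t" "t < 1" using e n1 by (auto simp: t_def)
  have "t * norm (T One) \<le> e / (2 * (norm (T One) + 1)) * (norm (T One) + 1)"
    using e n1 t by (intro mult_mono) (auto simp: t_def)
  also have "\<dots> = e / 2" using n1 by (simp add: field_simps)
  finally have "norm (T (t *\<^sub>R One)) < e" using e t by (simp add: linear_scale[OF T(1)])
  then have "\<mu> + T (t *\<^sub>R One) \<in> U" using e by (auto simp: dist_norm)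
  moreover have "t *\<^sub>R One \<in> box 0 (One::'b)" using t by (auto simp: mem_box)
  ultimately have "\<mu> + T (t *\<^sub>R One) \<in> V" unfolding V_def by blast
  then show False using \<open>V = {}\<close> by blast
qed

text \<open>Replacing the value at \<mu> by any strictly smaller s makes the condition open, which
  is what \<open>locsup_ge\<close> asks for.\<close>

lemma continuous_le_locsup:
  fixes T :: "'b::euclidean_space \<Rightarrow> 'b" and F :: "'b \<Rightarrow> real"
  assumes T: "linear T" "bij T" and F: "continuous_on UNIV F"
  shows "ereal (F \<mu>) \<le> locsup T (\<lambda>z. ereal (F z)) \<mu>"
proof (rule dense_le)
  fix s assume s: "s < ereal (F \<mu>)"
  have "continuous_on UNIV (\<lambda>z. ereal (F z))" using F by (intro continuous_intros)
  then have "open {z. s < ereal (F z)}"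
    by (intro open_Collect_less continuous_on_const)
  then show "s \<le> locsup T (\<lambda>z. ereal (F z)) \<mu>"
    by (rule locsup_ge[OF T]) (use s in auto)
qed

text \<open>\<open>amalg_seq\<close> turns an infinite local supremum into 0, so the comparison
  rests on the finiteness clause of \<open>in_WA\<close>.\<close>

lemma le_amalg_seq:
  assumes l: "l \<in> lat T" and fin: "locsup T F l \<noteq> \<infinity>" and le: "ereal r \<le> locsup T F l" and r: "0 \<le> r"
  shows "r \<le> cmod (amalg_seq T F l)"
proof -
  obtain q where q: "locsup T F l = ereal q"
    using fin le by (cases "locsup T F l") auto
  then show ?thesis using le l r by (simp add: amalg_seq_def)
qed

section \<open>Almost diagonalisation\<close>

text \<open>On each cell the function is almost everywhere at most its local supremum, and the cells
  have uniformly bounded measure. Summability of the suprema thus bounds the integral over finite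
  unions of cells, and Fatou's lemma reaches the whole space.\<close>

lemma wiener_amalgam_integrable:
  fixes T :: "'b::euclidean_space \<Rightarrow> 'b" and V :: "'b \<Rightarrow> complex"
  assumes T: "linear T" "bij T" and A: "solid_inv_conv_alg (lat T) A nA"
    and V: "V \<in> borel_measurable lborel" and WA: "in_WA T A (\<lambda>z. ereal (cmod (V z)))"
  shows "integrable lborel V"
proof -
  interpret solid_conv_algebra "lat T" A nA
    by (rule solid_conv_algebra.intro[OF A lat_zero[OF T(1)] lat_add[OF T(1)] lat_neg[OF T(1)]])
  have [measurable]: "V \<in> borel_measurable borel" using V by simp
  let ?v = "amalg_seq T (\<lambda>z. ereal (cmod (V z)))"
  have v: "?v \<in> A" and fin: "\<And>l. l \<in> lat T \<Longrightarrow> locsup T (\<lambda>z. ereal (cmod (V z))) l \<noteq> \<infinity>"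
    using WA by (auto simp: in_WA_def)
  obtain B where B: "\<And>l. emeasure lborel ((\<lambda>c. l + c) ` fund T) \<le> ennreal B"
    using emeasure_fund_finite[OF T(1)] by blast
  let ?C = "\<lambda>l. (\<lambda>c. l + c) ` fund T"
  have mC [measurable]: "?C l \<in> sets borel" for l by (rule fund_translate_measurable[OF T])
  have cell: "(LBINT\<^sup>+z. ennreal (cmod (V z)) * indicator (?C l) z) \<le> ennreal (cmod (?v l)) * ennreal B"
    if l: "l \<in> lat T" for l
  proof -
    have "AE z in restrict_space lborel (?C l). ereal (cmod (V z)) \<le> locsup T (\<lambda>z. ereal (cmod (V z))) l"
      unfolding locsup_def by (rule esssup_AE)
    then have "AE z in lborel. z \<in> ?C l \<longrightarrow> ereal (cmod (V z)) \<le> locsup T (\<lambda>z. ereal (cmod (V z))) l"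
      by (subst (asm) AE_restrict_space_iff) (use mC in simp_all)
    then have "AE z in lborel. ennreal (cmod (V z)) * indicator (?C l) z \<le> ennreal (cmod (?v l)) * indicator (?C l) z"
    proof eventually_elim
      case (elim z)
      then show ?case
        using le_amalg_seq[OF l fin[OF l], of "cmod (V z)"] by (auto simp: indicator_def intro!: ennreal_leI)
    qed
    then have "(LBINT\<^sup>+z. ennreal (cmod (V z)) * indicator (?C l) z) \<le> (LBINT\<^sup>+z. ennreal (cmod (?v l)) * indicator (?C l) z)"
      by (rule nn_integral_mono_AE)
    also have "\<dots> = ennreal (cmod (?v l)) * emeasure lborel (?C l)"
      by (rule nn_integral_cmult_indicator) (use mC in simp)
    also have "\<dots> \<le> ennreal (cmod (?v l)) * ennreal B" by (intro mult_left_mono B) simp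
    finally show ?thesis .
  qed
  obtain X where X: "\<And>n. finite (X n)" "\<And>n. X n \<subseteq> lat T" and limX: "filterlim X (finite_subsets_at_top (lat T)) sequentially"
    using countable_exhausting_sequence[OF countable_lat[of T]] by blast
  define Z where "Z n = (\<Union>l\<in>X n. ?C l)" for n
  have mZ [measurable]: "Z n \<in> sets borel" for n unfolding Z_def by (intro sets.finite_UN X mC)
  have bound: "(LBINT\<^sup>+z. ennreal (cmod (V z)) * indicator (Z n) z) \<le> ennreal (nA ?v) * ennreal B" for n
  proof -
    have "(LBINT\<^sup>+z. ennreal (cmod (V z)) * indicator (Z n) z) \<le> (LBINT\<^sup>+z. (\<Sum>l\<in>X n. ennreal (cmod (V z)) * indicator (?C l) z))"
    proof (rule nn_integral_mono)
      fix z
      show "ennreal (cmod (V z)) * indicator (Z n) z \<le> (\<Sum>l\<in>X n. ennreal (cmod (V z)) * indicator (?C l) z)"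
      proof (cases "z \<in> Z n")
        case True
        then obtain l where l: "l \<in> X n" "z \<in> ?C l" unfolding Z_def by blast
        have "ennreal (cmod (V z)) * indicator (Z n) z = ennreal (cmod (V z)) * indicator (?C l) z"
          using True l by (simp add: indicator_def)
        also have "\<dots> \<le> (\<Sum>l\<in>X n. ennreal (cmod (V z)) * indicator (?C l) z)"
          by (rule member_le_sum[OF l(1) _ X(1)]) simp
        finally show ?thesis .
      qed simp
    qed
    also have "\<dots> = (\<Sum>l\<in>X n. LBINT\<^sup>+z. ennreal (cmod (V z)) * indicator (?C l) z)"
      by (rule nn_integral_sum) measurable
    also have "\<dots> \<le> (\<Sum>l\<in>X n. ennreal (cmod (?v l)) * ennreal B)"
      using X(2) by (intro sum_mono cell) blast
    also have "\<dots> = ennreal (\<Sum>l\<in>X n. cmod (?v l)) * ennreal B"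
      by (simp add: sum_ennreal flip: sum_distrib_right)
    also have "\<dots> \<le> ennreal (nA ?v) * ennreal B"
      by (intro mult_right_mono ennreal_leI sum_le_norm v X) simp
    finally show ?thesis .
  qed
  have "(LBINT\<^sup>+z. ennreal (cmod (V z))) = (LBINT\<^sup>+z. liminf (\<lambda>n. ennreal (cmod (V z)) * indicator (Z n) z))"
  proof (rule nn_integral_cong)
    fix z
    obtain l where l: "l \<in> lat T" "z \<in> ?C l" using lat_fund_cover[OF T] by blast
    have "\<forall>\<^sub>F n in sequentially. finite (X n) \<and> {l} \<subseteq> X n \<and> X n \<subseteq> lat T"
      using limX l(1) unfolding filterlim_finite_subsets_at_top by blast
    then have "\<forall>\<^sub>F n in sequentially. ennreal (cmod (V z)) * indicator (Z n) z = ennreal (cmod (V z))"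
    proof eventually_elim
      case (elim n)
      then have "z \<in> Z n" using l(2) unfolding Z_def by blast
      then show ?case by simp
    qed
    from lim_imp_Liminf[OF _ tendsto_eventually[OF this]]
    show "ennreal (cmod (V z)) = liminf (\<lambda>n. ennreal (cmod (V z)) * indicator (Z n) z)" by simp
  qed
  also have "\<dots> \<le> liminf (\<lambda>n. LBINT\<^sup>+z. ennreal (cmod (V z)) * indicator (Z n) z)"
    by (rule nn_integral_liminf) measurable
  also have "\<dots> \<le> ennreal (nA ?v) * ennreal B"
    by (rule Liminf_le) (use bound in auto)
  also have "\<dots> < \<infinity>" by (simp add: ennreal_mult_less_top)
  finally show ?thesis using V by (simp add: integrable_iff_bounded)
qed

lemma cmod_weyl_pair_tfs:
  fixes g :: "'a::euclidean_space \<Rightarrow> complex"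
  assumes \<sigma>: "\<sigma> \<in> S0_dual" and g: "g \<in> S0"
  shows "cmod (weyl_pair \<sigma> (tfs m g) (tfs l g)) = cmod (\<sigma> (tfs ((1/2) *\<^sub>R (l + m), jmap (l - m)) (wigner g g)))"
  unfolding weyl_pair_def
  using wigner_tfs_tfs[OF L2_measurable[OF S0_L2[OF g]] L2_measurable[OF S0_L2[OF g]], of l m]
    S0_dual_scale[OF \<sigma> S0_tfs[OF wigner_S0(1)[OF g g]]]
  by (simp add: norm_mult)

text \<open>Two essential suprema have to be crossed: over z inside the grand symbol and over
  \<zeta> in the cell. An open box \<open>Q \<times> U\<close> on which the modulus exceeds s
  handles them in turn, first through \<open>Q\<close> for each \<zeta> in \<open>U\<close>, then
  through \<open>U\<close>.\<close>

lemma weyl_pair_le_grand_symbol: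
  fixes T :: "'a::euclidean_space \<times> 'a \<Rightarrow> 'a \<times> 'a"
  assumes T: "linear T" "bij T" and \<sigma>: "\<sigma> \<in> S0_dual" and g: "g \<in> S0"
  shows "ereal (cmod (weyl_pair \<sigma> (tfs m g) (tfs l g))) \<le> locsup T (grand_symbol \<sigma> (wigner g g) \<circ> jmap) (l - m)"
proof (rule dense_le)
  fix s assume s: "s < ereal (cmod (weyl_pair \<sigma> (tfs m g) (tfs l g)))"
  \<comment> \<open>Parametrising by midpoint and difference makes \<open>P\<close> the modulus of
    the STFT of the symbol, while its continuity in both variables comes from
    \<open>weyl_pair_tfs_continuous\<close>.\<close>
  define P where "P y = cmod (weyl_pair \<sigma> (tfs (fst y - (1/2) *\<^sub>R snd y) g) (tfs (fst y + (1/2) *\<^sub>R snd y) g))"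
    for y :: "('a \<times> 'a) \<times> ('a \<times> 'a)"
  have P: "P (z, \<zeta>) = cmod (\<sigma> (tfs (z, jmap \<zeta>) (wigner g g)))" for z \<zeta>
  proof -
    have "(1/2) *\<^sub>R (z + (1/2) *\<^sub>R \<zeta> + (z - (1/2) *\<^sub>R \<zeta>)) = z"
      and "z + (1/2) *\<^sub>R \<zeta> - (z - (1/2) *\<^sub>R \<zeta>) = \<zeta>"
      by (simp_all flip: scaleR_add_left scaleR_2)
    then show ?thesis using cmod_weyl_pair_tfs[OF \<sigma> g, of "z - (1/2) *\<^sub>R \<zeta>" "z + (1/2) *\<^sub>R \<zeta>"]
      by (simp only: P_def fst_conv snd_conv)
  qed
  have cP: "continuous_on UNIV P"
  proof (rule continuous_at_imp_continuous_on, rule ballI, rule continuous_at_sequentiallyI)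
    fix y :: "('a \<times> 'a) \<times> ('a \<times> 'a)" and u assume u: "u \<longlonglongrightarrow> y"
    have "(\<lambda>n. fst (u n) + (1/2) *\<^sub>R snd (u n)) \<longlonglongrightarrow> fst y + (1/2) *\<^sub>R snd y"
      and "(\<lambda>n. fst (u n) - (1/2) *\<^sub>R snd (u n)) \<longlonglongrightarrow> fst y - (1/2) *\<^sub>R snd y"
      by (intro tendsto_intros u)+
    from tendsto_norm[OF weyl_pair_tfs_continuous[OF \<sigma> g this]]
    show "(\<lambda>n. P (u n)) \<longlonglongrightarrow> P y" by (simp add: P_def)
  qed
  have "continuous_on UNIV (\<lambda>y. ereal (P y))" using cP by (intro continuous_intros)
  then have o: "open {y. s < ereal (P y)}" by (intro open_Collect_less continuous_on_const)
  have "((1/2) *\<^sub>R (l + m), l - m) \<in> {y. s < ereal (P y)}"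
    using s by (simp add: P cmod_weyl_pair_tfs[OF \<sigma> g])
  from open_prod_elim[OF o this] obtain Q U where Q: "open Q" and U: "open U" and
    mem: "((1/2) *\<^sub>R (l + m), l - m) \<in> Q \<times> U" and sub: "Q \<times> U \<subseteq> {y. s < ereal (P y)}" by blast
  show "s \<le> locsup T (grand_symbol \<sigma> (wigner g g) \<circ> jmap) (l - m)"
  proof (rule locsup_ge[OF T U])
    show "l - m \<in> U" using mem by blast
    fix \<zeta> assume \<zeta>: "\<zeta> \<in> U"
    have "s \<le> ereal (cmod (\<sigma> (tfs (z, jmap \<zeta>) (wigner g g))))" if "z \<in> Q" for z
    proof -
      have "(z, \<zeta>) \<in> {y. s < ereal (P y)}" using sub \<zeta> that by blast
      then show ?thesis by (simp add: P)
    qed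
    then show "s \<le> (grand_symbol \<sigma> (wigner g g) \<circ> jmap) \<zeta>"
      unfolding grand_symbol_def comp_def using Q mem by (intro esssup_lborel_ge[of Q]) blast+
  qed
qed

text \<open>A kernel dominated by \<open>d (l - k)\<close> acts no worse than convolution with the
  modulus of \<open>d\<close>, and solidity transfers the convolution bound. It is used for the Gram
  matrix as well as for the matrix of the symbol.\<close>

lemma kernel_action_bound:
  fixes \<Lambda> :: "'b::real_vector set" and K :: "'b \<Rightarrow> 'b \<Rightarrow> complex"
  assumes sub [rule_format]: "\<forall>x\<in>\<Lambda>. \<forall>y\<in>\<Lambda>. x - y \<in> \<Lambda>"
    and solA: "solid \<Lambda> A nA" and solY: "solid \<Lambda> Y nY" and banA: "banach_seq_space \<Lambda> A nA" and banY: "banach_seq_space \<Lambda> Y nY"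
    and AY: "\<forall>a\<in>A. \<forall>c\<in>Y. conv_ok \<Lambda> a c \<and> conv \<Lambda> a c \<in> Y \<and> nY (conv \<Lambda> a c) \<le> nA a * nY c"
    and d: "d \<in> A" and y: "y \<in> Y" and K [rule_format]: "\<forall>l\<in>\<Lambda>. \<forall>k\<in>\<Lambda>. cmod (K l k) \<le> cmod (d (l - k))"
    and z0 [rule_format]: "\<forall>l. l \<notin> \<Lambda> \<longrightarrow> z l = 0" and z [rule_format]: "\<forall>l\<in>\<Lambda>. z l = (\<Sum>\<^sub>\<infinity>k\<in>\<Lambda>. K l k * y k)"
  shows "z \<in> Y" and "nY z \<le> nA d * nY y"
proof -
  \<comment> \<open>Moduli are taken in both factors so that the convolution majorises the kernel
    sum without cancellation; solidity keeps the norms under control.\<close>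
  let ?d = "\<lambda>x. complex_of_real (cmod (d x))" and ?y = "\<lambda>x. complex_of_real (cmod (y x))"
  have offA: "d x = 0" if "x \<notin> \<Lambda>" for x using banA d that unfolding banach_seq_space_def by blast
  have offY: "y x = 0" if "x \<notin> \<Lambda>" for x using banY y that unfolding banach_seq_space_def by blast
  have d': "?d \<in> A" "nA ?d \<le> nA d"
    using solA[unfolded solid_def, rule_format, of d ?d] d offA by auto
  have y': "?y \<in> Y" "nY ?y \<le> nY y"
    using solY[unfolded solid_def, rule_format, of y ?y] y offY by auto
  have c: "conv_ok \<Lambda> ?d ?y" "conv \<Lambda> ?d ?y \<in> Y" "nY (conv \<Lambda> ?d ?y) \<le> nA ?d * nY ?y"
    using AY d' y' by blast+
  have le: "cmod (z x) \<le> cmod (conv \<Lambda> ?d ?y x)" for x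
  proof (cases "x \<in> \<Lambda>")
    case True
    \<comment> \<open>Reflection about x permutes the lattice and converts the convolution sum into
      the form \<open>d (x - k) * y k\<close>.\<close>
    have inj: "inj_on (\<lambda>k. x - k) \<Lambda>" by (auto simp: inj_on_def)
    have im: "(\<lambda>k. x - k) ` \<Lambda> = \<Lambda>"
    proof
      show "(\<lambda>k. x - k) ` \<Lambda> \<subseteq> \<Lambda>" using sub True by blast
      show "\<Lambda> \<subseteq> (\<lambda>k. x - k) ` \<Lambda>"
      proof
        fix w assume "w \<in> \<Lambda>" then show "w \<in> (\<lambda>k. x - k) ` \<Lambda>"
          using sub[OF True] by (intro image_eqI[of _ _ "x - w"]) auto
      qed
    qed
    have "(\<lambda>\<mu>. ?d \<mu> * ?y (x - \<mu>)) summable_on \<Lambda>" using c(1) True by (simp add: conv_ok_def)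
    then have s: "(\<lambda>\<mu>. ?d \<mu> * ?y (x - \<mu>)) summable_on (\<lambda>k. x - k) ` \<Lambda>" by (simp only: im)
    from s[unfolded summable_on_reindex[OF inj]]
    have s1: "(\<lambda>k. ?d (x - k) * ?y k) summable_on \<Lambda>" by (simp add: comp_def)
    have cv: "conv \<Lambda> ?d ?y x = (\<Sum>\<^sub>\<infinity>k\<in>\<Lambda>. ?d (x - k) * ?y k)"
      using True infsum_reindex[OF inj, of "\<lambda>\<mu>. ?d \<mu> * ?y (x - \<mu>)"] by (simp add: conv_def im comp_def)
    have s2: "(\<lambda>k. cmod (d (x - k)) * cmod (y k)) summable_on \<Lambda>"
      using s1 unfolding summable_on_iff_abs_summable_on_complex by (simp add: norm_mult)
    have le1: "cmod (K x k * y k) \<le> cmod (d (x - k)) * cmod (y k)" if "k \<in> \<Lambda>" for k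
      using K[OF True that] by (simp add: norm_mult mult_right_mono)
    have s3: "(\<lambda>k. cmod (K x k * y k)) summable_on \<Lambda>"
      by (rule summable_on_comparison_test[OF s2]) (use le1 in auto)
    have "cmod (z x) \<le> (\<Sum>\<^sub>\<infinity>k\<in>\<Lambda>. cmod (K x k * y k))"
      unfolding z[OF True] by (rule norm_infsum_bound[OF s3])
    also have "\<dots> \<le> (\<Sum>\<^sub>\<infinity>k\<in>\<Lambda>. cmod (d (x - k)) * cmod (y k))"
      by (rule infsum_mono[OF s3 s2 le1])
    also have "\<dots> = cmod (conv \<Lambda> ?d ?y x)"
    proof -
      have "conv \<Lambda> ?d ?y x = complex_of_real (\<Sum>\<^sub>\<infinity>k\<in>\<Lambda>. cmod (d (x - k)) * cmod (y k))"
        using infsumI[OF has_sum_of_real[OF has_sum_infsum[OF s2], where 'a=complex]] unfolding cv by simp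
      moreover have "0 \<le> (\<Sum>\<^sub>\<infinity>k\<in>\<Lambda>. cmod (d (x - k)) * cmod (y k))" by (intro infsum_nonneg) simp
      ultimately show ?thesis by (simp only: norm_of_real abs_of_nonneg)
    qed
    finally show ?thesis .
  qed (simp add: z0)
  have "z \<in> Y \<and> nY z \<le> nY (conv \<Lambda> ?d ?y)"
    using solY c(2) z0 le unfolding solid_def by blast
  moreover have "nA ?d * nY ?y \<le> nA d * nY y"
    using d' y' banA banY d y unfolding banach_seq_space_def by (intro mult_mono) auto
  ultimately show "z \<in> Y" "nY z \<le> nA d * nY y" using c(3) by auto
qed

text \<open>\<open>M(Y)\<close> is an abstract completion, so the extension is expressed through
  coefficients: the last conjunct places the image of \<open>f\<close> in the closure of the
  coefficient sequences of \<open>L0\<close>, and the norm bound extends the operator by density.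
  The first conjunct makes the suprema in \<open>gabor_diag\<close> genuine.\<close>

theorem mainTheorem9:
  fixes T :: "'a::euclidean_space \<times> 'a \<Rightarrow> 'a \<times> 'a"
    and A :: "('a \<times> 'a \<Rightarrow> complex) set" and nA :: "('a \<times> 'a \<Rightarrow> complex) \<Rightarrow> real"
    and Y :: "('a \<times> 'a \<Rightarrow> complex) set" and nY :: "('a \<times> 'a \<Rightarrow> complex) \<Rightarrow> real"
    and g :: "'a \<Rightarrow> complex"
    and \<sigma> :: "('a \<times> 'a \<Rightarrow> complex) \<Rightarrow> complex"
  assumes T: "linear T" "bij T"
    and A: "solid_inv_conv_alg (lat T) A nA"
    and g_WA: "stft g g \<in> borel_measurable lborel"
              "in_WA T A (\<lambda>z. ereal (cmod (stft g g z)))"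
    and frame: "tight_gabor_frame (lat T) g"
    and Y: "banach_seq_space (lat T) Y nY" "solid (lat T) Y nY"
    and Y_fin: "\<forall>b. finite {x. b x \<noteq> 0} \<and> {x. b x \<noteq> 0} \<subseteq> lat T \<longrightarrow> b \<in> Y"
    and Y_dense: "\<forall>c\<in>Y. \<forall>e>0. \<exists>b\<in>Y. finite {x. b x \<noteq> 0} \<and> nY (\<lambda>x. c x - b x) < e"
    and AY: "\<forall>a\<in>A. \<forall>c\<in>Y. conv_ok (lat T) a c \<and> conv (lat T) a c \<in> Y
                 \<and> nY (conv (lat T) a c) \<le> nA a * nY c"
    and \<sigma>_dist: "\<sigma> \<in> S0_dual"
    and \<sigma>_sym: "in_WA T A (grand_symbol \<sigma> (wigner g g) \<circ> jmap)"
  shows "(\<forall>\<mu>\<in>lat T. bdd_above ((\<lambda>l. cmod (gabor_matrix \<sigma> g l (l - \<mu>))) ` lat T))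
       \<and> gabor_diag (lat T) \<sigma> g \<in> A
       \<and> nA (gabor_diag (lat T) \<sigma> g) \<le> WA_norm T nA (grand_symbol \<sigma> (wigner g g) \<circ> jmap)
       \<and> (\<forall>f\<in>L0 (lat T) g.
            weyl_coeff (lat T) \<sigma> g f \<in> Y
          \<and> nY (weyl_coeff (lat T) \<sigma> g f) \<le> nA (gabor_diag (lat T) \<sigma> g) * nY (coeff (lat T) g f)
          \<and> (\<forall>e>0. \<exists>h\<in>L0 (lat T) g.
                nY (\<lambda>l. coeff (lat T) g h l - weyl_coeff (lat T) \<sigma> g f l) < e))"
proof -
  let ?\<Lambda> = "lat T"
  interpret solid_conv_algebra ?\<Lambda> A nA
    by (rule solid_conv_algebra.intro[OF A lat_zero[OF T(1)] lat_add[OF T(1)] lat_neg[OF T(1)]])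
  have solA: "solid ?\<Lambda> A nA" using A by (simp add: solid_inv_conv_alg_def)
  have gL: "g \<in> L2" using frame by (simp add: tight_gabor_frame_def)
  have gS: "g \<in> S0"
    by (rule S0_of_tight_frame[OF frame wiener_amalgam_integrable[OF T A g_WA]])
  note count = countable_lat[of T]

  \<comment> \<open>Local suprema of \<open>stft g g\<close>: the convolution majorant of the Gram
    matrix of the frame.\<close>
  define v where "v = amalg_seq T (\<lambda>z. ereal (cmod (stft g g z)))"
  have vA: "v \<in> A" using g_WA(2) by (simp add: in_WA_def v_def)
  have gram: "cmod (l2_inner (tfs k g) (tfs l g)) \<le> cmod (v (l - k))" if "l \<in> ?\<Lambda>" "k \<in> ?\<Lambda>" for l k
  proof -
    have lk: "l - k \<in> ?\<Lambda>" by (rule diff_mem[OF that])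
    have "ereal (cmod (stft g g (l - k))) \<le> locsup T (\<lambda>z. ereal (cmod (stft g g z))) (l - k)"
      by (rule continuous_le_locsup[OF T]) (intro continuous_intros stft_continuous gL)
    then have "cmod (stft g g (l - k)) \<le> cmod (v (l - k))"
      unfolding v_def using g_WA(2) lk by (intro le_amalg_seq) (auto simp: in_WA_def)
    then show ?thesis using stft_tfs[OF gL gL, of k l] by (simp add: stft_def norm_mult)
  qed

  let ?G = "grand_symbol \<sigma> (wigner g g) \<circ> jmap"
  define w where "w = amalg_seq T ?G"
  have wA: "w \<in> A" using \<sigma>_sym by (simp add: in_WA_def w_def)
  have entry: "cmod (gabor_matrix \<sigma> g l (l - \<mu>)) \<le> cmod (w \<mu>)" if "\<mu> \<in> ?\<Lambda>" for l \<mu>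
    unfolding gabor_matrix_def w_def
    using weyl_pair_le_grand_symbol[OF T \<sigma>_dist gS, of "l - \<mu>" l] \<sigma>_sym that
    by (intro le_amalg_seq) (auto simp: in_WA_def)
  have bdd: "bdd_above ((\<lambda>l. cmod (gabor_matrix \<sigma> g l (l - \<mu>))) ` ?\<Lambda>)" if "\<mu> \<in> ?\<Lambda>" for \<mu>
    using entry[OF that] by (intro bdd_aboveI[of _ "cmod (w \<mu>)"]) auto
  define d where "d = gabor_diag ?\<Lambda> \<sigma> g"
  have dw: "cmod (d \<mu>) \<le> cmod (w \<mu>)" for \<mu>
  proof (cases "\<mu> \<in> ?\<Lambda>")
    case True
    have "(SUP l\<in>?\<Lambda>. cmod (gabor_matrix \<sigma> g l (l - \<mu>))) \<le> cmod (w \<mu>)"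
      using zero_mem entry[OF True] by (intro cSUP_least) auto
    moreover have "0 \<le> (SUP l\<in>?\<Lambda>. cmod (gabor_matrix \<sigma> g l (l - \<mu>)))"
      by (rule cSUP_upper2[OF bdd[OF True] zero_mem]) simp
    ultimately show ?thesis using True by (simp add: d_def gabor_diag_def)
  qed (simp add: d_def gabor_diag_def)
  \<comment> \<open>Solidity turns the entrywise domination by \<open>w\<close> directly into the
    second inequality of the theorem.\<close>
  have dA: "d \<in> A" and nd: "nA d \<le> nA w"
    by (rule solidD[OF wA _ dw]; simp add: d_def gabor_diag_def)+
  have entry_d: "cmod (weyl_pair \<sigma> (tfs k g) (tfs l g)) \<le> cmod (d (l - k))" if l: "l \<in> ?\<Lambda>" and k: "k \<in> ?\<Lambda>" for l k
  proof -
    have lk: "l - k \<in> ?\<Lambda>" by (rule diff_mem[OF l k])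
    \<comment> \<open>The entry with indices l and k lies on the side diagonal \<mu> = l - k, where
      l - \<mu> = k.\<close>
    have "cmod (gabor_matrix \<sigma> g l (l - (l - k))) \<le> (SUP l'\<in>?\<Lambda>. cmod (gabor_matrix \<sigma> g l' (l' - (l - k))))"
      by (rule cSUP_upper[OF l bdd[OF lk]])
    also have "\<dots> \<le> cmod (d (l - k))" using lk by (simp add: d_def gabor_diag_def)
    finally show ?thesis by (simp add: gabor_matrix_def)
  qed

  have sub: "\<forall>x\<in>?\<Lambda>. \<forall>y\<in>?\<Lambda>. x - y \<in> ?\<Lambda>" using diff_mem by blast
  have gram': "\<forall>l\<in>?\<Lambda>. \<forall>k\<in>?\<Lambda>. cmod (l2_inner (tfs k g) (tfs l g)) \<le> cmod (v (l - k))"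
    using gram by blast
  have entry': "\<forall>l\<in>?\<Lambda>. \<forall>k\<in>?\<Lambda>. cmod (weyl_pair \<sigma> (tfs k g) (tfs l g)) \<le> cmod (d (l - k))"
    using entry_d by blast
  note act = kernel_action_bound[OF sub solA Y(2) banach Y(1) AY]
  have coeff_sum: "coeff ?\<Lambda> g (\<lambda>t. \<Sum>m\<in>S. c m * tfs m g t) l = (\<Sum>m\<in>S. l2_inner (tfs m g) (tfs l g) * c m)"
    if "l \<in> ?\<Lambda>" for S c l
    using that by (simp add: coeff_def l2_inner_sum_left L2_scale L2_tfs gL l2_inner_scale_left mult.commute)
  have finite_sum: "(\<Sum>m\<in>S. l2_inner (tfs m g) (tfs l g) * c m)
      = (\<Sum>\<^sub>\<infinity>k\<in>?\<Lambda>. l2_inner (tfs k g) (tfs l g) * (if k \<in> S then c k else 0))"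
    if S: "finite S" "S \<subseteq> ?\<Lambda>" for S c l
  proof -
    have "(\<Sum>\<^sub>\<infinity>k\<in>?\<Lambda>. l2_inner (tfs k g) (tfs l g) * (if k \<in> S then c k else 0))
        = (\<Sum>\<^sub>\<infinity>k\<in>S. l2_inner (tfs k g) (tfs l g) * c k)"
      using S by (intro infsum_cong_neutral) auto
    then show ?thesis using S by simp
  qed
  have gram_summable: "(\<lambda>l. cmod (l2_inner (tfs k g) (tfs l g))) summable_on ?\<Lambda>" if k: "k \<in> ?\<Lambda>" for k
  proof (rule summable_on_comparison_test)
    have inj: "inj_on (\<lambda>l. l - k) ?\<Lambda>" by (auto simp: inj_on_def)
    have "(\<lambda>x. cmod (v x)) summable_on (\<lambda>l. l - k) ` ?\<Lambda>"
      by (rule summable_on_subset_banach[OF abs_summable[OF vA]]) (use diff_mem k in blast)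
    then show "(\<lambda>l. cmod (v (l - k))) summable_on ?\<Lambda>"
      unfolding summable_on_reindex[OF inj] by (simp add: comp_def)
  qed (use gram[OF _ k] in simp_all)

  have main: "weyl_coeff ?\<Lambda> \<sigma> g f \<in> Y
      \<and> nY (weyl_coeff ?\<Lambda> \<sigma> g f) \<le> nA d * nY (coeff ?\<Lambda> g f)
      \<and> (\<forall>e>0. \<exists>h\<in>L0 ?\<Lambda> g. nY (\<lambda>l. coeff ?\<Lambda> g h l - weyl_coeff ?\<Lambda> \<sigma> g f l) < e)"
    if fL0: "f \<in> L0 ?\<Lambda> g" for f
  proof -
    obtain S c where S: "finite S" "S \<subseteq> ?\<Lambda>" and f: "f = (\<lambda>t. \<Sum>m\<in>S. c m * tfs m g t)"
      using fL0 unfolding L0_def by blast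
    have fS: "f \<in> S0" unfolding f by (intro S0_sum S0_scale S0_tfs gS)
    obtain D where D: "\<And>u h. u \<in> S0 \<Longrightarrow> h \<in> S0 \<Longrightarrow> cmod (weyl_pair \<sigma> u h) \<le> D * S0_norm u * S0_norm h"
      using weyl_pair_bounded[OF \<sigma>_dist] by blast
    let ?cf = "coeff ?\<Lambda> g f" and ?y = "weyl_coeff ?\<Lambda> \<sigma> g f"

    \<comment> \<open>The scalars that build \<open>f\<close>, extended by zero. The frame
      coefficients of \<open>f\<close> are the Gram matrix applied to them; they may have infinite
      support, so their membership in \<open>Y\<close> needs the action of \<open>v\<close>.\<close>
    let ?c = "\<lambda>k. if k \<in> S then c k else 0"
    have cY: "?c \<in> Y"
    proof (rule Y_fin[rule_format], rule conjI)
      have "{x. ?c x \<noteq> 0} \<subseteq> S" by auto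
      then show "finite {x. ?c x \<noteq> 0}" "{x. ?c x \<noteq> 0} \<subseteq> ?\<Lambda>"
        using S finite_subset by blast+
    qed
    have cf0: "\<forall>l. l \<notin> ?\<Lambda> \<longrightarrow> ?cf l = 0" by (simp add: coeff_def)
    have cf_eq: "\<forall>l\<in>?\<Lambda>. ?cf l = (\<Sum>\<^sub>\<infinity>k\<in>?\<Lambda>. l2_inner (tfs k g) (tfs l g) * ?c k)"
    proof
      fix l assume l: "l \<in> ?\<Lambda>"
      show "?cf l = (\<Sum>\<^sub>\<infinity>k\<in>?\<Lambda>. l2_inner (tfs k g) (tfs l g) * ?c k)"
        unfolding f coeff_sum[OF l] by (rule finite_sum[OF S])
    qed
    note cfY = act(1)[OF vA cY gram' cf0 cf_eq]
    have cf_summable: "(\<lambda>m. cmod (l2_inner f (tfs m g))) summable_on ?\<Lambda>"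
    proof (rule summable_on_comparison_test)
      show "(\<lambda>m. \<Sum>k\<in>S. cmod (c k) * cmod (l2_inner (tfs k g) (tfs m g))) summable_on ?\<Lambda>"
        using S by (induction S rule: finite_induct) (simp_all add: summable_on_add summable_on_cmult_right gram_summable)
      fix m assume "m \<in> ?\<Lambda>"
      then have "l2_inner f (tfs m g) = (\<Sum>k\<in>S. l2_inner (tfs k g) (tfs m g) * c k)"
        using coeff_sum[of m c S] by (simp add: coeff_def f)
      then show "cmod (l2_inner f (tfs m g)) \<le> (\<Sum>k\<in>S. cmod (c k) * cmod (l2_inner (tfs k g) (tfs m g)))"
        by (simp add: sum_norm_le norm_mult mult.commute)
    qed simp

    \<comment> \<open>Expanding \<open>f\<close> in the frame inside the first argument exhibits the
      coefficients of the image as the matrix of the symbol applied to those of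
      \<open>f\<close>.\<close>
    have y_eq: "?y l = (\<Sum>\<^sub>\<infinity>k\<in>?\<Lambda>. weyl_pair \<sigma> (tfs k g) (tfs l g) * ?cf k)" if l: "l \<in> ?\<Lambda>" for l
    proof -
      have "((\<lambda>m. l2_inner f (tfs m g) * weyl_pair \<sigma> (tfs m g) (tfs l g)) has_sum weyl_pair \<sigma> f (tfs l g)) ?\<Lambda>"
      proof (rule frame_expansion_functional[OF frame gS count fS cf_summable])
        show "cmod (weyl_pair \<sigma> u (tfs l g)) \<le> D * S0_norm g * S0_norm u" if "u \<in> S0" for u
          using D[OF that S0_tfs[OF gS, of l]] by (simp add: S0_norm_tfs[OF gS] mult_ac)
      qed (auto intro: weyl_pair_add_left weyl_pair_scale_left \<sigma>_dist S0_tfs gS)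
      from infsumI[OF this] have "?y l = (\<Sum>\<^sub>\<infinity>m\<in>?\<Lambda>. l2_inner f (tfs m g) * weyl_pair \<sigma> (tfs m g) (tfs l g))"
        using l by (simp add: weyl_coeff_def)
      also have "\<dots> = (\<Sum>\<^sub>\<infinity>k\<in>?\<Lambda>. weyl_pair \<sigma> (tfs k g) (tfs l g) * ?cf k)"
        by (rule infsum_cong) (simp add: coeff_def)
      finally show ?thesis .
    qed
    have y0: "?y l = 0" if "l \<notin> ?\<Lambda>" for l using that by (simp add: weyl_coeff_def)
    have y0': "\<forall>l. l \<notin> ?\<Lambda> \<longrightarrow> ?y l = 0" using y0 by blast
    have y_eq': "\<forall>l\<in>?\<Lambda>. ?y l = (\<Sum>\<^sub>\<infinity>k\<in>?\<Lambda>. weyl_pair \<sigma> (tfs k g) (tfs l g) * ?cf k)" using y_eq by blast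
    note yY = act(1)[OF dA cfY entry' y0' y_eq'] and ny = act(2)[OF dA cfY entry' y0' y_eq']

    \<comment> \<open>Expanding the second argument \<open>tfs l g\<close> instead shows that the
      coefficients reproduce themselves under the Gram matrix. The pairing is antilinear there,
      hence the conjugations.\<close>
    have y_gram: "((\<lambda>m. l2_inner (tfs m g) (tfs l g) * ?y m) has_sum ?y l) ?\<Lambda>" if l: "l \<in> ?\<Lambda>" for l
    proof -
      have "((\<lambda>m. l2_inner (tfs l g) (tfs m g) * cnj (weyl_pair \<sigma> f (tfs m g))) has_sum cnj (weyl_pair \<sigma> f (tfs l g))) ?\<Lambda>"
      proof (rule frame_expansion_functional[OF frame gS count S0_tfs[OF gS] gram_summable[OF l]])
        show "cmod (cnj (weyl_pair \<sigma> f u)) \<le> D * S0_norm f * S0_norm u" if "u \<in> S0" for u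
          using D[OF fS that] by simp
      qed (auto simp: weyl_pair_add_right weyl_pair_scale_right \<sigma>_dist fS)
      then have "((\<lambda>m. cnj (l2_inner (tfs l g) (tfs m g) * cnj (weyl_pair \<sigma> f (tfs m g)))) has_sum cnj (cnj (weyl_pair \<sigma> f (tfs l g)))) ?\<Lambda>"
        by (simp only: has_sum_cnj_iff)
      then have "((\<lambda>m. l2_inner (tfs m g) (tfs l g) * weyl_pair \<sigma> f (tfs m g)) has_sum ?y l) ?\<Lambda>"
        using l by (simp add: l2_inner_cnj weyl_coeff_def)
      then show ?thesis
        by (rule has_sum_cong[THEN iffD1, rotated]) (simp add: weyl_coeff_def)
    qed
    have "\<exists>h\<in>L0 ?\<Lambda> g. nY (\<lambda>l. coeff ?\<Lambda> g h l - ?y l) < e" if e: "e > 0" for e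
    proof -
      have nv: "nA v + 1 > 0" using norm_nonneg[OF vA] by linarith
      define e' where "e' = e / (nA v + 1)"
      have e': "e' > 0" using e nv by (simp add: e'_def)
      obtain b where bY: "b \<in> Y" and fb: "finite {x. b x \<noteq> 0}" and nb: "nY (\<lambda>x. ?y x - b x) < e'"
        using Y_dense yY e' by blast
      have sb: "{x. b x \<noteq> 0} \<subseteq> ?\<Lambda>" using Y(1) bY unfolding banach_seq_space_def by blast
      let ?B = "{x. b x \<noteq> 0}"
      \<comment> \<open>Its coefficients are the Gram matrix applied to \<open>b\<close>, and
        \<open>?y\<close> is the Gram matrix applied to itself. So the error is the Gram matrix
        applied to \<open>?u\<close>, whose norm is at most \<open>nA v\<close> times that of
        \<open>?u\<close>.\<close>
      let ?h = "\<lambda>t. \<Sum>m\<in>?B. b m * tfs m g t"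
      let ?u = "\<lambda>x. b x - ?y x"
      have Yscale: "(\<lambda>x. r * a x) \<in> Y" "nY (\<lambda>x. r * a x) = cmod r * nY a" if "a \<in> Y" for r a
        using Y(1) that unfolding banach_seq_space_def by blast+
      have Yadd: "(\<lambda>x. a x + a' x) \<in> Y" if "a \<in> Y" "a' \<in> Y" for a a'
        using Y(1) that unfolding banach_seq_space_def by blast
      have uY: "?u \<in> Y" using Yadd[OF bY Yscale(1)[OF yY, of "-1"]] by simp
      have nu: "nY ?u < e'" using Yscale(2)[OF uY, of "-1"] nb by simp
      have "nY (\<lambda>l. coeff ?\<Lambda> g ?h l - ?y l) \<le> nA v * nY ?u"
      proof (rule act(2)[OF vA uY gram']; intro allI impI ballI)
        show "coeff ?\<Lambda> g ?h l - ?y l = 0" if "l \<notin> ?\<Lambda>" for l using that by (simp add: coeff_def weyl_coeff_def)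
        fix l assume l: "l \<in> ?\<Lambda>"
        have "((\<lambda>k. l2_inner (tfs k g) (tfs l g) * b k) has_sum coeff ?\<Lambda> g ?h l) ?\<Lambda>"
          unfolding coeff_sum[OF l]
          by (rule has_sum_finite_neutralI[OF fb sb]) auto
        from has_sum_add[OF this has_sum_cmult_right[OF y_gram[OF l], of "-1"]]
        have "((\<lambda>k. l2_inner (tfs k g) (tfs l g) * ?u k) has_sum (coeff ?\<Lambda> g ?h l - ?y l)) ?\<Lambda>"
          by (simp add: right_diff_distrib)
        then show "coeff ?\<Lambda> g ?h l - ?y l = (\<Sum>\<^sub>\<infinity>k\<in>?\<Lambda>. l2_inner (tfs k g) (tfs l g) * ?u k)"
          by (rule infsumI[symmetric])
      qed
      also have "\<dots> \<le> nA v * e'" using nu norm_nonneg[OF vA] by (intro mult_left_mono) auto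
      also have "\<dots> < (nA v + 1) * e'" using e' by simp
      also have "\<dots> = e" using nv by (simp add: e'_def)
      finally have "nY (\<lambda>l. coeff ?\<Lambda> g ?h l - ?y l) < e" .
      moreover have "?h \<in> L0 ?\<Lambda> g" using fb sb unfolding L0_def by blast
      ultimately show ?thesis by blast
    qed
    then show ?thesis using yY ny by blast
  qed
  show ?thesis
    unfolding WA_norm_def
  proof (rule conjI[OF _ conjI[OF _ conjI]])
    show "\<forall>\<mu>\<in>?\<Lambda>. bdd_above ((\<lambda>l. cmod (gabor_matrix \<sigma> g l (l - \<mu>))) ` ?\<Lambda>)"
      by (rule ballI) (rule bdd)
    show "gabor_diag ?\<Lambda> \<sigma> g \<in> A" using dA by (simp only: d_def)
    show "nA (gabor_diag ?\<Lambda> \<sigma> g) \<le> nA (amalg_seq T ?G)" using nd by (simp only: d_def w_def)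
  qed (rule ballI, rule main[unfolded d_def])
qed

end
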